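(* Let $G$ be a finitely generated group. Then: (1) If $H$ is a strongly quasiconvex subgroup of $G$, then the inclusion $i:H\hookrightarrow G$ induces a topological embedding $\hat{i}:\partial_M H\to\partial_M G$ of the Morse boundary of $H$ into the Morse boundary of $G$ such that $\hat{i}(\partial_M H)=\Lambda H$, where $\Lambda H$ is the limit set of $H$ in $\partial_M G$. (2) If $H_1$ and $H_2$ are strongly quasiconvex subgroups of $G$, then $H_1\cap H_2$ is strongly quasiconvex in $G$ and $\Lambda(H_1\cap H_2)=\Lambda H_1\cap\Lambda H_2$.
   Context: A $(K,L)$-quasi-geodesic is a map $c$ from an interval of $\mathbb{R}$ to a metric space with $\frac1K|s-t|-L\le d(c(s),c(t))\le K|s-t|+L$. A subset $A$ of a geodesic space $X$ is Morse with Morse gauge $M$ if for every $K\ge1$, $C\ge0$ every $(K,C)$-quasi-geodesic with endpoints on $A$ lies in the $M(K,C)$-neighborhood of $A$. A subgroup $H$ of a finitely generated group $G$ is strongly quasiconvex if it is a Morse subset of the Cayley graph of $G$ for some (any) finite generating set; such $H$ is finitely generated and undistorted. Morse boundary: let $X$ be a proper geodesic space with basepoint $p$. $\partial_M X_p$ is the set of equivalence classes $[\alpha]$ of Morse geodesic rays $\alpha:[0,\infty)\to X$ with $\alpha(0)=p$, where $\alpha\sim\alpha'$ if $\sup_t d(\alpha(t),\alpha'(t))<\infty$. For a Morse gauge $N$, $\partial_M^N X_p$ is the set of classes containing at least one $N$-Morse geodesic ray starting at $p$. Declare $x_n\to x$ in $\partial_M^NX_p$ if there are $N$-Morse geodesic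 rays $\alpha_n$ from $p$ with $[\alpha_n]=x_n$ such that every subsequence of $(\alpha_n)$ has a further subsequence converging uniformly on compact sets to a geodesic ray $\alpha$ with $[\alpha]=x$; closed sets of $\partial_M^N X_p$ are those closed under such limits. Order Morse gauges pointwise; $\partial_M X_p=\varinjlim_N\partial_M^N X_p$ carries the direct limit topology. It is independent of basepoint and a quasi-isometry invariant, and $\partial_M G$ is the Morse boundary of a Cayley graph of $G$ with respect to a finite generating set. The limit set $\Lambda A$ of a subset $A\subset X$ is the set of points of $\partial_M X_p$ represented by (Morse geodesic) rays based at $p$ that lie in some finite neighborhood of $A$ (for subgroups, $p$ is the identity $e$). The map induced by the inclusion sends $[\alpha]$ to $[\beta]$, where $\beta$ is a Morse geodesic ray from the basepoint at finite Hausdorff distance from the image of $\alpha$. *)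

theory Defs
  imports "HOL-Analysis.Analysis" "HOL-Algebra.Generated_Groups"
begin

section \<open>Morse subsets of metric spaces\<close>

definition quasi_geodesic :: "'p metric \<Rightarrow> real \<Rightarrow> real \<Rightarrow> real set \<Rightarrow> (real \<Rightarrow> 'p) \<Rightarrow> bool" where
  "quasi_geodesic X K L I c \<longleftrightarrow>
     is_interval I \<and> c ` I \<subseteq> mspace X \<and>
     (\<forall>s\<in>I. \<forall>t\<in>I. \<bar>s - t\<bar> / K - L \<le> mdist X (c s) (c t) \<and>
                 mdist X (c s) (c t) \<le> K * \<bar>s - t\<bar> + L)"

definition metric_nbhd :: "'p metric \<Rightarrow> real \<Rightarrow> 'p set \<Rightarrow> 'p set" where
  "metric_nbhd X r A = {x \<in> mspace X. \<exists>a\<in>A. mdist X x a \<le> r}"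

text \<open>A Morse gauge is a function $[1,\infty) \times [0,\infty) \to [0,\infty)$; its values outside
  this domain are irrelevant everywhere below.\<close>

definition morse_gauge :: "(real \<Rightarrow> real \<Rightarrow> real) \<Rightarrow> bool" where
  "morse_gauge N \<longleftrightarrow> (\<forall>K\<ge>1. \<forall>C\<ge>0. 0 \<le> N K C)"

definition morse_with_gauge :: "'p metric \<Rightarrow> (real \<Rightarrow> real \<Rightarrow> real) \<Rightarrow> 'p set \<Rightarrow> bool" where
  "morse_with_gauge X N A \<longleftrightarrow>
     A \<subseteq> mspace X \<and>
     (\<forall>K\<ge>1. \<forall>C\<ge>0. \<forall>a b c.
        a \<le> b \<and> quasi_geodesic X K C {a..b} c \<and> c a \<in> A \<and> c b \<in> A \<longrightarrow>
        c ` {a..b} \<subseteq> metric_nbhd X (N K C) A)"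

definition morse_subset :: "'p metric \<Rightarrow> 'p set \<Rightarrow> bool" where
  "morse_subset X A \<longleftrightarrow> (\<exists>N. morse_gauge N \<and> morse_with_gauge X N A)"

definition finite_hausdorff_distance :: "'p metric \<Rightarrow> 'p set \<Rightarrow> 'p set \<Rightarrow> bool" where
  "finite_hausdorff_distance X A B \<longleftrightarrow>
     (\<exists>r. A \<subseteq> metric_nbhd X r B \<and> B \<subseteq> metric_nbhd X r A)"


section \<open>The Morse boundary\<close>

text \<open>Rays are functions on all of \<open>real\<close> of which only the restriction to \<open>{0..}\<close> matters;
  a point of the boundary is the set of all functions representing it.\<close>

definition geodesic_ray :: "'p metric \<Rightarrow> 'p \<Rightarrow> (real \<Rightarrow> 'p) \<Rightarrow> bool" where
  "geodesic_ray X p \<alpha> \<longleftrightarrow>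
     \<alpha> ` {0..} \<subseteq> mspace X \<and> \<alpha> 0 = p \<and>
     (\<forall>s\<ge>0. \<forall>t\<ge>0. mdist X (\<alpha> s) (\<alpha> t) = \<bar>s - t\<bar>)"

definition morse_rays :: "'p metric \<Rightarrow> 'p \<Rightarrow> (real \<Rightarrow> 'p) set" where
  "morse_rays X p = {\<alpha>. geodesic_ray X p \<alpha> \<and> morse_subset X (\<alpha> ` {0..})}"

definition asymptotic_rel :: "'p metric \<Rightarrow> 'p \<Rightarrow> ((real \<Rightarrow> 'p) \<times> (real \<Rightarrow> 'p)) set" where
  "asymptotic_rel X p =
     {(\<alpha>, \<beta>). \<alpha> \<in> morse_rays X p \<and> \<beta> \<in> morse_rays X p \<and>
              bdd_above ((\<lambda>t. mdist X (\<alpha> t) (\<beta> t)) ` {0..})}"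

definition boundary_points :: "'p metric \<Rightarrow> 'p \<Rightarrow> (real \<Rightarrow> 'p) set set" where
  "boundary_points X p = morse_rays X p // asymptotic_rel X p"

definition boundary_stratum ::
    "'p metric \<Rightarrow> 'p \<Rightarrow> (real \<Rightarrow> real \<Rightarrow> real) \<Rightarrow> (real \<Rightarrow> 'p) set set" where
  "boundary_stratum X p N =
     {x \<in> boundary_points X p. \<exists>\<alpha>\<in>x. morse_with_gauge X N (\<alpha> ` {0..})}"

definition converges_on_compacta ::
    "'p metric \<Rightarrow> (nat \<Rightarrow> real \<Rightarrow> 'p) \<Rightarrow> (real \<Rightarrow> 'p) \<Rightarrow> bool" where
  "converges_on_compacta X \<alpha> \<beta> \<longleftrightarrow>
     (\<forall>C. compact C \<and> C \<subseteq> {0..} \<longrightarrow>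
        (\<forall>e>0. \<forall>\<^sub>F n in sequentially. \<forall>t\<in>C. mdist X (\<alpha> n t) (\<beta> t) < e))"

definition stratum_converges :: "'p metric \<Rightarrow> 'p \<Rightarrow> (real \<Rightarrow> real \<Rightarrow> real) \<Rightarrow>
    (nat \<Rightarrow> (real \<Rightarrow> 'p) set) \<Rightarrow> (real \<Rightarrow> 'p) set \<Rightarrow> bool" where
  "stratum_converges X p N x y \<longleftrightarrow>
     range x \<subseteq> boundary_stratum X p N \<and> y \<in> boundary_stratum X p N \<and>
     (\<exists>\<alpha>. (\<forall>n. \<alpha> n \<in> x n \<and> morse_with_gauge X N (\<alpha> n ` {0..})) \<and>
          (\<forall>r. strict_mono (r :: nat \<Rightarrow> nat) \<longrightarrow>
             (\<exists>s \<beta>. strict_mono (s :: nat \<Rightarrow> nat) \<and> \<beta> \<in> y \<and>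
                    converges_on_compacta X (\<lambda>n. \<alpha> (r (s n))) \<beta>)))"

definition stratum_closed ::
    "'p metric \<Rightarrow> 'p \<Rightarrow> (real \<Rightarrow> real \<Rightarrow> real) \<Rightarrow> (real \<Rightarrow> 'p) set set \<Rightarrow> bool" where
  "stratum_closed X p N C \<longleftrightarrow>
     C \<subseteq> boundary_stratum X p N \<and>
     (\<forall>x y. range x \<subseteq> C \<and> stratum_converges X p N x y \<longrightarrow> y \<in> C)"

definition stratum_topology ::
    "'p metric \<Rightarrow> 'p \<Rightarrow> (real \<Rightarrow> real \<Rightarrow> real) \<Rightarrow> (real \<Rightarrow> 'p) set topology" where
  "stratum_topology X p N =
     topology (\<lambda>U. U \<subseteq> boundary_stratum X p N \<and> stratum_closed X p N (boundary_stratum X p N - U))"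

text \<open>The strata are subsets of the boundary that exhaust it and are directed by inclusion, so the
  direct limit topology is the finest topology making all inclusions of strata continuous.\<close>

definition morse_boundary :: "'p metric \<Rightarrow> 'p \<Rightarrow> (real \<Rightarrow> 'p) set topology" where
  "morse_boundary X p =
     topology (\<lambda>U. U \<subseteq> boundary_points X p \<and>
       (\<forall>N. morse_gauge N \<longrightarrow> openin (stratum_topology X p N) (U \<inter> boundary_stratum X p N)))"

definition limit_set :: "'p metric \<Rightarrow> 'p \<Rightarrow> 'p set \<Rightarrow> (real \<Rightarrow> 'p) set set" where
  "limit_set X p A = {x \<in> boundary_points X p. \<exists>\<alpha>\<in>x. \<exists>r. \<alpha> ` {0..} \<subseteq> metric_nbhd X r A}"

lemma stratum_converges_subseq:
  assumes "stratum_converges X p N x y" and q: "strict_mono (q :: nat \<Rightarrow> nat)"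
  shows "stratum_converges X p N (x \<circ> q) y"
proof -
  from assms(1) obtain \<alpha> where a: "\<And>n. \<alpha> n \<in> x n \<and> morse_with_gauge X N (\<alpha> n ` {0..})"
    and c: "\<And>r. strict_mono (r :: nat \<Rightarrow> nat) \<Longrightarrow>
             \<exists>s \<beta>. strict_mono (s :: nat \<Rightarrow> nat) \<and> \<beta> \<in> y \<and>
                    converges_on_compacta X (\<lambda>n. \<alpha> (r (s n))) \<beta>"
    unfolding stratum_converges_def by blast
  have "\<exists>s \<beta>. strict_mono (s :: nat \<Rightarrow> nat) \<and> \<beta> \<in> y \<and>
                    converges_on_compacta X (\<lambda>n. (\<alpha> \<circ> q) (r (s n))) \<beta>"
    if "strict_mono (r :: nat \<Rightarrow> nat)" for r
    using c[of "q \<circ> r"] strict_mono_o[OF q that] by simp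
  moreover have "\<And>n. (\<alpha> \<circ> q) n \<in> (x \<circ> q) n \<and> morse_with_gauge X N ((\<alpha> \<circ> q) n ` {0..})"
    using a by simp
  moreover have "range (x \<circ> q) \<subseteq> boundary_stratum X p N \<and> y \<in> boundary_stratum X p N"
    using assms(1) unfolding stratum_converges_def by auto
  ultimately show ?thesis
    unfolding stratum_converges_def by blast
qed

lemma stratum_closed_Un:
  assumes "stratum_closed X p N C" "stratum_closed X p N D"
  shows "stratum_closed X p N (C \<union> D)"
proof -
  have "y \<in> C \<union> D" if x: "range x \<subseteq> C \<union> D" and c: "stratum_converges X p N x y" for x y
  proof -
    have "infinite {n. x n \<in> C} \<or> infinite {n. x n \<in> D}"
    proof (rule ccontr)
      assume "\<not> ?thesis"
      then have "finite ({n. x n \<in> C} \<union> {n. x n \<in> D})" by simp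
      moreover have "{n. x n \<in> C} \<union> {n. x n \<in> D} = UNIV" using x by auto
      ultimately show False by simp
    qed
    then obtain E where E: "E = C \<or> E = D" "infinite {n. x n \<in> E}" by blast
    obtain q :: "nat \<Rightarrow> nat" where q: "strict_mono q" "\<And>n. q n \<in> {n. x n \<in> E}"
      using infinite_enumerate[OF E(2)] by blast
    have "range (x \<circ> q) \<subseteq> E" using q(2) by auto
    then have "y \<in> E"
      using E(1) assms stratum_converges_subseq[OF c q(1)] unfolding stratum_closed_def by blast
    then show ?thesis using E(1) by blast
  qed
  then show ?thesis using assms unfolding stratum_closed_def by blast
qed

lemma openin_stratum_topology:
  "openin (stratum_topology X p N) U \<longleftrightarrow>
     U \<subseteq> boundary_stratum X p N \<and> stratum_closed X p N (boundary_stratum X p N - U)"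
proof -
  let ?B = "boundary_stratum X p N"
  have "istopology (\<lambda>U. U \<subseteq> ?B \<and> stratum_closed X p N (?B - U))"
    unfolding istopology_def
  proof (intro conjI allI impI)
    fix S T
    assume a: "S \<subseteq> ?B \<and> stratum_closed X p N (?B - S)" "T \<subseteq> ?B \<and> stratum_closed X p N (?B - T)"
    then show "S \<inter> T \<subseteq> ?B" by blast
    show "stratum_closed X p N (?B - S \<inter> T)"
      using a stratum_closed_Un[of X p N "?B - S" "?B - T"] by (simp add: Diff_Int)
  next
    fix \<K>
    assume a: "\<forall>K\<in>\<K>. K \<subseteq> ?B \<and> stratum_closed X p N (?B - K)"
    then show "\<Union>\<K> \<subseteq> ?B" by blast
    have "y \<in> ?B - \<Union>\<K>" if "range x \<subseteq> ?B - \<Union>\<K>" "stratum_converges X p N x y" for x y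
    proof -
      have "y \<in> ?B" using that(2) unfolding stratum_converges_def by blast
      moreover have "y \<notin> K" if "K \<in> \<K>" for K
        using a \<open>range x \<subseteq> ?B - \<Union>\<K>\<close> \<open>stratum_converges X p N x y\<close> that
        unfolding stratum_closed_def by blast
      ultimately show ?thesis by blast
    qed
    then show "stratum_closed X p N (?B - \<Union>\<K>)"
      unfolding stratum_closed_def by blast
  qed
  then show ?thesis by (simp add: stratum_topology_def topology_inverse')
qed

lemma topspace_stratum_topology: "topspace (stratum_topology X p N) = boundary_stratum X p N"
proof -
  have "openin (stratum_topology X p N) (boundary_stratum X p N)"
    by (auto simp: openin_stratum_topology stratum_closed_def)
  then show ?thesis
    by (meson openin_stratum_topology openin_subset openin_topspace subset_antisym)
qed

lemma openin_morse_boundary: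
  "openin (morse_boundary X p) U \<longleftrightarrow> U \<subseteq> boundary_points X p \<and>
     (\<forall>N. morse_gauge N \<longrightarrow> openin (stratum_topology X p N) (U \<inter> boundary_stratum X p N))"
proof -
  define P where "P U \<longleftrightarrow> U \<subseteq> boundary_points X p \<and>
     (\<forall>N. morse_gauge N \<longrightarrow> openin (stratum_topology X p N) (U \<inter> boundary_stratum X p N))" for U
  have Int: "P (S \<inter> T)" if "P S" "P T" for S T
  proof -
    have "openin (stratum_topology X p N) (S \<inter> T \<inter> boundary_stratum X p N)" if "morse_gauge N" for N
    proof -
      have "S \<inter> T \<inter> boundary_stratum X p N = (S \<inter> boundary_stratum X p N) \<inter> (T \<inter> boundary_stratum X p N)"
        by blast
      then show ?thesis
        using \<open>P S\<close> \<open>P T\<close> that unfolding P_def by (metis openin_Int)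
    qed
    moreover have "S \<inter> T \<subseteq> boundary_points X p" using that(1) unfolding P_def by blast
    ultimately show ?thesis by (simp add: P_def)
  qed
  have Un: "P (\<Union>\<K>)" if "\<And>K. K \<in> \<K> \<Longrightarrow> P K" for \<K>
  proof -
    have "openin (stratum_topology X p N) (\<Union>\<K> \<inter> boundary_stratum X p N)" if "morse_gauge N" for N
    proof -
      have "openin (stratum_topology X p N) (\<Union>K\<in>\<K>. K \<inter> boundary_stratum X p N)"
        using \<open>\<And>K. K \<in> \<K> \<Longrightarrow> P K\<close> that unfolding P_def by (intro openin_Union) auto
      moreover have "\<Union>\<K> \<inter> boundary_stratum X p N = (\<Union>K\<in>\<K>. K \<inter> boundary_stratum X p N)" by blast
      ultimately show ?thesis by metis
    qed
    moreover have "\<Union>\<K> \<subseteq> boundary_points X p" using that unfolding P_def by blast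
    ultimately show ?thesis by (simp add: P_def)
  qed
  have "istopology P" unfolding istopology_def by (simp add: Int Un)
  moreover have "morse_boundary X p = topology P"
    unfolding morse_boundary_def by (rule arg_cong[where f = topology]) (simp add: fun_eq_iff P_def)
  ultimately show ?thesis using P_def by (simp add: topology_inverse')
qed

lemma topspace_morse_boundary: "topspace (morse_boundary X p) = boundary_points X p"
proof -
  have "boundary_points X p \<inter> boundary_stratum X p N = topspace (stratum_topology X p N)" for N
    by (auto simp: topspace_stratum_topology boundary_stratum_def)
  then have "openin (morse_boundary X p) (boundary_points X p)"
    unfolding openin_morse_boundary by simp
  then show ?thesis
    by (meson openin_morse_boundary openin_subset openin_topspace subset_antisym)
qed


section \<open>Cayley graphs\<close>

definition finite_generating_set :: "('a, 'b) monoid_scheme \<Rightarrow> 'a set \<Rightarrow> bool" where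
  "finite_generating_set G S \<longleftrightarrow> finite S \<and> S \<subseteq> carrier G \<and> generate G S = carrier G"

text \<open>The (right) Cayley graph is taken as an undirected simple graph.\<close>

definition cayley_adj :: "('a, 'b) monoid_scheme \<Rightarrow> 'a set \<Rightarrow> 'a \<Rightarrow> 'a \<Rightarrow> bool" where
  "cayley_adj G S u v \<longleftrightarrow>
     u \<in> carrier G \<and> v \<in> carrier G \<and> u \<noteq> v \<and> (\<exists>s\<in>S. v = u \<otimes>\<^bsub>G\<^esub> s \<or> u = v \<otimes>\<^bsub>G\<^esub> s)"

text \<open>Points of the geometric realization are encoded by their barycentric coordinates.\<close>

definition vertex :: "'a \<Rightarrow> 'a \<Rightarrow> real" where
  "vertex u = (\<lambda>g. if g = u then 1 else 0)"

definition edge_point :: "'a \<Rightarrow> 'a \<Rightarrow> real \<Rightarrow> 'a \<Rightarrow> real" where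
  "edge_point u v a = (\<lambda>g. (1 - a) * vertex u g + a * vertex v g)"

definition cayley_points :: "('a, 'b) monoid_scheme \<Rightarrow> 'a set \<Rightarrow> ('a \<Rightarrow> real) set" where
  "cayley_points G S =
     vertex ` carrier G \<union> {edge_point u v a | u v a. cayley_adj G S u v \<and> 0 \<le> a \<and> a \<le> 1}"

text \<open>\<open>cayley_path G S x l y\<close>: some path of length \<open>l\<close> from \<open>x\<close> to \<open>y\<close> is a concatenation of
  finitely many segments, each contained in a closed edge; every edge is isometric to \<open>[0,1]\<close>.\<close>

inductive cayley_path ::
    "('a, 'b) monoid_scheme \<Rightarrow> 'a set \<Rightarrow> ('a \<Rightarrow> real) \<Rightarrow> real \<Rightarrow> ('a \<Rightarrow> real) \<Rightarrow> bool"
  for G S where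
  refl: "x \<in> cayley_points G S \<Longrightarrow> cayley_path G S x 0 x"
| step: "cayley_path G S x l (edge_point u v a) \<Longrightarrow> cayley_adj G S u v \<Longrightarrow>
         0 \<le> a \<Longrightarrow> a \<le> 1 \<Longrightarrow> 0 \<le> b \<Longrightarrow> b \<le> 1 \<Longrightarrow>
         cayley_path G S x (l + \<bar>a - b\<bar>) (edge_point u v b)"

text \<open>Outside the space the distance is set to \<open>0\<close>, as \<open>Metric_space\<close> requires a distance function
  that is nonnegative and symmetric everywhere.\<close>

definition cayley_dist ::
    "('a, 'b) monoid_scheme \<Rightarrow> 'a set \<Rightarrow> ('a \<Rightarrow> real) \<Rightarrow> ('a \<Rightarrow> real) \<Rightarrow> real" where
  "cayley_dist G S x y =
     (if x \<in> cayley_points G S \<and> y \<in> cayley_points G S then Inf {l. cayley_path G S x l y} else 0)"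

definition cayley_graph :: "('a, 'b) monoid_scheme \<Rightarrow> 'a set \<Rightarrow> ('a \<Rightarrow> real) metric" where
  "cayley_graph G S = metric (cayley_points G S, cayley_dist G S)"

lemma edge_point_ends: "edge_point u v 0 = vertex u" "edge_point u v 1 = vertex v"
  by (auto simp: edge_point_def)

lemma cayley_path_points:
  "cayley_path G S x l y \<Longrightarrow> x \<in> cayley_points G S \<and> y \<in> cayley_points G S"
  by (induction rule: cayley_path.induct) (auto simp: cayley_points_def)

lemma cayley_path_trans:
  assumes "cayley_path G S y m z" "cayley_path G S x l y"
  shows "cayley_path G S x (l + m) z"
  using assms
proof (induction rule: cayley_path.induct)
  case (step y m u v a b)
  then show ?case
    using cayley_path.step[of G S x "l + m" u v a b] by (simp add: add.assoc)
qed simp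

lemma cayley_path_edge:
  assumes "cayley_adj G S u v" "0 \<le> a" "a \<le> 1" "0 \<le> b" "b \<le> 1"
  shows "cayley_path G S (edge_point u v a) \<bar>a - b\<bar> (edge_point u v b)"
proof -
  have "edge_point u v a \<in> cayley_points G S" using assms by (auto simp: cayley_points_def)
  from cayley_path.step[OF cayley_path.refl[OF this] assms] show ?thesis by simp
qed

lemma cayley_path_sym: "cayley_path G S x l y \<Longrightarrow> cayley_path G S y l x"
proof (induction rule: cayley_path.induct)
  case (refl x)
  then show ?case by (rule cayley_path.refl)
next
  case (step x l u v a b)
  have "cayley_path G S (edge_point u v b) \<bar>b - a\<bar> (edge_point u v a)"
    using step by (intro cayley_path_edge) auto
  from cayley_path_trans[OF step.IH this] show ?case by (simp add: abs_minus_commute add.commute)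
qed

lemma cayley_path_coordinate: "cayley_path G S x l y \<Longrightarrow> \<bar>x g - y g\<bar> \<le> l"
proof (induction rule: cayley_path.induct)
  case (step x l u v a b)
  have "edge_point u v a g - edge_point u v b g = (a - b) * (vertex v g - vertex u g)"
    by (simp add: edge_point_def algebra_simps)
  then have "\<bar>edge_point u v a g - edge_point u v b g\<bar> = \<bar>a - b\<bar> * \<bar>vertex v g - vertex u g\<bar>"
    by (simp add: abs_mult)
  also have "\<dots> \<le> \<bar>a - b\<bar> * 1"
    by (intro mult_left_mono) (auto simp: vertex_def)
  finally show ?case
    using step.IH abs_triangle_ineq[of "x g - edge_point u v a g" "edge_point u v a g - edge_point u v b g"]
    by simp
qed simp

lemma cayley_path_exists:
  fixes G (structure)
  assumes "group G" "finite_generating_set G S"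
    and "x \<in> cayley_points G S" "y \<in> cayley_points G S"
  shows "\<exists>l. cayley_path G S x l y"
proof -
  interpret group G by fact
  have S: "S \<subseteq> carrier G" "generate G S = carrier G"
    using assms(2) by (auto simp: finite_generating_set_def)
  have v: "vertex u \<in> cayley_points G S" if "u \<in> carrier G" for u
    using that by (auto simp: cayley_points_def)
  have adj: "\<exists>l. cayley_path G S (vertex u) l (vertex v)" if "cayley_adj G S u v" for u v
    using cayley_path_edge[OF that, of 0 1] by (auto simp: edge_point_ends)
  have one: "\<exists>l. cayley_path G S (vertex u) l (vertex (u \<otimes> s))"
    if u: "u \<in> carrier G" and s: "s \<in> S \<or> inv s \<in> S" "s \<in> carrier G" for u s
  proof (cases "u \<otimes> s = u")
    case True
    then show ?thesis using cayley_path.refl[OF v[OF u]] by auto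
  next
    case False
    have "cayley_adj G S u (u \<otimes> s)"
      using s(1)
    proof
      assume "s \<in> S"
      then show ?thesis using u s(2) False unfolding cayley_adj_def by auto
    next
      assume "inv s \<in> S"
      moreover have "u = u \<otimes> s \<otimes> inv s" using u s(2) by (simp add: m_assoc)
      ultimately show ?thesis using u s(2) False unfolding cayley_adj_def by (metis m_closed)
    qed
    then show ?thesis by (rule adj)
  qed
  have mult: "\<forall>u\<in>carrier G. \<exists>l. cayley_path G S (vertex u) l (vertex (u \<otimes> h))"
    if "h \<in> generate G S" for h
    using that
  proof (induction rule: generate.induct)
    case one
    then show ?case using cayley_path.refl[OF v] by auto
  next
    case (incl h)
    then show ?case using one S(1) by blast
  next
    case (inv h)
    then have "h \<in> carrier G" using S(1) by blast
    then show ?case using one inv by (metis inv_closed inv_inv)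
  next
    case (eng h1 h2)
    then have h: "h1 \<in> carrier G" "h2 \<in> carrier G" using S(2) by auto
    show ?case
    proof
      fix u assume u: "u \<in> carrier G"
      obtain l where "cayley_path G S (vertex u) l (vertex (u \<otimes> h1))" using eng u by blast
      moreover obtain m where "cayley_path G S (vertex (u \<otimes> h1)) m (vertex (u \<otimes> h1 \<otimes> h2))"
        using eng u h by blast
      ultimately show "\<exists>l. cayley_path G S (vertex u) l (vertex (u \<otimes> (h1 \<otimes> h2)))"
        using cayley_path_trans u h by (metis m_assoc)
    qed
  qed
  have base: "\<exists>l. cayley_path G S (vertex \<one>) l z" if "z \<in> cayley_points G S" for z
  proof -
    obtain u l where u: "u \<in> carrier G" "cayley_path G S (vertex u) l z"
    proof (cases "z \<in> vertex ` carrier G")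
      case True
      then show ?thesis using that cayley_path.refl[OF v] by blast
    next
      case False
      then obtain a b t where z: "z = edge_point a b t" "cayley_adj G S a b" "0 \<le> t" "t \<le> 1"
        using \<open>z \<in> cayley_points G S\<close> by (auto simp: cayley_points_def)
      then have "cayley_path G S (vertex a) \<bar>0 - t\<bar> z"
        using cayley_path_edge[OF z(2), of 0 t] z by (simp add: edge_point_ends)
      then show ?thesis using that z(2) by (auto simp: cayley_adj_def)
    qed
    moreover obtain m where "cayley_path G S (vertex \<one>) m (vertex u)"
      using bspec[OF mult[of u], of \<one>] u(1) S(2) by auto
    ultimately show ?thesis using cayley_path_trans by blast
  qed
  show ?thesis
    using base[OF assms(3)] base[OF assms(4)] cayley_path_sym cayley_path_trans by meson
qed

lemma Metric_space_cayley:
  assumes "group G" "finite_generating_set G S"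
  shows "Metric_space (cayley_points G S) (cayley_dist G S)"
proof
  note ex = cayley_path_exists[OF assms]
  have ge0: "0 \<le> l" if "cayley_path G S x l y" for x y l
    using cayley_path_coordinate[OF that, of undefined] by linarith
  have bdd: "bdd_below {l. cayley_path G S x l y}" for x y
    using ge0 by (auto intro!: bdd_belowI[of _ 0])
  show "0 \<le> cayley_dist G S x y" for x y
    unfolding cayley_dist_def using ex[of x y] ge0 by (auto intro: cInf_greatest)
  show "cayley_dist G S x y = cayley_dist G S y x" for x y
    using cayley_path_sym[of G S] by (metis (no_types, lifting) Collect_cong cayley_dist_def)
  show "cayley_dist G S x y = 0 \<longleftrightarrow> x = y"
    if "x \<in> cayley_points G S" "y \<in> cayley_points G S" for x y
  proof
    assume 0: "cayley_dist G S x y = 0"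
    have "\<bar>x g - y g\<bar> \<le> Inf {l. cayley_path G S x l y}" for g
      using ex[OF that] cayley_path_coordinate[of G S x _ y g] by (intro cInf_greatest) auto
    then have "\<bar>x g - y g\<bar> \<le> 0" for g using 0 that by (simp add: cayley_dist_def)
    then show "x = y" by (intro ext) (simp add: abs_le_zero_iff)
  next
    assume "x = y"
    then have "Inf {l. cayley_path G S x l y} \<le> 0"
      using cayley_path.refl[OF that(1)] bdd by (intro cInf_lower) auto
    moreover have "0 \<le> Inf {l. cayley_path G S x l y}"
      using ex[OF that] ge0 by (intro cInf_greatest) auto
    ultimately show "cayley_dist G S x y = 0" by (simp add: cayley_dist_def)
  qed
  show "cayley_dist G S x z \<le> cayley_dist G S x y + cayley_dist G S y z"
    if p: "x \<in> cayley_points G S" "y \<in> cayley_points G S" "z \<in> cayley_points G S" for x y z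
  proof -
    have "Inf {l. cayley_path G S x l z} - m \<le> Inf {l. cayley_path G S x l y}"
      if m: "cayley_path G S y m z" for m
    proof (rule cInf_greatest)
      fix l assume "l \<in> {l. cayley_path G S x l y}"
      then have "Inf {l. cayley_path G S x l z} \<le> l + m"
        using cayley_path_trans[OF m] bdd by (intro cInf_lower) auto
      then show "Inf {l. cayley_path G S x l z} - m \<le> l" by simp
    qed (use ex p in auto)
    then have "Inf {l. cayley_path G S x l z} - Inf {l. cayley_path G S x l y}
        \<le> Inf {l. cayley_path G S y l z}"
      using ex[OF p(2,3)] by (intro cInf_greatest) (auto simp: algebra_simps)
    then show ?thesis using p by (simp add: cayley_dist_def)
  qed
qed

lemma cayley_graph_simps:
  assumes "group G" "finite_generating_set G S"
  shows "mspace (cayley_graph G S) = cayley_points G S"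
    and "mdist (cayley_graph G S) = cayley_dist G S"
  using Metric_space_cayley[OF assms]
  by (simp_all add: cayley_graph_def Metric_space.mspace_metric Metric_space.mdist_metric)


section \<open>Strongly quasiconvex subgroups\<close>

definition strongly_quasiconvex :: "('a, 'b) monoid_scheme \<Rightarrow> 'a set \<Rightarrow> bool" where
  "strongly_quasiconvex G H \<longleftrightarrow>
     subgroup H G \<and> (\<exists>S. finite_generating_set G S \<and> morse_subset (cayley_graph G S) (vertex ` H))"

definition group_boundary :: "('a, 'b) monoid_scheme \<Rightarrow> 'a set \<Rightarrow> (real \<Rightarrow> 'a \<Rightarrow> real) set topology"
  where "group_boundary G S = morse_boundary (cayley_graph G S) (vertex \<one>\<^bsub>G\<^esub>)"

definition group_limit_set ::
    "('a, 'b) monoid_scheme \<Rightarrow> 'a set \<Rightarrow> 'a set \<Rightarrow> (real \<Rightarrow> 'a \<Rightarrow> real) set set" where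
  "group_limit_set G S H = limit_set (cayley_graph G S) (vertex \<one>\<^bsub>G\<^esub>) (vertex ` H)"

text \<open>The inclusion of a subgroup is defined on vertices, so the image of a geodesic ray \<open>\<alpha>\<close> of the
  Cayley graph of \<open>H\<close> in the Cayley graph of \<open>G\<close> is the set of vertices that \<open>\<alpha>\<close> passes through. The
  image of a boundary point is the set of all admissible rays \<open>\<beta>\<close>; that the boundary map is
  well-defined means that this set is again a boundary point.\<close>

definition inclusion_image :: "'a set \<Rightarrow> (real \<Rightarrow> 'a \<Rightarrow> real) \<Rightarrow> ('a \<Rightarrow> real) set" where
  "inclusion_image H \<alpha> = vertex ` {h \<in> H. vertex h \<in> \<alpha> ` {0..}}"

definition induced_boundary_map :: "('a, 'b) monoid_scheme \<Rightarrow> 'a set \<Rightarrow> 'a set \<Rightarrow>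
    (real \<Rightarrow> 'a \<Rightarrow> real) set \<Rightarrow> (real \<Rightarrow> 'a \<Rightarrow> real) set" where
  "induced_boundary_map G S H x =
     {\<beta> \<in> morse_rays (cayley_graph G S) (vertex \<one>\<^bsub>G\<^esub>).
        \<exists>\<alpha>\<in>x. finite_hausdorff_distance (cayley_graph G S) (inclusion_image H \<alpha>) (\<beta> ` {0..})}"

end

theory Submission
  imports Defs "HOL-Library.Diagonal_Subsequence"
begin

text \<open>Quasi-geodesics need not be continuous, so their endpoints can be moved at the cost of the additive
  constant; hence Morse sets are stable under bounded perturbation, pull back along quasi-isometric
  embeddings, and push forward along those with Morse image. A Morse subgroup is finitely generated
  and undistorted, so rounding to vertices is such an embedding \<open>f\<close> of the Cayley graph of \<open>H\<close>. A
  Morse quasi-geodesic ray lies close to a limit of geodesics, with constants depending only on its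
  gauge; this moves rays from \<open>H\<close> to \<open>G\<close> and, for rays that stay close to \<open>H\<close>, back again.

  The boundary map is closed because a geodesic ray in some finite neighbourhood of the Morse set \<open>H\<close>
  already lies in the neighbourhood given by the gauge of \<open>H\<close> at \<open>(3, 5)\<close>: limits in a stratum stay
  in the limit set, and the pulled back rays lie in a single stratum of the boundary of \<open>H\<close>. A closed
  continuous injection is an embedding.

  For intersections, a pigeonhole argument in a finite ball of \<open>G\<close> shows that points close to both
  \<open>H\<^sub>1\<close> and \<open>H\<^sub>2\<close> are close to \<open>H\<^sub>1 \<inter> H\<^sub>2\<close>, for arbitrary subgroups.\<close>

section \<open>Quasi-geodesics and Morse subsets\<close>

text \<open>The topology of the boundary is accessible only through its strata, so every
  construction on rays has to be uniform: from a gauge \<open>N\<close> it must produce one gauge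
  \<open>N'\<close> and one distance that serve all rays with gauge \<open>N\<close> at once. This
  dictates the quantifier order in \<open>morse_quasi_geodesic_ray\<close>, \<open>push_ray\<close>
  and \<open>pull_ray\<close>.

  Closeness of rays (\<open>ray_near\<close>) is one-sided and does not match parameters, because
  rounding to vertices is neither continuous nor length preserving. Closeness at equal times is
  recovered only for geodesic rays with a common start.

  Cayley graphs enter the boundary argument only through \<open>ray_space\<close>. Its compactness
  clause is proved combinatorially: a geodesic from the identity is determined by the vertices at
  integer times, these lie in finite balls, and a diagonal subsequence makes them eventually
  constant.

  The embedding lemma for undistorted subgroups, applied to the whole group as a subgroup of itself,
  also gives the independence of the Morse property from the generating set.\<close>

lemma mdist_self [simp]: "x \<in> mspace X \<Longrightarrow> mdist X x x = 0"
  by simp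

lemma mdist_triangle4:
  assumes "x \<in> mspace X" "y \<in> mspace X" "z \<in> mspace X" "w \<in> mspace X"
  shows "mdist X x w \<le> mdist X x y + mdist X y z + mdist X z w"
  using mdist_triangle[of x X y w] mdist_triangle[of y X z w] assms by linarith

text \<open>With the denominator cleared, both inequalities are monotone in \<open>K\<close> and
  \<open>L\<close>.\<close>

lemma quasi_geodesic_iff:
  assumes "K \<ge> 1"
  shows "quasi_geodesic X K L I c \<longleftrightarrow> is_interval I \<and> (\<forall>s\<in>I. c s \<in> mspace X) \<and>
    (\<forall>s\<in>I. \<forall>t\<in>I. \<bar>s - t\<bar> \<le> K * (mdist X (c s) (c t) + L) \<and>
                mdist X (c s) (c t) \<le> K * \<bar>s - t\<bar> + L)"
proof -
  have "\<bar>s - t\<bar> / K - L \<le> d \<longleftrightarrow> \<bar>s - t\<bar> \<le> K * (d + L)" for s t d :: real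
    using assms by (simp add: field_simps)
  then show ?thesis unfolding quasi_geodesic_def by auto
qed

lemma quasi_geodesicI:
  fixes X :: "'p metric"
  assumes "K \<ge> 1" "L \<ge> 0" "is_interval I" "\<And>s. s \<in> I \<Longrightarrow> c s \<in> mspace X"
    and "\<And>s t. s \<in> I \<Longrightarrow> t \<in> I \<Longrightarrow> s < t \<Longrightarrow> t - s \<le> K * (mdist X (c s) (c t) + L)"
    and "\<And>s t. s \<in> I \<Longrightarrow> t \<in> I \<Longrightarrow> s < t \<Longrightarrow> mdist X (c s) (c t) \<le> K * (t - s) + L"
  shows "quasi_geodesic X K L I c"
proof -
  have "\<bar>s - t\<bar> \<le> K * (mdist X (c s) (c t) + L) \<and> mdist X (c s) (c t) \<le> K * \<bar>s - t\<bar> + L"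
    if "s \<in> I" "t \<in> I" for s t
  proof (cases s t rule: linorder_cases)
    case less
    then show ?thesis using assms(5,6)[OF that less] by (simp add: abs_if)
  next
    case equal
    then show ?thesis using assms(1,2) assms(4)[OF that(1)] by simp
  next
    case greater
    then show ?thesis using assms(5,6)[OF that(2,1) greater] by (simp add: abs_if mdist_commute)
  qed
  then show ?thesis using assms(1,3,4) by (simp add: quasi_geodesic_iff)
qed

lemma quasi_geodesicD:
  assumes "quasi_geodesic X K L I c" "K \<ge> 1" "s \<in> I" "t \<in> I"
  shows "\<bar>s - t\<bar> \<le> K * (mdist X (c s) (c t) + L)"
    and "mdist X (c s) (c t) \<le> K * \<bar>s - t\<bar> + L"
  using assms by (auto simp: quasi_geodesic_iff)

lemma quasi_geodesic_mspace: "quasi_geodesic X K L I c \<Longrightarrow> s \<in> I \<Longrightarrow> c s \<in> mspace X"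
  by (auto simp: quasi_geodesic_def)

lemma quasi_geodesic_weaken:
  assumes "quasi_geodesic X K L I c" "1 \<le> K" "K \<le> K'" "0 \<le> L" "L \<le> L'"
  shows "quasi_geodesic X K' L' I c"
proof (rule quasi_geodesicI)
  fix s t assume st: "s \<in> I" "t \<in> I" "s < t"
  note D = quasi_geodesicD[OF assms(1,2) st(1,2)]
  have "K * (mdist X (c s) (c t) + L) \<le> K' * (mdist X (c s) (c t) + L')"
    using assms by (intro mult_mono) auto
  then show "t - s \<le> K' * (mdist X (c s) (c t) + L')" using D st by simp
  have e: "\<bar>s - t\<bar> = t - s" using st by simp
  have "K * (t - s) \<le> K' * (t - s)" using assms st by (intro mult_right_mono) auto
  then show "mdist X (c s) (c t) \<le> K' * (t - s) + L'"
    using D(2)[unfolded e] assms(5) by linarith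
qed (use assms in \<open>auto simp: quasi_geodesic_def\<close>)

text \<open>Each of the two points in a distance moves by at most \<open>D\<close>, hence
  \<open>2 * D\<close>; the factor \<open>K\<close> is untouched.\<close>

lemma quasi_geodesic_perturb:
  assumes c: "quasi_geodesic X K L I c" and K: "K \<ge> 1" "L \<ge> 0" "D \<ge> 0"
    and c': "\<And>t. t \<in> I \<Longrightarrow> c' t \<in> mspace X" "\<And>t. t \<in> I \<Longrightarrow> mdist X (c t) (c' t) \<le> D"
  shows "quasi_geodesic X K (L + 2 * D) I c'"
proof (rule quasi_geodesicI)
  fix s t assume st: "s \<in> I" "t \<in> I" "s < t"
  note D = quasi_geodesicD[OF c K(1) st(1,2)]
  note m = quasi_geodesic_mspace[OF c st(1)] quasi_geodesic_mspace[OF c st(2)] c'(1)[OF st(1)] c'(1)[OF st(2)]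
  have 1: "mdist X (c s) (c t) \<le> mdist X (c' s) (c' t) + 2 * D"
    using mdist_triangle4[OF m(1,3,4,2)] c'(2)[OF st(1)] c'(2)[OF st(2)] mdist_commute[of X "c t" "c' t"] by linarith
  have 2: "mdist X (c' s) (c' t) \<le> mdist X (c s) (c t) + 2 * D"
    using mdist_triangle4[OF m(3,1,2,4)] c'(2)[OF st(1)] c'(2)[OF st(2)] mdist_commute[of X "c s" "c' s"] by linarith
  have "K * (mdist X (c s) (c t) + L) \<le> K * (mdist X (c' s) (c' t) + (L + 2 * D))"
    using 1 K by (intro mult_left_mono) auto
  then show "t - s \<le> K * (mdist X (c' s) (c' t) + (L + 2 * D))" using D st by simp
  show "mdist X (c' s) (c' t) \<le> K * (t - s) + (L + 2 * D)" using 2 D st by simp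
qed (use c c' K in \<open>auto simp: quasi_geodesic_def\<close>)

section \<open>Quasi-isometric embeddings and transport of quasi-geodesics\<close>

definition qi_embedding :: "'p metric \<Rightarrow> 'q metric \<Rightarrow> real \<Rightarrow> real \<Rightarrow> ('p \<Rightarrow> 'q) \<Rightarrow> bool" where
  "qi_embedding Y X A B f \<longleftrightarrow> 1 \<le> A \<and> 0 \<le> B \<and> f ` mspace Y \<subseteq> mspace X \<and>
     (\<forall>x\<in>mspace Y. \<forall>y\<in>mspace Y. mdist X (f x) (f y) \<le> A * mdist Y x y + B \<and>
                                   mdist Y x y \<le> A * mdist X (f x) (f y) + B)"

lemma qi_embeddingD:
  assumes "qi_embedding Y X A B f"
  shows "1 \<le> A" "0 \<le> B" "x \<in> mspace Y \<Longrightarrow> f x \<in> mspace X"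
    and "x \<in> mspace Y \<Longrightarrow> y \<in> mspace Y \<Longrightarrow> mdist X (f x) (f y) \<le> A * mdist Y x y + B"
    and "x \<in> mspace Y \<Longrightarrow> y \<in> mspace Y \<Longrightarrow> mdist Y x y \<le> A * mdist X (f x) (f y) + B"
  using assms unfolding qi_embedding_def by auto

lemma quasi_geodesic_image:
  assumes f: "qi_embedding Y X A B f" and c: "quasi_geodesic Y K L I c" and K: "K \<ge> 1" "L \<ge> 0"
  shows "quasi_geodesic X (A * K) (A * L + B) I (f \<circ> c)"
proof (rule quasi_geodesicI)
  note A = qi_embeddingD(1,2)[OF f]
  show "1 \<le> A * K" using A K by (simp add: mult_ge1_I)
  show "0 \<le> A * L + B" using A K by simp
  fix s t assume st: "s \<in> I" "t \<in> I" "s < t"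
  note D = quasi_geodesicD[OF c K(1) st(1,2)]
  note m = quasi_geodesic_mspace[OF c st(1)] quasi_geodesic_mspace[OF c st(2)]
  have "mdist X (f (c s)) (f (c t)) \<le> A * mdist Y (c s) (c t) + B"
    by (rule qi_embeddingD(4)[OF f m])
  also have "A * mdist Y (c s) (c t) \<le> A * (K * (t - s) + L)"
    using D A st by (intro mult_left_mono) auto
  finally show "mdist X ((f \<circ> c) s) ((f \<circ> c) t) \<le> A * K * (t - s) + (A * L + B)"
    by (simp add: algebra_simps)
  \<comment> \<open>Since \<open>A \<ge> 1\<close>, the product of \<open>A\<close> and the new
    additive constant \<open>A * L + B\<close> still dominates \<open>L + B\<close>, so one additive
    constant serves both inequalities.\<close>
  have "L \<le> A * L" using A K by (simp add: mult_le_cancel_right1)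
  moreover have "B \<le> A * B" "A * L \<le> A * (A * L)"
    using A K mult_right_mono[of 1 A B] mult_right_mono[of 1 A "A * L"] by auto
  ultimately have "mdist Y (c s) (c t) + L \<le> A * (mdist X (f (c s)) (f (c t)) + (A * L + B))"
    using qi_embeddingD(5)[OF f m] by (simp add: algebra_simps)
  then have "K * (mdist Y (c s) (c t) + L) \<le> K * (A * (mdist X (f (c s)) (f (c t)) + (A * L + B)))"
    using K by (intro mult_left_mono) auto
  then show "t - s \<le> A * K * (mdist X ((f \<circ> c) s) ((f \<circ> c) t) + (A * L + B))"
    using D st by (simp add: algebra_simps)
qed (use c qi_embeddingD(3)[OF f] quasi_geodesic_mspace[OF c] in \<open>auto simp: quasi_geodesic_def\<close>)

text \<open>Stands in for a coarse inverse of \<open>f\<close>: \<open>c'\<close> is any pointwise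
  choice of points whose images are \<open>D\<close>-close to \<open>c\<close>. Once
  \<open>c\<close> is replaced by \<open>f \<circ> c'\<close>, the argument for images applies with
  the two bounds of \<open>f\<close> exchanged.\<close>

lemma quasi_geodesic_lift:
  assumes f: "qi_embedding Y X A B f" and c: "quasi_geodesic X K L I c" and K: "K \<ge> 1" "L \<ge> 0" "D \<ge> 0"
    and c': "\<And>t. t \<in> I \<Longrightarrow> c' t \<in> mspace Y" "\<And>t. t \<in> I \<Longrightarrow> mdist X (c t) (f (c' t)) \<le> D"
  shows "quasi_geodesic Y (A * K) (A * (L + 2 * D) + B) I c'"
proof (rule quasi_geodesicI)
  note A = qi_embeddingD(1,2)[OF f]
  have q: "quasi_geodesic X K (L + 2 * D) I (f \<circ> c')"
    using quasi_geodesic_perturb[OF c K, of "f \<circ> c'"] c' qi_embeddingD(3)[OF f] by auto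
  show "1 \<le> A * K" using A K by (simp add: mult_ge1_I)
  show "0 \<le> A * (L + 2 * D) + B" using A K by simp
  fix s t assume st: "s \<in> I" "t \<in> I" "s < t"
  note D = quasi_geodesicD[OF q K(1) st(1,2)]
  note m = c'(1)[OF st(1)] c'(1)[OF st(2)]
  have "mdist Y (c' s) (c' t) \<le> A * mdist X (f (c' s)) (f (c' t)) + B"
    by (rule qi_embeddingD(5)[OF f m])
  also have "A * mdist X (f (c' s)) (f (c' t)) \<le> A * (K * (t - s) + (L + 2 * D))"
    using D A st by (intro mult_left_mono) auto
  finally show "mdist Y (c' s) (c' t) \<le> A * K * (t - s) + (A * (L + 2 * D) + B)"
    by (simp add: algebra_simps)
  have "L + 2 * D \<le> A * (L + 2 * D)" "A * (L + 2 * D) \<le> A * (A * (L + 2 * D))" "B \<le> A * B"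
    using A K mult_right_mono[of 1 A "L + 2 * D"] mult_right_mono[of 1 A "A * (L + 2 * D)"]
      mult_right_mono[of 1 A B] by auto
  then have "mdist X (f (c' s)) (f (c' t)) + (L + 2 * D)
      \<le> A * (mdist Y (c' s) (c' t) + (A * (L + 2 * D) + B))"
    using qi_embeddingD(4)[OF f m] by (simp add: algebra_simps)
  then have "K * (mdist X (f (c' s)) (f (c' t)) + (L + 2 * D))
      \<le> K * (A * (mdist Y (c' s) (c' t) + (A * (L + 2 * D) + B)))"
    using K by (intro mult_left_mono) auto
  then show "t - s \<le> A * K * (mdist Y (c' s) (c' t) + (A * (L + 2 * D) + B))"
    using D st by (simp add: algebra_simps)
qed (use c c' in \<open>auto simp: quasi_geodesic_def\<close>)

section \<open>Neighbourhoods and stability of the Morse property\<close>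

lemma metric_nbhdI: "x \<in> mspace X \<Longrightarrow> a \<in> A \<Longrightarrow> mdist X x a \<le> r \<Longrightarrow> x \<in> metric_nbhd X r A"
  by (auto simp: metric_nbhd_def)

lemma metric_nbhdE:
  assumes "x \<in> metric_nbhd X r A"
  obtains a where "a \<in> A" "mdist X x a \<le> r" "x \<in> mspace X"
  using assms by (auto simp: metric_nbhd_def)

lemma metric_nbhd_le: "r \<le> r' \<Longrightarrow> metric_nbhd Y r B \<subseteq> metric_nbhd Y r' B"
  by (auto simp: metric_nbhd_def intro: order_trans)

lemma metric_nbhd_mono: "A \<subseteq> B \<Longrightarrow> metric_nbhd X r A \<subseteq> metric_nbhd X r B"
  by (auto simp: metric_nbhd_def)

lemma metric_nbhd_trans:
  assumes "A \<subseteq> metric_nbhd X r B" "B \<subseteq> metric_nbhd X s C" "C \<subseteq> mspace X"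
  shows "A \<subseteq> metric_nbhd X (r + s) C"
proof
  fix x assume "x \<in> A"
  then obtain b where b: "b \<in> B" "mdist X x b \<le> r" "x \<in> mspace X"
    using assms(1) by (auto simp: metric_nbhd_def)
  obtain c where c: "c \<in> C" "mdist X b c \<le> s" "b \<in> mspace X"
    using b assms(2) by (auto simp: metric_nbhd_def)
  have "mdist X x c \<le> r + s" using mdist_triangle[of x X b c] b c assms(3) by auto
  then show "x \<in> metric_nbhd X (r + s) C" using b c by (auto simp: metric_nbhd_def)
qed

lemma morse_with_gaugeD:
  assumes "morse_with_gauge X N A" "K \<ge> 1" "C \<ge> 0" "quasi_geodesic X K C {a..b} c"
    and "c a \<in> A" "c b \<in> A" "t \<in> {a..b}"
  shows "\<exists>x\<in>A. mdist X (c t) x \<le> N K C"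
proof -
  have "c ` {a..b} \<subseteq> metric_nbhd X (N K C) A"
    using assms unfolding morse_with_gauge_def by auto
  then have "c t \<in> metric_nbhd X (N K C) A" using assms(7) by blast
  then show ?thesis by (auto simp: metric_nbhd_def)
qed

text \<open>For \<open>a = b\<close> the only point of the curve lies in \<open>A\<close> itself.
  Having \<open>a < b\<close> is what later allows the two end values of a curve to be reassigned
  independently.\<close>

lemma morse_with_gaugeI:
  assumes "A \<subseteq> mspace X" "\<And>K C. 1 \<le> K \<Longrightarrow> 0 \<le> C \<Longrightarrow> 0 \<le> N K C"
    and "\<And>K C a b c t. 1 \<le> K \<Longrightarrow> 0 \<le> C \<Longrightarrow> a < b \<Longrightarrow> quasi_geodesic X K C {a..b} c \<Longrightarrow>
            c a \<in> A \<Longrightarrow> c b \<in> A \<Longrightarrow> t \<in> {a..b} \<Longrightarrow> \<exists>x\<in>A. mdist X (c t) x \<le> N K C"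
  shows "morse_with_gauge X N A"
  unfolding morse_with_gauge_def
proof (intro conjI assms(1) allI impI image_subsetI)
  fix K C a b :: real and c t
  assume K: "1 \<le> K" "0 \<le> C" and c: "a \<le> b \<and> quasi_geodesic X K C {a..b} c \<and> c a \<in> A \<and> c b \<in> A"
    and t: "t \<in> {a..b}"
  have "\<exists>x\<in>A. mdist X (c t) x \<le> N K C"
  proof (cases "a < b")
    case True
    then show ?thesis using assms(3)[of K C a b c t] K c t by blast
  next
    case False
    then have "t = a" using t by auto
    then show ?thesis using c assms(1,2) K by (intro bexI[of _ "c a"]) auto
  qed
  then show "c t \<in> metric_nbhd X (N K C) A"
    using quasi_geodesic_mspace[of X K C "{a..b}" c t] c t by (auto simp: metric_nbhd_def)
qed

lemma morse_with_gauge_subset: "morse_with_gauge X N A \<Longrightarrow> A \<subseteq> mspace X"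
  by (simp add: morse_with_gauge_def)

text \<open>Moving the endpoints from \<open>B\<close> into \<open>A\<close> raises \<open>C\<close>
  by \<open>2 * D\<close>. The outer \<open>2 * D\<close> pays for the way back: \<open>D\<close>
  from the altered to the original curve and \<open>D\<close> from \<open>A\<close> to
  \<open>B\<close>.\<close>

lemma morse_with_gauge_hausdorff:
  assumes A: "morse_with_gauge X N A" "morse_gauge N"
    and AB: "A \<subseteq> metric_nbhd X D B" "B \<subseteq> metric_nbhd X D A" and B: "B \<subseteq> mspace X" and D: "D \<ge> 0"
  shows "morse_with_gauge X (\<lambda>K C. N K (C + 2 * D) + 2 * D) B"
proof (rule morse_with_gaugeI[OF B])
  show "0 \<le> N K (C + 2 * D) + 2 * D" if "1 \<le> K" "0 \<le> C" for K C
    using A(2) that D unfolding morse_gauge_def by simp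
  fix K C a b :: real and c t
  assume K: "1 \<le> K" "0 \<le> C" and ab: "a < b" and c: "quasi_geodesic X K C {a..b} c"
    and e: "c a \<in> B" "c b \<in> B" and t: "t \<in> {a..b}"
  obtain x where x: "x \<in> A" "mdist X (c a) x \<le> D" using AB(2) e by (auto simp: metric_nbhd_def)
  obtain y where y: "y \<in> A" "mdist X (c b) y \<le> D" using AB(2) e by (auto simp: metric_nbhd_def)
  note As = morse_with_gauge_subset[OF A(1)]
  define c' where "c' = c(a := x, b := y)"
  note m = quasi_geodesic_mspace[OF c]
  have c'm: "c' s \<in> mspace X" if "s \<in> {a..b}" for s
    using that x y m As by (auto simp: c'_def)
  have c'd: "mdist X (c s) (c' s) \<le> D" if "s \<in> {a..b}" for s
    using that x y m D by (auto simp: c'_def)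
  have "quasi_geodesic X K (C + 2 * D) {a..b} c'"
    using quasi_geodesic_perturb[OF c K D] c'm c'd by blast
  then obtain z where z: "z \<in> A" "mdist X (c' t) z \<le> N K (C + 2 * D)"
    using morse_with_gaugeD[OF A(1) K(1), of "C + 2 * D" a b c' t] K D t x y ab by (auto simp: c'_def)
  obtain w where w: "w \<in> B" "mdist X z w \<le> D" using AB(1) z by (auto simp: metric_nbhd_def)
  have "mdist X (c t) w \<le> mdist X (c t) (c' t) + mdist X (c' t) z + mdist X z w"
    using m[OF t] c'm[OF t] z w As B by (intro mdist_triangle4) auto
  then show "\<exists>x\<in>B. mdist X (c t) x \<le> N K (C + 2 * D) + 2 * D"
    using c'd[OF t] z w by (intro bexI[of _ w]) auto
qed

text \<open>The image of a quasi-geodesic with endpoints in \<open>Z\<close> has endpoints in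
  \<open>f\<close>
  Z\<open>; the lower bound of\<close>f\<open>then carries the nearby point of\<close>f
  \<open>Z\<close> back to \<open>Y\<close>.\<close>

lemma morse_with_gauge_pullback:
  assumes f: "qi_embedding Y X A B f" and Z: "Z \<subseteq> mspace Y"
    and N: "morse_with_gauge X N (f ` Z)" "morse_gauge N"
  shows "morse_with_gauge Y (\<lambda>K C. A * N (A * K) (A * C + B) + B) Z"
    and "morse_gauge (\<lambda>K C. A * N (A * K) (A * C + B) + B)"
proof -
  note A = qi_embeddingD(1,2)[OF f]
  have AK: "1 \<le> A * K" "0 \<le> A * C + B" if "1 \<le> K" "0 \<le> C" for K C
    using A that by (simp_all add: mult_ge1_I)
  have nonneg: "0 \<le> A * N (A * K) (A * C + B) + B" if "1 \<le> K" "0 \<le> C" for K C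
    using AK[OF that] A N(2) unfolding morse_gauge_def by simp
  then show "morse_gauge (\<lambda>K C. A * N (A * K) (A * C + B) + B)"
    by (simp add: morse_gauge_def)
  show "morse_with_gauge Y (\<lambda>K C. A * N (A * K) (A * C + B) + B) Z"
  proof (rule morse_with_gaugeI[OF Z nonneg])
    fix K C a b :: real and c t
    assume K: "1 \<le> K" "0 \<le> C" and ab: "a < b" and c: "quasi_geodesic Y K C {a..b} c"
      and e: "c a \<in> Z" "c b \<in> Z" and t: "t \<in> {a..b}"
    obtain z where z: "z \<in> Z" "mdist X (f (c t)) (f z) \<le> N (A * K) (A * C + B)"
      using morse_with_gaugeD[OF N(1) AK[OF K] quasi_geodesic_image[OF f c K] _ _ t] e by auto
    have "mdist Y (c t) z \<le> A * mdist X (f (c t)) (f z) + B"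
      using quasi_geodesic_mspace[OF c t] z Z by (intro qi_embeddingD(5)[OF f]) auto
    also have "A * mdist X (f (c t)) (f z) \<le> A * N (A * K) (A * C + B)"
      using z A by (intro mult_left_mono) auto
    finally show "\<exists>x\<in>Z. mdist Y (c t) x \<le> A * N (A * K) (A * C + B) + B"
      using z by auto
  qed
qed

lemma morse_with_gauge_pushforward:
  assumes f: "qi_embedding Y X A B f" and M: "morse_with_gauge X M (f ` mspace Y)" "morse_gauge M"
    and N: "morse_with_gauge Y N Z" "morse_gauge N"
  defines "N' \<equiv> \<lambda>K C. A * N (A * K) (A * (C + 2 * M K C) + B) + B + M K C"
  shows "morse_with_gauge X N' (f ` Z)" "morse_gauge N'"
proof -
  note A = qi_embeddingD(1,2)[OF f]
  have M0: "0 \<le> M K C" if "1 \<le> K" "0 \<le> C" for K C using M(2) that by (simp add: morse_gauge_def)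
  have AK: "1 \<le> A * K" "0 \<le> A * (C + 2 * M K C) + B" if "1 \<le> K" "0 \<le> C" for K C
    using A that M0[OF that] by (simp_all add: mult_ge1_I)
  have nonneg: "0 \<le> N' K C" if "1 \<le> K" "0 \<le> C" for K C
    using AK[OF that] A N(2) M0[OF that] unfolding morse_gauge_def N'_def by simp
  then show "morse_gauge N'" by (simp add: morse_gauge_def)
  note Z = morse_with_gauge_subset[OF N(1)]
  show "morse_with_gauge X N' (f ` Z)"
  proof (rule morse_with_gaugeI[OF _ nonneg])
    show "f ` Z \<subseteq> mspace X" using Z qi_embeddingD(3)[OF f] by auto
    fix K C a b :: real and c t
    assume K: "1 \<le> K" "0 \<le> C" and ab: "a < b" and c: "quasi_geodesic X K C {a..b} c"
      and e: "c a \<in> f ` Z" "c b \<in> f ` Z" and t: "t \<in> {a..b}"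
    note m = quasi_geodesic_mspace[OF c]
    have "\<exists>y\<in>mspace Y. mdist X (c s) (f y) \<le> M K C" if "s \<in> {a..b}" for s
      using morse_with_gaugeD[OF M(1) K c _ _ that] e Z by auto
    then obtain g where g: "\<And>s. s \<in> {a..b} \<Longrightarrow> g s \<in> mspace Y \<and> mdist X (c s) (f (g s)) \<le> M K C"
      by metis
    obtain x y where x: "x \<in> Z" "c a = f x" and y: "y \<in> Z" "c b = f y" using e by auto
    \<comment> \<open>The two end values are reset so that the lift starts and ends exactly in
      \<open>Z\<close>; elsewhere any nearby preimage will do.\<close>
    define c' where "c' = g(a := x, b := y)"
    have c': "c' s \<in> mspace Y" "mdist X (c s) (f (c' s)) \<le> M K C" if "s \<in> {a..b}" for s
      using g[OF that] x y m[OF that] M0[OF K] Z by (auto simp: c'_def)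
    have "quasi_geodesic Y (A * K) (A * (C + 2 * M K C) + B) {a..b} c'"
      using quasi_geodesic_lift[OF f c K M0[OF K]] c' by blast
    then obtain z where z: "z \<in> Z" "mdist Y (c' t) z \<le> N (A * K) (A * (C + 2 * M K C) + B)"
      using morse_with_gaugeD[OF N(1) AK[OF K], of a b c' t] t x y ab by (auto simp: c'_def)
    have zm: "z \<in> mspace Y" using z Z by auto
    have "mdist X (c t) (f z) \<le> mdist X (c t) (f (c' t)) + mdist X (f (c' t)) (f z)"
      using m[OF t] c'(1)[OF t] zm qi_embeddingD(3)[OF f] by (intro mdist_triangle) auto
    also have "mdist X (f (c' t)) (f z) \<le> A * mdist Y (c' t) z + B"
      by (rule qi_embeddingD(4)[OF f c'(1)[OF t] zm])
    also have "A * mdist Y (c' t) z \<le> A * N (A * K) (A * (C + 2 * M K C) + B)"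
      using z A by (intro mult_left_mono) auto
    finally have "mdist X (c t) (f z) \<le> N' K C" using c'(2)[OF t] by (simp add: N'_def)
    then show "\<exists>x\<in>f ` Z. mdist X (c t) x \<le> N' K C" using z by auto
  qed
qed

section \<open>Rays\<close>

text \<open>One direction of Hausdorff closeness. Limits and pushforwards yield only one direction
  at first; \<open>ray_near_sym\<close> supplies the other for quasi-geodesic rays with a common
  start.\<close>

definition ray_near :: "'p metric \<Rightarrow> (real \<Rightarrow> 'p) \<Rightarrow> (real \<Rightarrow> 'p) \<Rightarrow> real \<Rightarrow> bool" where
  "ray_near X c c' D \<longleftrightarrow> (\<forall>t\<ge>0. \<exists>s\<ge>0. mdist X (c t) (c' s) \<le> D)"

lemma ray_near_trans:
  assumes "ray_near X c1 c2 D" "ray_near X c2 c3 D'"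
    and "c1 ` {0..} \<subseteq> mspace X" "c2 ` {0..} \<subseteq> mspace X" "c3 ` {0..} \<subseteq> mspace X"
  shows "ray_near X c1 c3 (D + D')"
  unfolding ray_near_def
proof (intro allI impI)
  fix t :: real assume t: "t \<ge> 0"
  obtain s where s: "s \<ge> 0" "mdist X (c1 t) (c2 s) \<le> D" using assms(1) t by (auto simp: ray_near_def)
  obtain u where u: "u \<ge> 0" "mdist X (c2 s) (c3 u) \<le> D'" using assms(2) s by (auto simp: ray_near_def)
  have "mdist X (c1 t) (c3 u) \<le> D + D'"
    using mdist_triangle[of "c1 t" X "c2 s" "c3 u"] s u t assms(3-5) by (auto simp: image_subset_iff)
  then show "\<exists>s\<ge>0. mdist X (c1 t) (c3 s) \<le> D + D'" using u by auto
qed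

lemma ray_near_mono: "ray_near X c1 c2 D \<Longrightarrow> D \<le> D' \<Longrightarrow> ray_near X c1 c2 D'"
  unfolding ray_near_def by (meson order_trans)

lemma ray_near_nbhd:
  "c1 ` {0..} \<subseteq> mspace X \<Longrightarrow> ray_near X c1 c2 D \<longleftrightarrow> c1 ` {0..} \<subseteq> metric_nbhd X D (c2 ` {0..})"
  by (auto simp: ray_near_def metric_nbhd_def image_subset_iff)

lemma geodesic_ray_mspace: "geodesic_ray X p \<alpha> \<Longrightarrow> \<alpha> ` {0..} \<subseteq> mspace X"
  by (simp add: geodesic_ray_def)

lemma geodesic_rayD:
  assumes "geodesic_ray X p \<alpha>"
  shows "\<alpha> 0 = p" "s \<ge> 0 \<Longrightarrow> \<alpha> s \<in> mspace X"
    "s \<ge> 0 \<Longrightarrow> t \<ge> 0 \<Longrightarrow> mdist X (\<alpha> s) (\<alpha> t) = \<bar>s - t\<bar>"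
    "s \<ge> 0 \<Longrightarrow> mdist X p (\<alpha> s) = s"
  using assms unfolding geodesic_ray_def by force+

lemma geodesic_ray_quasi_geodesic:
  assumes "geodesic_ray X p \<alpha>" "K \<ge> 1" "L \<ge> 0"
  shows "quasi_geodesic X K L {0..} \<alpha>"
proof -
  have "quasi_geodesic X 1 0 {0..} \<alpha>"
    by (rule quasi_geodesicI) (use geodesic_rayD[OF assms(1)] in \<open>auto simp: is_interval_ci\<close>)
  then show ?thesis using quasi_geodesic_weaken[of X 1 0] assms by auto
qed

text \<open>The times at which the second ray is met start at \<open>0\<close>, are unbounded and have bounded gaps.\<close>

lemma ray_near_sym:
  assumes c: "quasi_geodesic X K L {0..} c" "quasi_geodesic X K L {0..} c'" "K \<ge> 1" "L \<ge> 0"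
    and start: "c 0 = c' 0" and near: "ray_near X c c' D" and D: "D \<ge> 0"
  shows "ray_near X c' c (K * (K * (K + 2 * L + 2 * D)) + L + D)"
  unfolding ray_near_def
proof (intro allI impI)
  fix s :: real assume s: "s \<ge> 0"
  note m = quasi_geodesic_mspace[OF c(1)] quasi_geodesic_mspace[OF c(2)]
  have "\<forall>n. \<exists>u\<ge>0. mdist X (c (real n)) (c' u) \<le> D" using near by (auto simp: ray_near_def)
  then obtain g where g: "\<And>n. g n \<ge> 0 \<and> mdist X (c (real n)) (c' (g n)) \<le> D" by metis
  \<comment> \<open>The common start allows the first meeting time to be reset to \<open>0\<close>,
    so that no \<open>s \<ge> 0\<close> lies before all meeting times.\<close>
  define \<tau> where "\<tau> = g(0 := 0)"
  have \<tau>: "\<tau> n \<ge> 0" "mdist X (c (real n)) (c' (\<tau> n)) \<le> D" for n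
    using g start D m(2)[of 0] by (auto simp: \<tau>_def)
  have gap: "\<bar>\<tau> n - \<tau> (Suc n)\<bar> \<le> K * (K + 2 * L + 2 * D)" for n
  proof -
    have "mdist X (c' (\<tau> n)) (c' (\<tau> (Suc n))) \<le> mdist X (c' (\<tau> n)) (c (real n))
        + mdist X (c (real n)) (c (real (Suc n))) + mdist X (c (real (Suc n))) (c' (\<tau> (Suc n)))"
      using m \<tau>(1) by (intro mdist_triangle4) auto
    also have "mdist X (c (real n)) (c (real (Suc n))) \<le> K * \<bar>real n - real (Suc n)\<bar> + L"
      by (rule quasi_geodesicD(2)[OF c(1,3)]) auto
    finally have "mdist X (c' (\<tau> n)) (c' (\<tau> (Suc n))) + L \<le> K + 2 * L + 2 * D"
      using \<tau>(2)[of n] \<tau>(2)[of "Suc n"] by (simp add: mdist_commute)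
    then have "K * (mdist X (c' (\<tau> n)) (c' (\<tau> (Suc n))) + L) \<le> K * (K + 2 * L + 2 * D)"
      using c(3) by (intro mult_left_mono) auto
    then show ?thesis
      using quasi_geodesicD(1)[OF c(2,3), of "\<tau> n" "\<tau> (Suc n)"] \<tau>(1) by auto
  qed
  have unb: "real n \<le> K * (D + K * \<tau> n + 2 * L)" for n
  proof -
    have "mdist X (c 0) (c (real n)) \<le> mdist X (c 0) (c' (\<tau> n)) + mdist X (c' (\<tau> n)) (c (real n))"
      using m \<tau>(1) by (intro mdist_triangle) auto
    moreover have "mdist X (c 0) (c' (\<tau> n)) \<le> K * \<bar>0 - \<tau> n\<bar> + L"
      unfolding start by (rule quasi_geodesicD(2)[OF c(2,3)]) (use \<tau>(1) in auto)
    ultimately have "mdist X (c 0) (c (real n)) + L \<le> D + K * \<tau> n + 2 * L"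
      using \<tau>[of n] by (simp add: mdist_commute)
    then have "K * (mdist X (c 0) (c (real n)) + L) \<le> K * (D + K * \<tau> n + 2 * L)"
      using c(3) by (intro mult_left_mono) auto
    then show ?thesis using quasi_geodesicD(1)[OF c(1,3), of 0 "real n"] by auto
  qed
  have "\<exists>n. \<tau> n > s"
  proof (rule ccontr)
    assume "\<not> ?thesis"
    then have le: "\<tau> n \<le> s" for n by (simp add: not_less)
    obtain n :: nat where n: "real n > K * (D + K * s + 2 * L)" using reals_Archimedean2 by blast
    have "K * (D + K * \<tau> n + 2 * L) \<le> K * (D + K * s + 2 * L)"
      using le c(3) by (intro mult_left_mono add_mono) auto
    then show False using unb[of n] n by linarith
  qed
  \<comment> \<open>The first meeting time beyond \<open>s\<close> has a predecessor, as
    \<open>\<tau> 0 = 0 \<le> s\<close>; this traps \<open>s\<close> inside a single gap.\<close>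
  then obtain k where k: "\<tau> k > s" "\<And>j. j < k \<Longrightarrow> \<not> \<tau> j > s"
    using exists_least_iff[of "\<lambda>n. \<tau> n > s"] by blast
  have "k \<noteq> 0" using k(1) s by (auto simp: \<tau>_def split: if_splits)
  then obtain n where n: "k = Suc n" by (cases k) auto
  have "\<bar>\<tau> n - s\<bar> \<le> K * (K + 2 * L + 2 * D)" using gap[of n] k(1) k(2)[of n] n by auto
  then have "K * \<bar>\<tau> n - s\<bar> \<le> K * (K * (K + 2 * L + 2 * D))" using c(3) by (intro mult_left_mono) auto
  then have "mdist X (c' (\<tau> n)) (c' s) \<le> K * (K * (K + 2 * L + 2 * D)) + L"
    using quasi_geodesicD(2)[OF c(2,3), of "\<tau> n" s] \<tau>(1) s by auto
  moreover have "mdist X (c' s) (c (real n)) \<le> mdist X (c' s) (c' (\<tau> n)) + mdist X (c' (\<tau> n)) (c (real n))"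
    using m \<tau>(1) s by (intro mdist_triangle) auto
  ultimately have "mdist X (c' s) (c (real n)) \<le> K * (K * (K + 2 * L + 2 * D)) + L + D"
    using \<tau>(2)[of n] by (simp add: mdist_commute)
  then show "\<exists>t\<ge>0. mdist X (c' s) (c t) \<le> K * (K * (K + 2 * L + 2 * D)) + L + D"
    by (intro exI[of _ "real n"]) auto
qed

text \<open>Parameters are distances from \<open>p\<close>, so a point of \<open>\<beta>\<close>
  within \<open>D\<close> of \<open>\<alpha> t\<close> has parameter within \<open>D\<close> of
  \<open>t\<close>. Thus closeness of images becomes closeness at equal times, which is what
  \<open>asymptotic_rel\<close> demands.\<close>

lemma geodesic_rays_fellow_travel:
  assumes "geodesic_ray X p \<alpha>" "geodesic_ray X p \<beta>" "ray_near X \<alpha> \<beta> D" "t \<ge> 0"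
  shows "mdist X (\<alpha> t) (\<beta> t) \<le> 2 * D"
proof -
  obtain s where s: "s \<ge> 0" "mdist X (\<alpha> t) (\<beta> s) \<le> D" using assms(3,4) by (auto simp: ray_near_def)
  note a = geodesic_rayD[OF assms(1)] and b = geodesic_rayD[OF assms(2)]
  have p: "p \<in> mspace X" using a(1) a(2)[of 0] by auto
  have "mdist X p (\<alpha> t) \<le> mdist X p (\<beta> s) + mdist X (\<beta> s) (\<alpha> t)"
    "mdist X p (\<beta> s) \<le> mdist X p (\<alpha> t) + mdist X (\<alpha> t) (\<beta> s)"
    using p a b s assms(4) by (intro mdist_triangle; simp)+
  then have "\<bar>s - t\<bar> \<le> D" using a(4)[OF assms(4)] b(4)[OF s(1)] s by (simp add: mdist_commute)
  moreover have "mdist X (\<alpha> t) (\<beta> t) \<le> mdist X (\<alpha> t) (\<beta> s) + mdist X (\<beta> s) (\<beta> t)"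
    using a b s assms(4) by (intro mdist_triangle; simp)
  ultimately show ?thesis using s b(3)[OF s(1) assms(4)] by simp
qed

lemma asymptotic_iff_ray_near:
  assumes "\<alpha> \<in> morse_rays X p" "\<beta> \<in> morse_rays X p"
  shows "(\<alpha>, \<beta>) \<in> asymptotic_rel X p \<longleftrightarrow> (\<exists>D. ray_near X \<alpha> \<beta> D)"
proof
  assume "(\<alpha>, \<beta>) \<in> asymptotic_rel X p"
  then obtain D where "\<And>t. t \<ge> 0 \<Longrightarrow> mdist X (\<alpha> t) (\<beta> t) \<le> D"
    unfolding asymptotic_rel_def bdd_above_def by auto
  then show "\<exists>D. ray_near X \<alpha> \<beta> D" unfolding ray_near_def by blast
next
  assume "\<exists>D. ray_near X \<alpha> \<beta> D"
  then obtain D where "ray_near X \<alpha> \<beta> D" by blast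
  then have "\<And>t. t \<ge> 0 \<Longrightarrow> mdist X (\<alpha> t) (\<beta> t) \<le> 2 * D"
    using geodesic_rays_fellow_travel[of X p \<alpha> \<beta>] assms by (simp add: morse_rays_def)
  then show "(\<alpha>, \<beta>) \<in> asymptotic_rel X p"
    using assms unfolding asymptotic_rel_def by (auto intro!: bdd_aboveI[of _ "2 * D"])
qed

lemma ray_near_sym_geodesic:
  assumes "geodesic_ray X p \<alpha>" "geodesic_ray X p \<beta>" "ray_near X \<alpha> \<beta> D"
  shows "ray_near X \<beta> \<alpha> (2 * D)"
  unfolding ray_near_def
  using geodesic_rays_fellow_travel[OF assms] by (metis mdist_commute)

lemma morse_with_gauge_ray_near:
  assumes "morse_with_gauge X N (c ` {0..})" "morse_gauge N"
    and "ray_near X c c' D" "ray_near X c' c D" "c' ` {0..} \<subseteq> mspace X" "D \<ge> 0"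
  shows "morse_with_gauge X (\<lambda>K C. N K (C + 2 * D) + 2 * D) (c' ` {0..})"
    and "morse_gauge (\<lambda>K C. N K (C + 2 * D) + 2 * D)"
proof -
  have "c ` {0..} \<subseteq> metric_nbhd X D (c' ` {0..})" "c' ` {0..} \<subseteq> metric_nbhd X D (c ` {0..})"
    using ray_near_nbhd[OF morse_with_gauge_subset[OF assms(1)]] ray_near_nbhd[OF assms(5)] assms(3,4)
    by blast+
  then show "morse_with_gauge X (\<lambda>K C. N K (C + 2 * D) + 2 * D) (c' ` {0..})"
    using morse_with_gauge_hausdorff[OF assms(1,2)] assms(5,6) by blast
  show "morse_gauge (\<lambda>K C. N K (C + 2 * D) + 2 * D)"
    using assms(2,6) by (simp add: morse_gauge_def)
qed

lemma geodesic_ray_near_morse: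
  assumes "\<alpha> \<in> morse_rays X p" "geodesic_ray X p \<beta>" "ray_near X \<beta> \<alpha> D"
  shows "\<beta> \<in> morse_rays X p"
proof -
  have a: "geodesic_ray X p \<alpha>" using assms(1) by (simp add: morse_rays_def)
  obtain N where N: "morse_gauge N" "morse_with_gauge X N (\<alpha> ` {0..})"
    using assms(1) by (auto simp: morse_rays_def morse_subset_def)
  have D: "0 \<le> D" using assms(3) mdist_nonneg unfolding ray_near_def by (meson order_refl order_trans)
  have "ray_near X \<beta> \<alpha> (2 * D)" using ray_near_mono[OF assms(3)] D by simp
  moreover have "ray_near X \<alpha> \<beta> (2 * D)" using ray_near_sym_geodesic[OF assms(2) a assms(3)] .
  ultimately show ?thesis
    using morse_with_gauge_ray_near[OF N(2,1), of \<beta> "2 * D"] geodesic_ray_mspace[OF assms(2)] assms(2) D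
    by (auto simp: morse_rays_def morse_subset_def)
qed

section \<open>Boundary points as classes of asymptotic Morse rays\<close>

lemma equiv_asymptotic_rel: "equiv (morse_rays X p) (asymptotic_rel X p)"
proof (rule equivI)
  have g: "geodesic_ray X p \<alpha>" if "\<alpha> \<in> morse_rays X p" for \<alpha> using that by (simp add: morse_rays_def)
  have m: "\<alpha> \<in> morse_rays X p" "\<beta> \<in> morse_rays X p" if "(\<alpha>, \<beta>) \<in> asymptotic_rel X p" for \<alpha> \<beta>
    using that by (auto simp: asymptotic_rel_def)
  show "asymptotic_rel X p \<subseteq> morse_rays X p \<times> morse_rays X p" using m by auto
  show "refl_on (morse_rays X p) (asymptotic_rel X p)"
  proof (rule refl_onI)
    fix \<alpha> assume a: "\<alpha> \<in> morse_rays X p"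
    have "ray_near X \<alpha> \<alpha> 0"
      using geodesic_rayD(2)[OF g[OF a]] unfolding ray_near_def by (metis mdist_self order_refl)
    then show "(\<alpha>, \<alpha>) \<in> asymptotic_rel X p" using asymptotic_iff_ray_near[OF a a] by blast
  qed
  show "sym (asymptotic_rel X p)"
    by (rule symI) (metis asymptotic_iff_ray_near g m ray_near_sym_geodesic)
  show "trans (asymptotic_rel X p)"
  proof (rule transI)
    fix \<alpha> \<beta> \<gamma> assume 1: "(\<alpha>, \<beta>) \<in> asymptotic_rel X p" and 2: "(\<beta>, \<gamma>) \<in> asymptotic_rel X p"
    obtain D D' where "ray_near X \<alpha> \<beta> D" "ray_near X \<beta> \<gamma> D'"
      using 1 2 asymptotic_iff_ray_near m by metis
    then have "ray_near X \<alpha> \<gamma> (D + D')"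
      using m[OF 1] m[OF 2] g by (intro ray_near_trans) (auto intro!: geodesic_ray_mspace simp del: image_subset_iff)
    then show "(\<alpha>, \<gamma>) \<in> asymptotic_rel X p" using asymptotic_iff_ray_near m[OF 1] m[OF 2] by metis
  qed
qed

lemma boundary_points_morse_rays: "x \<in> boundary_points X p \<Longrightarrow> \<alpha> \<in> x \<Longrightarrow> \<alpha> \<in> morse_rays X p"
  using in_quotient_imp_subset[OF equiv_asymptotic_rel, of x] by (auto simp: boundary_points_def)

lemma boundary_points_geodesic_ray: "x \<in> boundary_points X p \<Longrightarrow> \<alpha> \<in> x \<Longrightarrow> geodesic_ray X p \<alpha>"
  using boundary_points_morse_rays by (fastforce simp: morse_rays_def)

lemma boundary_points_nonempty: "x \<in> boundary_points X p \<Longrightarrow> \<exists>\<alpha>. \<alpha> \<in> x"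
  using in_quotient_imp_non_empty[OF equiv_asymptotic_rel, of x] by (auto simp: boundary_points_def)

lemma boundary_points_near:
  assumes "x \<in> boundary_points X p" "\<alpha> \<in> x" "\<beta> \<in> x"
  shows "\<exists>D. ray_near X \<alpha> \<beta> D"
proof -
  have "(\<alpha>, \<beta>) \<in> asymptotic_rel X p"
    using in_quotient_imp_in_rel[OF equiv_asymptotic_rel, of x X p \<alpha> \<beta>] assms
    by (simp add: boundary_points_def)
  then show ?thesis using asymptotic_iff_ray_near boundary_points_morse_rays assms by metis
qed

text \<open>Closeness to one representative already forces \<open>\<beta>\<close> to be Morse, so
  this is the membership test for rays that arise as limits.\<close>

lemma boundary_points_near_mem:
  assumes "x \<in> boundary_points X p" "\<alpha> \<in> x" "geodesic_ray X p \<beta>" "ray_near X \<beta> \<alpha> D"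
  shows "\<beta> \<in> x"
proof -
  have a: "\<alpha> \<in> morse_rays X p" using boundary_points_morse_rays[OF assms(1,2)] .
  have b: "\<beta> \<in> morse_rays X p" using geodesic_ray_near_morse[OF a assms(3,4)] .
  have "ray_near X \<alpha> \<beta> (2 * D)"
    using ray_near_sym_geodesic[OF assms(3) _ assms(4)] a by (simp add: morse_rays_def)
  then have "(\<alpha>, \<beta>) \<in> asymptotic_rel X p" using asymptotic_iff_ray_near[OF a b] by blast
  then show ?thesis
    using in_quotient_imp_closed[OF equiv_asymptotic_rel, of x X p \<alpha> \<beta>] assms(1,2)
    by (simp add: boundary_points_def)
qed

lemma boundary_points_ex: "\<alpha> \<in> morse_rays X p \<Longrightarrow> \<exists>x\<in>boundary_points X p. \<alpha> \<in> x"
  unfolding boundary_points_def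
  by (meson equiv_asymptotic_rel equiv_class_self quotientI)

lemma boundary_points_eqI:
  "x \<in> boundary_points X p \<Longrightarrow> y \<in> boundary_points X p \<Longrightarrow> \<alpha> \<in> x \<Longrightarrow> \<alpha> \<in> y \<Longrightarrow> x = y"
  using quotient_disj[OF equiv_asymptotic_rel, of x X p y] by (auto simp: boundary_points_def)

text \<open>Reduces continuity and closedness of maps to sequences inside single strata. A sequence
  that converges in a stratum lies in it together with its limit, so intersecting \<open>V\<close>
  with the stratum makes no difference.\<close>

lemma closedin_morse_boundary:
  "closedin (morse_boundary X p) V \<longleftrightarrow> V \<subseteq> boundary_points X p \<and>
     (\<forall>N x y. morse_gauge N \<and> range x \<subseteq> V \<and> stratum_converges X p N x y \<longrightarrow> y \<in> V)"
proof -
  have s: "boundary_stratum X p N \<subseteq> boundary_points X p" for N by (auto simp: boundary_stratum_def)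
  have r: "range x \<subseteq> boundary_stratum X p N" "y \<in> boundary_stratum X p N"
    if "stratum_converges X p N x y" for x y N
    using that by (auto simp: stratum_converges_def)
  have "boundary_stratum X p N - (boundary_points X p - V) \<inter> boundary_stratum X p N
      = V \<inter> boundary_stratum X p N" if "V \<subseteq> boundary_points X p" for N
    using s[of N] by blast
  then have "closedin (morse_boundary X p) V \<longleftrightarrow> V \<subseteq> boundary_points X p \<and>
     (\<forall>N. morse_gauge N \<longrightarrow> stratum_closed X p N (V \<inter> boundary_stratum X p N))"
    unfolding closedin_def topspace_morse_boundary openin_morse_boundary openin_stratum_topology by auto
  also have "\<dots> \<longleftrightarrow> V \<subseteq> boundary_points X p \<and>
     (\<forall>N x y. morse_gauge N \<and> range x \<subseteq> V \<and> stratum_converges X p N x y \<longrightarrow> y \<in> V)"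
    unfolding stratum_closed_def using r by (metis (no_types, lifting) Int_iff inf_le2 le_inf_iff)
  finally show ?thesis .
qed

section \<open>Spaces with limits of geodesics\<close>

definition geodesic_segment :: "'p metric \<Rightarrow> (real \<Rightarrow> 'p) \<Rightarrow> real \<Rightarrow> bool" where
  "geodesic_segment X \<gamma> l \<longleftrightarrow> 0 \<le> l \<and> \<gamma> ` {0..l} \<subseteq> mspace X \<and>
     (\<forall>s\<in>{0..l}. \<forall>t\<in>{0..l}. mdist X (\<gamma> s) (\<gamma> t) = \<bar>s - t\<bar>)"

lemma geodesic_segmentD:
  assumes "geodesic_segment X \<gamma> l"
  shows "0 \<le> l" "0 \<le> s \<Longrightarrow> s \<le> l \<Longrightarrow> \<gamma> s \<in> mspace X"
    "0 \<le> s \<Longrightarrow> s \<le> l \<Longrightarrow> 0 \<le> t \<Longrightarrow> t \<le> l \<Longrightarrow> mdist X (\<gamma> s) (\<gamma> t) = \<bar>s - t\<bar>"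
  using assms by (auto simp: geodesic_segment_def)

lemma geodesic_segment_quasi_geodesic: "geodesic_segment X \<gamma> l \<Longrightarrow> quasi_geodesic X 1 0 {0..l} \<gamma>"
  by (rule quasi_geodesicI) (auto simp: is_interval_cc geodesic_segment_def)

lemma converges_on_compactaD:
  assumes "converges_on_compacta X \<alpha> \<beta>" "e > 0" "b \<ge> 0"
  shows "\<forall>\<^sub>F n in sequentially. \<forall>t\<in>{0..b}. mdist X (\<alpha> n t) (\<beta> t) < e"
  using assms unfolding converges_on_compacta_def by (simp add: compact_Icc)

lemma converges_on_compacta_subseq:
  assumes "converges_on_compacta X \<alpha> \<beta>" "strict_mono r"
  shows "converges_on_compacta X (\<lambda>n. \<alpha> (r n)) \<beta>"
  unfolding converges_on_compacta_def
proof (intro allI impI)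
  fix C :: "real set" and e :: real assume "compact C \<and> C \<subseteq> {0..}" "e > 0"
  then have "\<forall>\<^sub>F n in sequentially. \<forall>t\<in>C. mdist X (\<alpha> n t) (\<beta> t) < e"
    using assms(1) unfolding converges_on_compacta_def by blast
  then show "\<forall>\<^sub>F n in sequentially. \<forall>t\<in>C. mdist X (\<alpha> (r n) t) (\<beta> t) < e"
    by (rule eventually_subseq[OF assms(2)])
qed

text \<open>Only points of the \<open>1\<close>-net \<open>V\<close> need to be joined by geodesics: in a Cayley graph these are the
  vertices.\<close>

locale ray_space =
  fixes X :: "'p metric" and V :: "'p set" and p :: 'p
  assumes base: "p \<in> V" and V: "V \<subseteq> mspace X"
    and net: "\<And>x. x \<in> mspace X \<Longrightarrow> \<exists>v\<in>V. mdist X x v \<le> 1"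
    and geodesic: "\<And>u v. u \<in> V \<Longrightarrow> v \<in> V \<Longrightarrow>
      \<exists>\<gamma>. geodesic_segment X \<gamma> (mdist X u v) \<and> \<gamma> 0 = u \<and> \<gamma> (mdist X u v) = v"
    and arzela_ascoli: "\<And>\<gamma> l. (\<And>n. geodesic_segment X (\<gamma> n) (l n) \<and> \<gamma> n 0 = p) \<Longrightarrow>
      filterlim l at_top sequentially \<Longrightarrow>
      \<exists>r \<beta>. strict_mono (r :: nat \<Rightarrow> nat) \<and> geodesic_ray X p \<beta> \<and> converges_on_compacta X (\<lambda>n. \<gamma> (r n)) \<beta>"
begin

lemma base_mspace: "p \<in> mspace X"
  using base V by blast

lemma arzela_ascoli_rays:
  assumes "\<And>n. geodesic_ray X p (\<alpha> n)"
  shows "\<exists>r \<beta>. strict_mono (r :: nat \<Rightarrow> nat) \<and> geodesic_ray X p \<beta> \<and> converges_on_compacta X (\<lambda>n. \<alpha> (r n)) \<beta>"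
proof (rule arzela_ascoli)
  \<comment> \<open>Cutting the \<open>n\<close>-th ray at time \<open>n\<close> gives segments
    whose lengths tend to infinity.\<close>
  show "geodesic_segment X (\<alpha> n) (real n) \<and> \<alpha> n 0 = p" for n
    using geodesic_rayD[OF assms[of n]] by (auto simp: geodesic_segment_def)
qed (rule filterlim_real_sequentially)

text \<open>The ray is a limit of geodesics from \<open>p\<close> to points of the quasi-geodesic.\<close>

lemma morse_quasi_geodesic_limit:
  assumes c: "quasi_geodesic X K L {0..} c" "K \<ge> 1" "L \<ge> 0" "c 0 = p"
    and N: "morse_with_gauge X N (c ` {0..})"
  shows "\<exists>\<beta>. geodesic_ray X p \<beta> \<and> ray_near X \<beta> c (N 1 2 + 1)"
proof -
  note m = quasi_geodesic_mspace[OF c(1)]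
  \<comment> \<open>Points of the quasi-geodesic are rounded to the net first, because only net
    points are known to be joined by geodesics.\<close>
  have "\<forall>n. \<exists>v\<in>V. mdist X (c (real n)) v \<le> 1" using net m by auto
  then obtain v where v: "\<And>n. v n \<in> V \<and> mdist X (c (real n)) (v n) \<le> 1" by metis
  define l where "l n = mdist X p (v n)" for n
  have "\<forall>n. \<exists>\<gamma>. geodesic_segment X \<gamma> (l n) \<and> \<gamma> 0 = p \<and> \<gamma> (l n) = v n"
    unfolding l_def using geodesic base v by blast
  then obtain \<gamma> where \<gamma>: "\<And>n. geodesic_segment X (\<gamma> n) (l n) \<and> \<gamma> n 0 = p \<and> \<gamma> n (l n) = v n" by metis
  have l: "real n \<le> K * (l n + 1 + L)" for n
  proof -
    have "mdist X p (c (real n)) \<le> l n + mdist X (v n) (c (real n))"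
      unfolding l_def using v m V base_mspace by (intro mdist_triangle) auto
    then have "mdist X (c 0) (c (real n)) + L \<le> l n + 1 + L"
      using v[of n] c(4) by (simp add: mdist_commute)
    then have "K * (mdist X (c 0) (c (real n)) + L) \<le> K * (l n + 1 + L)"
      using c(2) by (intro mult_left_mono) auto
    then show ?thesis using quasi_geodesicD(1)[OF c(1,2), of 0 "real n"] by auto
  qed
  \<comment> \<open>The lower quasi-geodesic bound drives \<open>c (real n)\<close>, and with it
    \<open>v n\<close>, away from \<open>p\<close>.\<close>
  have lim: "filterlim l at_top sequentially"
    unfolding filterlim_at_top
  proof
    fix Z
    show "\<forall>\<^sub>F n in sequentially. Z \<le> l n"
    proof (rule eventually_sequentiallyI)
      fix n assume "n \<ge> nat \<lceil>K * (Z + 1 + L)\<rceil>"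
      then have "K * (Z + 1 + L) \<le> K * (l n + 1 + L)" using l[of n] by linarith
      then show "Z \<le> l n" using c(2) by simp
    qed
  qed
  obtain r \<beta> where r: "strict_mono (r :: nat \<Rightarrow> nat)" and \<beta>: "geodesic_ray X p \<beta>"
    and conv: "converges_on_compacta X (\<lambda>n. \<gamma> (r n)) \<beta>"
    using arzela_ascoli[OF _ lim, of \<gamma>] \<gamma> by blast
  have "\<exists>s\<ge>0. mdist X (\<beta> t) (c s) \<le> N 1 2 + 1" if t: "t \<ge> 0" for t
  proof -
    have "\<forall>\<^sub>F n in sequentially. l (r n) \<ge> t + 1"
      using filterlim_compose[OF lim filterlim_subseq[OF r]] by (simp add: filterlim_at_top)
    from eventually_conj[OF this converges_on_compactaD[OF conv zero_less_one t]]
    obtain n where n: "l (r n) \<ge> t + 1" "mdist X (\<gamma> (r n) t) (\<beta> t) < 1"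
      using t by (auto dest!: eventually_happens)
    define k where "k = r n"
    \<comment> \<open>Moving the last point from \<open>v k\<close> to \<open>c (real k)\<close>
      costs \<open>2\<close> in the additive constant, hence \<open>N 1 2\<close>; the summand
      \<open>1\<close> in the claim is the distance to the limit at time \<open>t\<close>. As
      \<open>l k \<ge> t + 1\<close>, the altered endpoint is not at time \<open>t\<close>.\<close>
    define c' where "c' = (\<gamma> k)(l k := c (real k))"
    note g = geodesic_segmentD[OF conjunct1[OF \<gamma>[of k]]]
    have "quasi_geodesic X 1 (0 + 2 * 1) {0..l k} c'"
    proof (rule quasi_geodesic_perturb)
      show "quasi_geodesic X 1 0 {0..l k} (\<gamma> k)" using \<gamma> geodesic_segment_quasi_geodesic by blast
      show "c' s \<in> mspace X" if "s \<in> {0..l k}" for s using that m g(2) by (auto simp: c'_def)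
      show "mdist X (\<gamma> k s) (c' s) \<le> 1" if "s \<in> {0..l k}" for s
        using that v[of k] \<gamma>[of k] g(2) by (auto simp: c'_def mdist_commute)
    qed auto
    then have q: "quasi_geodesic X 1 2 {0..l k} c'" by simp
    have e: "c' 0 = c 0" "c' (l k) = c (real k)" "c' t = \<gamma> k t"
      using n(1) \<gamma>[of k] c(4) t by (auto simp: c'_def k_def)
    obtain s where s: "s \<ge> 0" "mdist X (\<gamma> k t) (c s) \<le> N 1 2"
      using morse_with_gaugeD[OF N _ _ q, of t] e n(1) t by (auto simp: k_def)
    have "mdist X (\<beta> t) (c s) \<le> mdist X (\<beta> t) (\<gamma> k t) + mdist X (\<gamma> k t) (c s)"
      using geodesic_rayD(2)[OF \<beta> t] m s g(2)[of t] t n by (intro mdist_triangle) (auto simp: k_def)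
    then show ?thesis using s n(2) by (intro exI[of _ s]) (auto simp: k_def mdist_commute)
  qed
  then show ?thesis using \<beta> by (auto simp: ray_near_def)
qed

text \<open>The order of quantifiers is the content: \<open>N'\<close> and \<open>D\<close> are
  fixed before the quasi-geodesic, so straightening all members of a family with gauge
  \<open>N\<close> ends in one stratum.\<close>

lemma morse_quasi_geodesic_ray:
  assumes K: "K \<ge> 1" "L \<ge> 0" and N: "morse_gauge N"
  shows "\<exists>N' D. morse_gauge N' \<and> (\<forall>c. quasi_geodesic X K L {0..} c \<and> c 0 = p \<and> morse_with_gauge X N (c ` {0..}) \<longrightarrow>
     (\<exists>\<beta>. geodesic_ray X p \<beta> \<and> morse_with_gauge X N' (\<beta> ` {0..}) \<and> ray_near X c \<beta> D \<and> ray_near X \<beta> c D))"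
proof -
  have N0: "0 \<le> N 1 2" using N by (simp add: morse_gauge_def)
  define D where "D = max (N 1 2 + 1) (K * (K * (K + 2 * L + 2 * (N 1 2 + 1))) + L + (N 1 2 + 1))"
  define N' where "N' = (\<lambda>K C. N K (C + 2 * D) + 2 * D)"
  have D: "D \<ge> 0" using N0 by (simp add: D_def)
  have "morse_gauge N'" using N D by (simp add: N'_def morse_gauge_def)
  moreover have "\<exists>\<beta>. geodesic_ray X p \<beta> \<and> morse_with_gauge X N' (\<beta> ` {0..}) \<and> ray_near X c \<beta> D \<and> ray_near X \<beta> c D"
    if c: "quasi_geodesic X K L {0..} c" "c 0 = p" and Nc: "morse_with_gauge X N (c ` {0..})" for c
  proof -
    obtain \<beta> where \<beta>: "geodesic_ray X p \<beta>" "ray_near X \<beta> c (N 1 2 + 1)"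
      using morse_quasi_geodesic_limit[OF c(1) K c(2) Nc] by blast
    have "ray_near X c \<beta> (K * (K * (K + 2 * L + 2 * (N 1 2 + 1))) + L + (N 1 2 + 1))"
      using c geodesic_rayD(1)[OF \<beta>(1)] N0 K
      by (intro ray_near_sym[OF geodesic_ray_quasi_geodesic[OF \<beta>(1) K] c(1) K _ \<beta>(2)]) auto
    then have n: "ray_near X c \<beta> D" "ray_near X \<beta> c D"
      using \<beta>(2) by (auto elim!: ray_near_mono simp: D_def)
    show ?thesis
      using morse_with_gauge_ray_near(1)[OF Nc N n geodesic_ray_mspace[OF \<beta>(1)] D] n \<beta>(1) N'_def by blast
  qed
  ultimately show ?thesis by blast
qed

text \<open>A geodesic ray that stays close to \<open>H\<close> is closed up to a quasi-geodesic with endpoints in \<open>H\<close>: up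
  to a far-away integer time nearest to some \<open>h \<in> H\<close> it is followed by a geodesic to \<open>h\<close>. The
  constants do not depend on how far the ray is from \<open>H\<close>.\<close>

lemma morse_subset_absorbs_ray:
  assumes H: "H \<subseteq> V" "p \<in> H" "morse_with_gauge X M H"
    and \<alpha>: "geodesic_ray X p \<alpha>" "\<alpha> ` {0..} \<subseteq> metric_nbhd X r H"
  shows "\<alpha> ` {0..} \<subseteq> metric_nbhd X (M 3 5) H"
proof
  fix x assume "x \<in> \<alpha> ` {0..}"
  then obtain t where t: "t \<ge> 0" "x = \<alpha> t" by auto
  note a = geodesic_rayD[OF \<alpha>(1)]
  \<comment> \<open>The nearest integer time \<open>s\<close> to \<open>h\<close> satisfies
    \<open>T - s \<le> 2 * r\<close>, since both \<open>\<alpha> s\<close> and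
    \<open>\<alpha> T\<close> are within \<open>r\<close> of \<open>h\<close>; this choice of
    \<open>T\<close> therefore keeps \<open>s\<close> beyond \<open>t\<close>.\<close>
  obtain T :: nat where T: "real T > t + 2 * r" using reals_Archimedean2 by blast
  have "\<alpha> (real T) \<in> metric_nbhd X r H" using \<alpha>(2) by auto
  then obtain h where h: "h \<in> H" "mdist X (\<alpha> (real T)) h \<le> r" by (auto elim: metric_nbhdE)
  have hV: "h \<in> V" "h \<in> mspace X" using h H V by auto
  \<comment> \<open>Restricting to the finitely many integer times makes a minimiser available at
    once; rounding a real time to an integer one costs at most \<open>1\<close>.\<close>
  define s where "s = arg_min_on (\<lambda>i. mdist X h (\<alpha> (real i))) {..T}"
  have s: "s \<le> T" "\<And>i. i \<le> T \<Longrightarrow> mdist X h (\<alpha> (real s)) \<le> mdist X h (\<alpha> (real i))"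
    using arg_min_if_finite[of "{..T}" "\<lambda>i. mdist X h (\<alpha> (real i))"] unfolding s_def by (auto simp: not_less)
  have "mdist X (\<alpha> (real s)) (\<alpha> (real T)) \<le> mdist X (\<alpha> (real s)) h + mdist X h (\<alpha> (real T))"
    using a(2) hV by (intro mdist_triangle) auto
  then have "real T - real s \<le> 2 * r"
    using s(2)[of T] h(2) a(3)[of "real s" "real T"] s(1) by (simp add: mdist_commute)
  then have ts: "t < real s" using T by linarith
  obtain q where q: "q \<in> V" "mdist X (\<alpha> (real s)) q \<le> 1" using net a(2) by (meson of_nat_0_le_iff)
  have qm: "q \<in> mspace X" using q V by auto
  define l where "l = mdist X q h"
  obtain \<eta> where \<eta>: "geodesic_segment X \<eta> l" "\<eta> 0 = q" "\<eta> l = h"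
    using geodesic[OF q(1) hV(1)] unfolding l_def by blast
  note g = geodesic_segmentD[OF \<eta>(1)]
  define c where "c u = (if u < real s then \<alpha> u else \<eta> (u - real s))" for u
  \<comment> \<open>Let \<open>d\<close> be the distance between the two points. Minimality of
    \<open>s\<close> gives \<open>v - s \<le> d + 2\<close>, with \<open>1\<close> for rounding
    \<open>u\<close> and \<open>1\<close> for replacing \<open>\<alpha> s\<close> by
    \<open>q\<close>. The triangle inequality then gives
    \<open>s - u \<le> d + (v - s) + 1 \<le> 2 * d + 3\<close>. The sum is \<open>3 * d + 5\<close>,
    the source of the constants \<open>3\<close> and \<open>5\<close>.\<close>
  have cross: "v - u \<le> 3 * mdist X (\<alpha> u) (\<eta> (v - real s)) + 5 \<and> mdist X (\<alpha> u) (\<eta> (v - real s)) \<le> v - u + 1"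
    if uv: "0 \<le> u" "u < real s" "real s \<le> v" "v \<le> real s + l" for u v
  proof -
    define y where "y = \<eta> (v - real s)"
    have ym: "y \<in> mspace X" using g(2) uv by (simp add: y_def)
    have yd: "mdist X q y = v - real s" "mdist X y h = l - (v - real s)"
      using g(3)[of 0 "v - real s"] g(3)[of "v - real s" l] uv g(1) \<eta> by (auto simp: y_def)
    define j where "j = nat \<lfloor>u\<rfloor>"
    have j: "j \<le> T" "\<bar>u - real j\<bar> \<le> 1" using uv s(1) unfolding j_def by linarith+
    have m: "\<alpha> u \<in> mspace X" "\<alpha> (real j) \<in> mspace X" "\<alpha> (real s) \<in> mspace X" using a(2) uv by auto
    have "mdist X h (\<alpha> (real s)) \<le> mdist X h y + mdist X y (\<alpha> u) + mdist X (\<alpha> u) (\<alpha> (real j))"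
      using s(2)[OF j(1)] mdist_triangle4[OF hV(2) ym m(1,2)] by linarith
    moreover have "mdist X (\<alpha> u) (\<alpha> (real j)) \<le> 1" using a(3) uv j by simp
    moreover have "l \<le> mdist X q (\<alpha> (real s)) + mdist X (\<alpha> (real s)) h"
      unfolding l_def using qm m hV by (intro mdist_triangle) auto
    ultimately have 1: "v - real s \<le> mdist X (\<alpha> u) y + 2"
      using yd q by (simp add: mdist_commute)
    have 2: "mdist X (\<alpha> u) (\<alpha> (real s)) = real s - u" using a(3) uv by simp
    have "mdist X (\<alpha> u) (\<alpha> (real s)) \<le> mdist X (\<alpha> u) y + mdist X y q + mdist X q (\<alpha> (real s))"
      using qm m ym by (intro mdist_triangle4) auto
    moreover have "mdist X (\<alpha> u) y \<le> mdist X (\<alpha> u) (\<alpha> (real s)) + mdist X (\<alpha> (real s)) q + mdist X q y"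
      using qm m ym by (intro mdist_triangle4) auto
    ultimately show ?thesis using 1 2 q(2) yd unfolding y_def[symmetric] by (simp add: mdist_commute)
  qed
  have "quasi_geodesic X 3 5 {0..real s + l} c"
  proof (rule quasi_geodesicI)
    fix u assume "u \<in> {0..real s + l}"
    then show "c u \<in> mspace X" using a(2) g(2) by (auto simp: c_def)
  next
    fix u v assume uv: "u \<in> {0..real s + l}" "v \<in> {0..real s + l}" "u < v"
    have "v - u \<le> 3 * (mdist X (c u) (c v) + 5) \<and> mdist X (c u) (c v) \<le> 3 * (v - u) + 5"
    proof (cases "v < real s \<or> real s \<le> u")
      case True
      then have "mdist X (c u) (c v) = v - u" using uv a(3) g(3) by (auto simp: c_def)
      then show ?thesis using uv by simp
    next
      case False
      then show ?thesis using cross[of u v] uv by (auto simp: c_def)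
    qed
    then show "v - u \<le> 3 * (mdist X (c u) (c v) + 5)" "mdist X (c u) (c v) \<le> 3 * (v - u) + 5" by auto
  qed (auto simp: is_interval_cc)
  moreover have "c 0 \<in> H" "c (real s + l) \<in> H" "c t = \<alpha> t"
    using ts t a(1) H h \<eta> g(1) by (auto simp: c_def)
  ultimately obtain z where "z \<in> H" "mdist X (\<alpha> t) z \<le> M 3 5"
    using morse_with_gaugeD[OF H(3), of 3 5 0 "real s + l" c t] ts t g(1) by auto
  then show "x \<in> metric_nbhd X (M 3 5) H" using t a(2) by (auto simp: metric_nbhd_def)
qed

end

section \<open>Quasi-isometric embeddings with Morse image\<close>

text \<open>Models a Morse subgroup, with \<open>f\<close> rounding to vertices. The image is kept
  inside \<open>V\<close> because absorption joins its points by geodesics; the base points match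
  exactly so that \<open>ray_near_sym\<close> applies.\<close>

locale morse_embedding = Y: ray_space Y W q + X: ray_space X V p
  for Y :: "'q metric" and W q and X :: "'p metric" and V p +
  fixes f :: "'q \<Rightarrow> 'p" and A B :: real and M :: "real \<Rightarrow> real \<Rightarrow> real"
  assumes qi: "qi_embedding Y X A B f" and fV: "f ` mspace Y \<subseteq> V" and f_base: "f q = p"
    and M: "morse_gauge M" "morse_with_gauge X M (f ` mspace Y)"
begin

lemmas A = qi_embeddingD(1,2)[OF qi]
lemmas f_mspace = qi_embeddingD(3)[OF qi]

lemma image_quasi_geodesic:
  assumes "geodesic_ray Y q \<alpha>"
  shows "quasi_geodesic X A B {0..} (f \<circ> \<alpha>)" "(f \<circ> \<alpha>) 0 = p" "(f \<circ> \<alpha>) ` {0..} \<subseteq> mspace X"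
  using quasi_geodesic_image[OF qi geodesic_ray_quasi_geodesic[OF assms, of 1 0]] f_base
    geodesic_rayD(1,2)[OF assms] f_mspace by auto

definition near :: "(real \<Rightarrow> 'q) \<Rightarrow> (real \<Rightarrow> 'p) \<Rightarrow> bool" where
  "near \<alpha> \<beta> \<longleftrightarrow> (\<exists>D. ray_near X (f \<circ> \<alpha>) \<beta> D)"

lemma near_sym:
  assumes "near \<alpha> \<beta>" "geodesic_ray Y q \<alpha>" "geodesic_ray X p \<beta>"
  shows "\<exists>D. ray_near X \<beta> (f \<circ> \<alpha>) D"
proof -
  obtain D where D: "ray_near X (f \<circ> \<alpha>) \<beta> D" using assms(1) by (auto simp: near_def)
  then have "D \<ge> 0" using mdist_nonneg unfolding ray_near_def by (meson order_refl order_trans)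
  then show ?thesis
    using ray_near_sym[OF image_quasi_geodesic(1)[OF assms(2)] geodesic_ray_quasi_geodesic[OF assms(3) A] A _ D]
      image_quasi_geodesic(2)[OF assms(2)] geodesic_rayD(1)[OF assms(3)] by auto
qed

lemma near_ray_near:
  assumes "near \<alpha> \<beta>" "ray_near X \<beta> \<beta>' D"
    and "geodesic_ray Y q \<alpha>" "geodesic_ray X p \<beta>" "geodesic_ray X p \<beta>'"
  shows "near \<alpha> \<beta>'"
  using assms(1) ray_near_trans[OF _ assms(2) image_quasi_geodesic(3)[OF assms(3)]
      geodesic_ray_mspace[OF assms(4)] geodesic_ray_mspace[OF assms(5)]] by (auto simp only: near_def)

lemma ray_near_image:
  assumes "ray_near Y \<alpha> \<alpha>' D" "\<alpha> ` {0..} \<subseteq> mspace Y" "\<alpha>' ` {0..} \<subseteq> mspace Y"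
  shows "ray_near X (f \<circ> \<alpha>) (f \<circ> \<alpha>') (A * D + B)"
  unfolding ray_near_def
proof (intro allI impI)
  fix t :: real assume t: "t \<ge> 0"
  then obtain s where s: "s \<ge> 0" "mdist Y (\<alpha> t) (\<alpha>' s) \<le> D" using assms(1) by (auto simp: ray_near_def)
  have "mdist X (f (\<alpha> t)) (f (\<alpha>' s)) \<le> A * mdist Y (\<alpha> t) (\<alpha>' s) + B"
    using assms s t by (intro qi_embeddingD(4)[OF qi]) auto
  moreover have "A * mdist Y (\<alpha> t) (\<alpha>' s) \<le> A * D" using s A by (intro mult_left_mono) auto
  ultimately show "\<exists>s\<ge>0. mdist X ((f \<circ> \<alpha>) t) ((f \<circ> \<alpha>') s) \<le> A * D + B"
    using s by (intro exI[of _ s]) auto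
qed

lemma ray_near_image_near:
  assumes "ray_near Y \<alpha> \<alpha>' D" "near \<alpha>' \<beta>"
    and "geodesic_ray Y q \<alpha>" "geodesic_ray Y q \<alpha>'" "geodesic_ray X p \<beta>"
  shows "near \<alpha> \<beta>"
  using assms(2) ray_near_trans[OF ray_near_image[OF assms(1)], of \<beta>] image_quasi_geodesic(3)[OF assms(3)]
    image_quasi_geodesic(3)[OF assms(4)] geodesic_ray_mspace[OF assms(5)]
    geodesic_ray_mspace[OF assms(3)] geodesic_ray_mspace[OF assms(4)] unfolding near_def by blast

text \<open>The source of well-definedness: all rays of \<open>X\<close> near one ray of
  \<open>Y\<close> are asymptotic.\<close>

lemma near_common_left:
  assumes "near \<alpha> \<beta>" "near \<alpha> \<beta>'"
    and "geodesic_ray Y q \<alpha>" "geodesic_ray X p \<beta>" "geodesic_ray X p \<beta>'"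
  shows "\<exists>D. ray_near X \<beta> \<beta>' D"
proof -
  obtain D where "ray_near X \<beta> (f \<circ> \<alpha>) D" using near_sym assms by blast
  moreover obtain D' where "ray_near X (f \<circ> \<alpha>) \<beta>' D'" using assms(2) by (auto simp: near_def)
  ultimately show ?thesis
    using ray_near_trans[of X \<beta> "f \<circ> \<alpha>" D \<beta>' D'] image_quasi_geodesic(3)[OF assms(3)]
      geodesic_ray_mspace[OF assms(4)] geodesic_ray_mspace[OF assms(5)] by blast
qed

text \<open>The source of injectivity: closeness of the images in \<open>X\<close> returns to
  \<open>Y\<close> through the lower bound of \<open>f\<close>.\<close>

lemma near_common_right:
  assumes "near \<alpha> \<beta>" "near \<alpha>' \<beta>"
    and "geodesic_ray Y q \<alpha>" "geodesic_ray Y q \<alpha>'" "geodesic_ray X p \<beta>"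
  shows "\<exists>D. ray_near Y \<alpha> \<alpha>' D"
proof -
  obtain D where "ray_near X \<beta> (f \<circ> \<alpha>') D" using near_sym assms by blast
  moreover obtain D' where "ray_near X (f \<circ> \<alpha>) \<beta> D'" using assms(1) by (auto simp: near_def)
  ultimately have n: "ray_near X (f \<circ> \<alpha>) (f \<circ> \<alpha>') (D' + D)"
    using ray_near_trans[of X "f \<circ> \<alpha>" \<beta> D' "f \<circ> \<alpha>'" D] image_quasi_geodesic(3)[OF assms(3)]
      image_quasi_geodesic(3)[OF assms(4)] geodesic_ray_mspace[OF assms(5)] by blast
  have "\<exists>s\<ge>0. mdist Y (\<alpha> t) (\<alpha>' s) \<le> A * (D' + D) + B" if t: "t \<ge> 0" for t
  proof -
    obtain s where s: "s \<ge> 0" "mdist X (f (\<alpha> t)) (f (\<alpha>' s)) \<le> D' + D"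
      using n t by (auto simp: ray_near_def)
    have "mdist Y (\<alpha> t) (\<alpha>' s) \<le> A * mdist X (f (\<alpha> t)) (f (\<alpha>' s)) + B"
      using geodesic_rayD(2)[OF assms(3) t] geodesic_rayD(2)[OF assms(4) s(1)]
      by (intro qi_embeddingD(5)[OF qi])
    moreover have "A * mdist X (f (\<alpha> t)) (f (\<alpha>' s)) \<le> A * (D' + D)" using s A by (intro mult_left_mono) auto
    ultimately show ?thesis using s by (intro exI[of _ s]) auto
  qed
  then show ?thesis by (auto simp: ray_near_def)
qed

section \<open>Transport of rays with uniform gauges\<close>

lemma push_ray:
  assumes N: "morse_gauge N"
  shows "\<exists>N' D. morse_gauge N' \<and> (\<forall>\<alpha>. geodesic_ray Y q \<alpha> \<and> morse_with_gauge Y N (\<alpha> ` {0..}) \<longrightarrow>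
     (\<exists>\<beta>. geodesic_ray X p \<beta> \<and> morse_with_gauge X N' (\<beta> ` {0..}) \<and> ray_near X (f \<circ> \<alpha>) \<beta> D))"
proof -
  define N1 where "N1 = (\<lambda>K C. A * N (A * K) (A * (C + 2 * M K C) + B) + B + M K C)"
  have g: "morse_gauge N1" and push: "morse_with_gauge X N1 (f ` Z)" if "morse_with_gauge Y N Z" for Z
    using morse_with_gauge_pushforward[OF qi M(2,1) that N] by (simp_all add: N1_def)
  \<comment> \<open>The empty set satisfies every gauge, so \<open>N1\<close> is known to be a gauge
    before any ray is chosen.\<close>
  have "morse_with_gauge Y N {}" by (simp add: morse_with_gauge_def)
  then have "morse_gauge N1" by (rule g)
  from X.morse_quasi_geodesic_ray[OF A this] obtain N' D where N': "morse_gauge N'"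
    and D: "\<And>c. quasi_geodesic X A B {0..} c \<and> c 0 = p \<and> morse_with_gauge X N1 (c ` {0..}) \<longrightarrow>
      (\<exists>\<beta>. geodesic_ray X p \<beta> \<and> morse_with_gauge X N' (\<beta> ` {0..}) \<and> ray_near X c \<beta> D \<and> ray_near X \<beta> c D)" by blast
  have "\<exists>\<beta>. geodesic_ray X p \<beta> \<and> morse_with_gauge X N' (\<beta> ` {0..}) \<and> ray_near X (f \<circ> \<alpha>) \<beta> D"
    if \<alpha>: "geodesic_ray Y q \<alpha>" "morse_with_gauge Y N (\<alpha> ` {0..})" for \<alpha>
    using D[of "f \<circ> \<alpha>"] image_quasi_geodesic(1,2)[OF \<alpha>(1)] push[OF \<alpha>(2)] by (metis image_comp)
  then show ?thesis using N' by blast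
qed

text \<open>The radius \<open>r\<close> is quantified after \<open>N'\<close> and \<open>D\<close>:
  absorption first replaces it by \<open>M 3 5\<close>. A pointwise lift of \<open>\<beta>\<close>
  is then a quasi-geodesic of \<open>Y\<close>, Morse by pullback, and is straightened
  there.\<close>

lemma pull_ray:
  assumes N: "morse_gauge N"
  shows "\<exists>N' D. morse_gauge N' \<and> (\<forall>\<beta> r. geodesic_ray X p \<beta> \<and> morse_with_gauge X N (\<beta> ` {0..}) \<and>
       \<beta> ` {0..} \<subseteq> metric_nbhd X r (f ` mspace Y) \<longrightarrow>
     (\<exists>\<alpha>. geodesic_ray Y q \<alpha> \<and> morse_with_gauge Y N' (\<alpha> ` {0..}) \<and> ray_near X (f \<circ> \<alpha>) \<beta> D))"
proof -
  define R where "R = M 3 5"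
  have R: "R \<ge> 0" using M(1) by (simp add: R_def morse_gauge_def)
  define N1 where "N1 = (\<lambda>K C. N K (C + 2 * R) + 2 * R)"
  define N2 where "N2 = (\<lambda>K C. A * N1 (A * K) (A * C + B) + B)"
  have N1: "morse_gauge N1" using N R by (simp add: N1_def morse_gauge_def)
  have N2: "morse_gauge N2" using N1 A by (simp add: N2_def morse_gauge_def mult_ge1_I)
  have AR: "A * (2 * R) + B \<ge> 0" using A R by simp
  from Y.morse_quasi_geodesic_ray[OF A(1) AR N2] obtain N' D where N': "morse_gauge N'"
    and D: "\<And>c. quasi_geodesic Y A (A * (2 * R) + B) {0..} c \<and> c 0 = q \<and> morse_with_gauge Y N2 (c ` {0..}) \<longrightarrow>
      (\<exists>\<beta>. geodesic_ray Y q \<beta> \<and> morse_with_gauge Y N' (\<beta> ` {0..}) \<and> ray_near Y c \<beta> D \<and> ray_near Y \<beta> c D)" by blast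
  show ?thesis
  proof (rule exI[of _ N'], rule exI[of _ "A * D + B + R"], intro conjI allI impI, rule N')
    fix \<beta> r
    assume a: "geodesic_ray X p \<beta> \<and> morse_with_gauge X N (\<beta> ` {0..}) \<and> \<beta> ` {0..} \<subseteq> metric_nbhd X r (f ` mspace Y)"
    then have \<beta>: "geodesic_ray X p \<beta>" "morse_with_gauge X N (\<beta> ` {0..})" by auto
    have "\<beta> ` {0..} \<subseteq> metric_nbhd X R (f ` mspace Y)"
      unfolding R_def using a f_base Y.base_mspace by (intro X.morse_subset_absorbs_ray[OF fV _ M(2) \<beta>(1)]) auto
    then have "\<forall>t\<in>{0..}. \<exists>y\<in>mspace Y. mdist X (\<beta> t) (f y) \<le> R" by (force simp: metric_nbhd_def)
    then obtain g where g: "\<And>t. t \<ge> 0 \<Longrightarrow> g t \<in> mspace Y \<and> mdist X (\<beta> t) (f (g t)) \<le> R" by (metis atLeast_iff)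
    \<comment> \<open>Straightening needs a curve that starts exactly at \<open>q\<close>; the new
      value is admissible because \<open>f q = p = \<beta> 0\<close>.\<close>
    define c where "c = g(0 := q)"
    have c: "c t \<in> mspace Y" "mdist X (\<beta> t) (f (c t)) \<le> R" if "t \<ge> 0" for t
      using g[OF that] that Y.base_mspace R X.base_mspace geodesic_rayD(1)[OF \<beta>(1)] f_base by (auto simp: c_def)
    have qc: "quasi_geodesic Y A (A * (2 * R) + B) {0..} c"
      using quasi_geodesic_lift[OF qi geodesic_ray_quasi_geodesic[OF \<beta>(1), of 1 0] _ _ R, of c] c by auto
    have cs: "c ` {0..} \<subseteq> mspace Y" "(f \<circ> c) ` {0..} \<subseteq> mspace X" using c f_mspace by auto
    have n: "ray_near X \<beta> (f \<circ> c) R" "ray_near X (f \<circ> c) \<beta> R"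
      using c(2) by (auto simp: ray_near_def mdist_commute)
    have "morse_with_gauge X N1 (f ` c ` {0..})"
      using morse_with_gauge_ray_near(1)[OF \<beta>(2) N n cs(2) R] by (simp add: N1_def image_comp)
    then have "morse_with_gauge Y N2 (c ` {0..})"
      using morse_with_gauge_pullback(1)[OF qi cs(1) _ N1] by (simp add: N2_def)
    then obtain \<alpha> where \<alpha>: "geodesic_ray Y q \<alpha>" "morse_with_gauge Y N' (\<alpha> ` {0..})" "ray_near Y \<alpha> c D"
      using D[of c] qc by (auto simp: c_def)
    show "\<exists>\<alpha>. geodesic_ray Y q \<alpha> \<and> morse_with_gauge Y N' (\<alpha> ` {0..}) \<and> ray_near X (f \<circ> \<alpha>) \<beta> (A * D + B + R)"
      using \<alpha>(1,2) ray_near_trans[OF ray_near_image[OF \<alpha>(3) geodesic_ray_mspace[OF \<alpha>(1)] cs(1)] n(2)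
        image_quasi_geodesic(3)[OF \<alpha>(1)] cs(2) geodesic_ray_mspace[OF \<beta>(1)]] by blast
  qed
qed

text \<open>Since \<open>f\<close> need not be continuous, points at distance below \<open>1\<close>
  have images within \<open>A + B\<close>; with \<open>D\<close> for the common bound and
  \<open>1\<close> for the convergence of \<open>\<beta>\<close> this gives
  \<open>A + B + D + 1\<close>.\<close>

lemma near_limit:
  assumes \<alpha>: "\<And>n. geodesic_ray Y q (\<alpha> n)" "geodesic_ray Y q \<alpha>'" "converges_on_compacta Y \<alpha> \<alpha>'"
    and \<beta>: "\<And>n. geodesic_ray X p (\<beta> n)" "geodesic_ray X p \<beta>'" "converges_on_compacta X \<beta> \<beta>'"
    and near: "\<And>n. ray_near X (f \<circ> \<alpha> n) (\<beta> n) D"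
  shows "near \<alpha>' \<beta>'"
proof -
  have "D \<ge> 0" using near[of 0] mdist_nonneg unfolding ray_near_def by (meson order_refl order_trans)
  have "\<exists>s\<ge>0. mdist X (f (\<alpha>' t)) (\<beta>' s) \<le> A + B + D + 1" if t: "t \<ge> 0" for t
  proof -
    \<comment> \<open>Bounds the time at which \<open>\<beta> n\<close> comes close to
      \<open>f (\<alpha> n t)\<close>, because that time is its distance from \<open>p\<close>.
      Uniform convergence on \<open>{0..b}\<close> therefore suffices for all
      \<open>n\<close>.\<close>
    define b where "b = A * t + B + D"
    have "b \<ge> 0" using A t \<open>D \<ge> 0\<close> by (simp add: b_def)
    then obtain n where "\<forall>u\<in>{0..t}. mdist Y (\<alpha> n u) (\<alpha>' u) < 1" "\<forall>s\<in>{0..b}. mdist X (\<beta> n s) (\<beta>' s) < 1"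
      using eventually_happens'[OF sequentially_bot eventually_conj[OF
        converges_on_compactaD[OF \<alpha>(3) zero_less_one t] converges_on_compactaD[OF \<beta>(3) zero_less_one]]]
      by blast
    then have n: "mdist Y (\<alpha> n t) (\<alpha>' t) < 1" "\<And>s. 0 \<le> s \<Longrightarrow> s \<le> b \<Longrightarrow> mdist X (\<beta> n s) (\<beta>' s) < 1"
      using t by auto
    note a = geodesic_rayD[OF \<alpha>(1)[of n]] and a' = geodesic_rayD[OF \<alpha>(2)]
      and b = geodesic_rayD[OF \<beta>(1)[of n]] and b' = geodesic_rayD[OF \<beta>(2)]
    obtain s where s: "s \<ge> 0" "mdist X (f (\<alpha> n t)) (\<beta> n s) \<le> D"
      using near[of n] t by (auto simp: ray_near_def)
    note m = f_mspace[OF a(2)[OF t]] f_mspace[OF a'(2)[OF t]] b(2)[OF s(1)] b'(2)[OF s(1)]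
    have "mdist X (f q) (f (\<alpha> n t)) \<le> A * mdist Y q (\<alpha> n t) + B"
      using a(2)[OF t] Y.base_mspace by (intro qi_embeddingD(4)[OF qi]) auto
    moreover have "mdist X p (\<beta> n s) \<le> mdist X p (f (\<alpha> n t)) + mdist X (f (\<alpha> n t)) (\<beta> n s)"
      using m X.base_mspace by (intro mdist_triangle) auto
    ultimately have "s \<le> b" using a(4)[OF t] b(4)[OF s(1)] s(2) by (simp add: b_def f_base)
    have "mdist X (f (\<alpha>' t)) (f (\<alpha> n t)) \<le> A * mdist Y (\<alpha>' t) (\<alpha> n t) + B"
      by (rule qi_embeddingD(4)[OF qi a'(2)[OF t] a(2)[OF t]])
    moreover have "A * mdist Y (\<alpha>' t) (\<alpha> n t) \<le> A * 1"
      using n(1) A by (intro mult_left_mono) (auto simp: mdist_commute)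
    ultimately have "mdist X (f (\<alpha>' t)) (\<beta>' s) \<le> A + B + D + 1"
      using mdist_triangle4[OF m(2,1,3,4)] s(2) n(2)[OF s(1) \<open>s \<le> b\<close>] by linarith
    then show ?thesis using s(1) by blast
  qed
  then show ?thesis unfolding near_def ray_near_def comp_def by blast
qed

section \<open>The induced map on boundary points\<close>

definition boundary_map :: "(real \<Rightarrow> 'q) set \<Rightarrow> (real \<Rightarrow> 'p) set" where
  "boundary_map x = {\<beta> \<in> morse_rays X p. \<exists>\<alpha>\<in>x. near \<alpha> \<beta>}"

lemma ex_near:
  assumes "\<alpha> \<in> morse_rays Y q"
  shows "\<exists>\<beta>\<in>morse_rays X p. near \<alpha> \<beta>"
proof -
  obtain N where N: "morse_gauge N" "morse_with_gauge Y N (\<alpha> ` {0..})" "geodesic_ray Y q \<alpha>"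
    using assms by (auto simp: morse_rays_def morse_subset_def)
  from push_ray[OF N(1)] N(2,3) obtain N' D \<beta> where "morse_gauge N'" "geodesic_ray X p \<beta>"
    "morse_with_gauge X N' (\<beta> ` {0..})" "ray_near X (f \<circ> \<alpha>) \<beta> D" by blast
  then show ?thesis unfolding morse_rays_def morse_subset_def near_def by blast
qed

text \<open>Any fixed representative \<open>\<alpha>\<close> decides membership. For the converse,
  \<open>ex_near\<close> provides a Morse ray near \<open>\<alpha>\<close>; a geodesic ray
  \<open>\<beta>\<close> near \<open>\<alpha>\<close> is close to it and hence Morse too.\<close>

lemma mem_boundary_map:
  assumes x: "x \<in> boundary_points Y q" "\<alpha> \<in> x" and \<beta>: "geodesic_ray X p \<beta>"
  shows "\<beta> \<in> boundary_map x \<longleftrightarrow> near \<alpha> \<beta>"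
proof
  note g = boundary_points_geodesic_ray[OF x(1)]
  assume "\<beta> \<in> boundary_map x"
  then obtain \<alpha>' where \<alpha>': "\<alpha>' \<in> x" "near \<alpha>' \<beta>" by (auto simp: boundary_map_def)
  obtain D where "ray_near Y \<alpha> \<alpha>' D" using boundary_points_near[OF x \<alpha>'(1)] by blast
  then show "near \<alpha> \<beta>" using ray_near_image_near[OF _ \<alpha>'(2) g[OF x(2)] g[OF \<alpha>'(1)] \<beta>] by blast
next
  note g = boundary_points_geodesic_ray[OF x]
  assume n: "near \<alpha> \<beta>"
  obtain \<gamma> where \<gamma>: "\<gamma> \<in> morse_rays X p" "near \<alpha> \<gamma>"
    using ex_near[OF boundary_points_morse_rays[OF x]] by blast
  then have "geodesic_ray X p \<gamma>" by (simp add: morse_rays_def)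
  from near_common_left[OF n \<gamma>(2) g \<beta> this] obtain D where "ray_near X \<beta> \<gamma> D" by blast
  from geodesic_ray_near_morse[OF \<gamma>(1) \<beta> this] show "\<beta> \<in> boundary_map x"
    using n x(2) by (auto simp: boundary_map_def)
qed

lemma boundary_map_nonempty: "x \<in> boundary_points Y q \<Longrightarrow> \<exists>\<beta>. \<beta> \<in> boundary_map x"
  using boundary_points_nonempty[of x Y q] ex_near boundary_points_morse_rays[of x Y q]
  unfolding boundary_map_def by fast

lemma boundary_map_geodesic_ray: "\<beta> \<in> boundary_map x \<Longrightarrow> geodesic_ray X p \<beta>"
  by (simp add: boundary_map_def morse_rays_def)

lemma boundary_map_in_boundary:
  assumes x: "x \<in> boundary_points Y q"
  shows "boundary_map x \<in> boundary_points X p"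
proof -
  obtain \<alpha> where \<alpha>: "\<alpha> \<in> x" using boundary_points_nonempty[OF x] by blast
  note ga = boundary_points_geodesic_ray[OF x \<alpha>]
  obtain \<beta> where \<beta>: "\<beta> \<in> boundary_map x" using boundary_map_nonempty[OF x] by blast
  note gb = boundary_map_geodesic_ray[OF \<beta>]
  have n: "near \<alpha> \<beta>" using mem_boundary_map[OF x \<alpha> gb] \<beta> by simp
  have "\<beta> \<in> morse_rays X p" using \<beta> by (simp add: boundary_map_def)
  then obtain y where y: "y \<in> boundary_points X p" "\<beta> \<in> y" using boundary_points_ex by meson
  have "boundary_map x = y"
  proof (intro equalityI subsetI)
    fix \<gamma> assume \<gamma>: "\<gamma> \<in> boundary_map x"
    note gc = boundary_map_geodesic_ray[OF \<gamma>]
    have "near \<alpha> \<gamma>" using mem_boundary_map[OF x \<alpha> gc] \<gamma> by simp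
    then obtain D where "ray_near X \<gamma> \<beta> D" using near_common_left[OF _ n ga gc gb] by blast
    then show "\<gamma> \<in> y" by (rule boundary_points_near_mem[OF y gc])
  next
    fix \<gamma> assume \<gamma>: "\<gamma> \<in> y"
    note gc = boundary_points_geodesic_ray[OF y(1) \<gamma>]
    obtain D where "ray_near X \<beta> \<gamma> D" using boundary_points_near[OF y \<gamma>] by blast
    then have "near \<alpha> \<gamma>" by (rule near_ray_near[OF n _ ga gb gc])
    then show "\<gamma> \<in> boundary_map x" using mem_boundary_map[OF x \<alpha> gc] by simp
  qed
  then show ?thesis using y by simp
qed

text \<open>Recognises the rays of \<open>x\<close> from one ray of its image; this serves
  injectivity and also identifies limits when convergence is pulled back.\<close>

lemma near_mem:
  assumes x: "x \<in> boundary_points Y q" and \<beta>: "\<beta> \<in> boundary_map x"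
    and \<alpha>: "geodesic_ray Y q \<alpha>" "near \<alpha> \<beta>"
  shows "\<alpha> \<in> x"
proof -
  obtain \<alpha>' where \<alpha>': "\<alpha>' \<in> x" "near \<alpha>' \<beta>" using \<beta> by (auto simp: boundary_map_def)
  obtain D where "ray_near Y \<alpha> \<alpha>' D"
    using near_common_right[OF \<alpha>(2) \<alpha>'(2) \<alpha>(1) boundary_points_geodesic_ray[OF x \<alpha>'(1)] boundary_map_geodesic_ray[OF \<beta>]]
    by blast
  then show ?thesis by (rule boundary_points_near_mem[OF x \<alpha>'(1) \<alpha>(1)])
qed

lemma inj_on_boundary_map: "inj_on boundary_map (boundary_points Y q)"
proof (rule inj_onI)
  fix x y assume x: "x \<in> boundary_points Y q" and y: "y \<in> boundary_points Y q" and e: "boundary_map x = boundary_map y"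
  obtain \<alpha> where \<alpha>: "\<alpha> \<in> x" using boundary_points_nonempty[OF x] by blast
  obtain \<beta> where \<beta>: "\<beta> \<in> boundary_map x" using boundary_map_nonempty[OF x] by blast
  have "near \<alpha> \<beta>" using mem_boundary_map[OF x \<alpha> boundary_map_geodesic_ray[OF \<beta>]] \<beta> by simp
  then have "\<alpha> \<in> y" using near_mem[OF y] boundary_points_geodesic_ray[OF x \<alpha>] \<beta> e by simp
  then show "x = y" using boundary_points_eqI[OF x y \<alpha>] by simp
qed

text \<open>Passing to another representative changes the radius, but absorption resets it. The
  radius \<open>M 3 5\<close>, common to all points of the limit set, is what survives
  limits.\<close>

lemma limit_set_ray:
  assumes y: "y \<in> limit_set X p (f ` mspace Y)" and \<beta>: "\<beta> \<in> y"
  shows "\<beta> ` {0..} \<subseteq> metric_nbhd X (M 3 5) (f ` mspace Y)"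
proof -
  obtain \<gamma> r where \<gamma>: "\<gamma> \<in> y" "\<gamma> ` {0..} \<subseteq> metric_nbhd X r (f ` mspace Y)" and yb: "y \<in> boundary_points X p"
    using y by (auto simp: limit_set_def)
  obtain D where "ray_near X \<beta> \<gamma> D" using boundary_points_near[OF yb \<beta> \<gamma>(1)] by blast
  then have "\<beta> ` {0..} \<subseteq> metric_nbhd X D (\<gamma> ` {0..})"
    using ray_near_nbhd[OF geodesic_ray_mspace[OF boundary_points_geodesic_ray[OF yb \<beta>]]] by blast
  then have "\<beta> ` {0..} \<subseteq> metric_nbhd X (D + r) (f ` mspace Y)"
    using metric_nbhd_trans[OF _ \<gamma>(2)] morse_with_gauge_subset[OF M(2)] by blast
  then show ?thesis
    using f_base Y.base_mspace
    by (intro X.morse_subset_absorbs_ray[OF fV _ M(2) boundary_points_geodesic_ray[OF yb \<beta>]]) auto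
qed

lemma boundary_map_in_limit_set:
  assumes x: "x \<in> boundary_points Y q"
  shows "boundary_map x \<in> limit_set X p (f ` mspace Y)"
proof -
  obtain \<alpha> where \<alpha>: "\<alpha> \<in> x" using boundary_points_nonempty[OF x] by blast
  note ga = boundary_points_geodesic_ray[OF x \<alpha>]
  obtain \<beta> where \<beta>: "\<beta> \<in> boundary_map x" using boundary_map_nonempty[OF x] by blast
  note gb = boundary_map_geodesic_ray[OF \<beta>]
  have "near \<alpha> \<beta>" using mem_boundary_map[OF x \<alpha> gb] \<beta> by simp
  then obtain D where D: "ray_near X \<beta> (f \<circ> \<alpha>) D" using near_sym[OF _ ga gb] by blast
  have "(f \<circ> \<alpha>) ` {0..} \<subseteq> f ` mspace Y" using geodesic_ray_mspace[OF ga] by auto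
  then have "\<beta> ` {0..} \<subseteq> metric_nbhd X D (f ` mspace Y)"
    using D[unfolded ray_near_nbhd[OF geodesic_ray_mspace[OF gb]]] metric_nbhd_mono by (meson order_trans)
  then show ?thesis using \<beta> boundary_map_in_boundary[OF x] unfolding limit_set_def by blast
qed

section \<open>Convergence in strata under the boundary map\<close>

lemma stratum_converges_push:
  assumes N: "morse_gauge N"
  shows "\<exists>N'. morse_gauge N' \<and> (\<forall>x y. stratum_converges Y q N x y \<longrightarrow>
    stratum_converges X p N' (\<lambda>n. boundary_map (x n)) (boundary_map y))"
proof -
  from push_ray[OF N] obtain N' D where N': "morse_gauge N'"
    and push: "\<And>\<alpha>. geodesic_ray Y q \<alpha> \<Longrightarrow> morse_with_gauge Y N (\<alpha> ` {0..}) \<Longrightarrow>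
     \<exists>\<beta>. geodesic_ray X p \<beta> \<and> morse_with_gauge X N' (\<beta> ` {0..}) \<and> ray_near X (f \<circ> \<alpha>) \<beta> D" by blast
  have stratum: "boundary_map x \<in> boundary_stratum X p N'" if x: "x \<in> boundary_stratum Y q N" for x
  proof -
    obtain \<alpha> where xb: "x \<in> boundary_points Y q" and \<alpha>: "\<alpha> \<in> x" "morse_with_gauge Y N (\<alpha> ` {0..})"
      using x by (auto simp: boundary_stratum_def)
    obtain \<beta> where \<beta>: "geodesic_ray X p \<beta>" "morse_with_gauge X N' (\<beta> ` {0..})" "ray_near X (f \<circ> \<alpha>) \<beta> D"
      using push[OF boundary_points_geodesic_ray[OF xb \<alpha>(1)] \<alpha>(2)] by blast
    then have "\<beta> \<in> boundary_map x" using mem_boundary_map[OF xb \<alpha>(1) \<beta>(1)] near_def by blast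
    then show ?thesis using \<beta>(2) boundary_map_in_boundary[OF xb] by (auto simp: boundary_stratum_def)
  qed
  have "stratum_converges X p N' (\<lambda>n. boundary_map (x n)) (boundary_map y)"
    if c: "stratum_converges Y q N x y" for x y
  proof -
    from c obtain \<alpha> where xs: "\<And>n. x n \<in> boundary_stratum Y q N" and ys: "y \<in> boundary_stratum Y q N"
      and \<alpha>: "\<And>n. \<alpha> n \<in> x n \<and> morse_with_gauge Y N (\<alpha> n ` {0..})"
      and sub: "\<And>r. strict_mono (r :: nat \<Rightarrow> nat) \<Longrightarrow> \<exists>s \<gamma>. strict_mono (s :: nat \<Rightarrow> nat) \<and> \<gamma> \<in> y \<and>
                    converges_on_compacta Y (\<lambda>n. \<alpha> (r (s n))) \<gamma>"
      unfolding stratum_converges_def by blast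
    have xb: "x n \<in> boundary_points Y q" for n using xs by (simp add: boundary_stratum_def)
    have yb: "y \<in> boundary_points Y q" using ys by (simp add: boundary_stratum_def)
    have ga: "geodesic_ray Y q (\<alpha> n)" for n using boundary_points_geodesic_ray[OF xb] \<alpha> by blast
    have "\<forall>n. \<exists>\<beta>. geodesic_ray X p \<beta> \<and> morse_with_gauge X N' (\<beta> ` {0..}) \<and> ray_near X (f \<circ> \<alpha> n) \<beta> D"
      using push ga \<alpha> by blast
    then obtain \<beta> where \<beta>: "\<And>n. geodesic_ray X p (\<beta> n)" "\<And>n. morse_with_gauge X N' (\<beta> n ` {0..})"
      "\<And>n. ray_near X (f \<circ> \<alpha> n) (\<beta> n) D" by metis
    have "\<beta> n \<in> boundary_map (x n)" for n
      using mem_boundary_map[OF xb _ \<beta>(1)] \<alpha> \<beta>(3) near_def by blast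
    moreover have "\<exists>s \<gamma>. strict_mono (s :: nat \<Rightarrow> nat) \<and> \<gamma> \<in> boundary_map y \<and>
                    converges_on_compacta X (\<lambda>n. \<beta> (r (s n))) \<gamma>" if r: "strict_mono (r :: nat \<Rightarrow> nat)" for r
    proof -
      obtain s \<gamma> where s: "strict_mono (s :: nat \<Rightarrow> nat)" "\<gamma> \<in> y" "converges_on_compacta Y (\<lambda>n. \<alpha> (r (s n))) \<gamma>"
        using sub[OF r] by blast
      \<comment> \<open>Convergence of \<open>\<alpha>\<close> along \<open>s\<close> says nothing
        about \<open>\<beta>\<close> directly: compactness extracts a further subsequence, and
        \<open>near_limit\<close> identifies its limit.\<close>
      obtain u \<delta> where u: "strict_mono (u :: nat \<Rightarrow> nat)" "geodesic_ray X p \<delta>"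
          "converges_on_compacta X (\<lambda>n. \<beta> (r (s (u n)))) \<delta>"
        using X.arzela_ascoli_rays[of "\<lambda>n. \<beta> (r (s n))"] \<beta>(1) by blast
      have "near \<gamma> \<delta>"
        by (rule near_limit[OF ga boundary_points_geodesic_ray[OF yb s(2)] converges_on_compacta_subseq[OF s(3) u(1)]
            \<beta>(1) u(2,3) \<beta>(3)])
      then have "\<delta> \<in> boundary_map y" using mem_boundary_map[OF yb s(2) u(2)] by simp
      moreover have "strict_mono (s \<circ> u)" using s(1) u(1) by (rule strict_mono_o)
      ultimately show ?thesis using u(3) by (intro exI[of _ "s \<circ> u"] exI[of _ \<delta>]) simp
    qed
    ultimately show ?thesis
      using stratum xs ys \<beta>(2) unfolding stratum_converges_def by blast
  qed
  then show ?thesis using N' by blast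
qed

text \<open>The counterpart for sequences in the limit set, and the core of closedness: both the
  sequence and its limit have preimages, and the preimages converge in one stratum that depends only
  on \<open>N\<close>.\<close>

lemma stratum_converges_pull:
  assumes N: "morse_gauge N"
  shows "\<exists>N'. morse_gauge N' \<and> (\<forall>x y. stratum_converges X p N x y \<and> range x \<subseteq> limit_set X p (f ` mspace Y) \<longrightarrow>
    (\<exists>x' y'. stratum_converges Y q N' x' y' \<and> x = (\<lambda>n. boundary_map (x' n)) \<and> y = boundary_map y'))"
proof -
  let ?L = "limit_set X p (f ` mspace Y)"
  from pull_ray[OF N] obtain N' D where N': "morse_gauge N'"
    and pull: "\<And>\<beta> r. geodesic_ray X p \<beta> \<Longrightarrow> morse_with_gauge X N (\<beta> ` {0..}) \<Longrightarrow>
       \<beta> ` {0..} \<subseteq> metric_nbhd X r (f ` mspace Y) \<Longrightarrow>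
     \<exists>\<alpha>. geodesic_ray Y q \<alpha> \<and> morse_with_gauge Y N' (\<alpha> ` {0..}) \<and> ray_near X (f \<circ> \<alpha>) \<beta> D" by blast
  have preimage: "\<exists>x\<in>boundary_stratum Y q N'. \<exists>\<alpha>\<in>x. morse_with_gauge Y N' (\<alpha> ` {0..}) \<and>
      ray_near X (f \<circ> \<alpha>) \<beta> D \<and> y = boundary_map x"
    if y: "y \<in> ?L" and \<beta>: "\<beta> \<in> y" "morse_with_gauge X N (\<beta> ` {0..})" for y \<beta>
  proof -
    have yb: "y \<in> boundary_points X p" using y by (simp add: limit_set_def)
    note gb = boundary_points_geodesic_ray[OF yb \<beta>(1)]
    obtain \<alpha> where \<alpha>: "geodesic_ray Y q \<alpha>" "morse_with_gauge Y N' (\<alpha> ` {0..})" "ray_near X (f \<circ> \<alpha>) \<beta> D"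
      using pull[OF gb \<beta>(2) limit_set_ray[OF y \<beta>(1)]] by blast
    have "\<alpha> \<in> morse_rays Y q" using \<alpha> N' by (auto simp: morse_rays_def morse_subset_def)
    then obtain x where x: "x \<in> boundary_points Y q" "\<alpha> \<in> x" using boundary_points_ex by meson
    have "\<beta> \<in> boundary_map x" using mem_boundary_map[OF x gb] \<alpha>(3) near_def by blast
    then have "y = boundary_map x" by (rule boundary_points_eqI[OF yb boundary_map_in_boundary[OF x(1)] \<beta>(1)])
    moreover have "x \<in> boundary_stratum Y q N'" using x \<alpha>(2) by (auto simp: boundary_stratum_def)
    ultimately show ?thesis using x(2) \<alpha>(2,3) by blast
  qed
  have "\<exists>x' y'. stratum_converges Y q N' x' y' \<and> x = (\<lambda>n. boundary_map (x' n)) \<and> y = boundary_map y'"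
    if c: "stratum_converges X p N x y" and xL: "range x \<subseteq> ?L" for x y
  proof -
    from c obtain \<beta> where xs: "\<And>n. x n \<in> boundary_stratum X p N" and ys: "y \<in> boundary_stratum X p N"
      and \<beta>: "\<And>n. \<beta> n \<in> x n" "\<And>n. morse_with_gauge X N (\<beta> n ` {0..})"
      and sub: "\<And>r. strict_mono (r :: nat \<Rightarrow> nat) \<Longrightarrow> \<exists>s \<gamma>. strict_mono (s :: nat \<Rightarrow> nat) \<and> \<gamma> \<in> y \<and>
                    converges_on_compacta X (\<lambda>n. \<beta> (r (s n))) \<gamma>"
      unfolding stratum_converges_def by blast
    have xb: "x n \<in> boundary_points X p" for n using xs by (simp add: boundary_stratum_def)
    have yb: "y \<in> boundary_points X p" using ys by (simp add: boundary_stratum_def)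
    have gb: "geodesic_ray X p (\<beta> n)" for n using boundary_points_geodesic_ray[OF xb \<beta>(1)] .
    have "\<forall>n. \<exists>x'. \<exists>\<alpha>. x' \<in> boundary_stratum Y q N' \<and> \<alpha> \<in> x' \<and> morse_with_gauge Y N' (\<alpha> ` {0..}) \<and>
      ray_near X (f \<circ> \<alpha>) (\<beta> n) D \<and> x n = boundary_map x'"
      using preimage[OF _ \<beta>] xL by blast
    then obtain x' \<alpha> where x': "\<And>n. x' n \<in> boundary_stratum Y q N'" and \<alpha>: "\<And>n. \<alpha> n \<in> x' n"
        "\<And>n. morse_with_gauge Y N' (\<alpha> n ` {0..})" "\<And>n. ray_near X (f \<circ> \<alpha> n) (\<beta> n) D"
      and xx': "\<And>n. x n = boundary_map (x' n)" by metis
    have x'b: "x' n \<in> boundary_points Y q" for n using x' by (simp add: boundary_stratum_def)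
    have ga: "geodesic_ray Y q (\<alpha> n)" for n using boundary_points_geodesic_ray[OF x'b \<alpha>(1)] .
    \<comment> \<open>All rays \<open>\<beta> n\<close> lie in the neighbourhood of radius
      \<open>M 3 5\<close>, independently of \<open>n\<close>, so a limit of them stays within one
      unit more.\<close>
    have "y \<in> ?L"
    proof -
      obtain s \<gamma> where s: "strict_mono (s :: nat \<Rightarrow> nat)" "\<gamma> \<in> y" "converges_on_compacta X (\<lambda>n. \<beta> (s n)) \<gamma>"
        using sub[of "\<lambda>n. n"] strict_mono_id by (auto simp: id_def)
      note gc = boundary_points_geodesic_ray[OF yb s(2)]
      have "\<gamma> t \<in> metric_nbhd X (1 + M 3 5) (f ` mspace Y)" if t: "t \<ge> 0" for t
      proof -
        obtain n where "\<forall>u\<in>{0..t}. mdist X (\<beta> (s n) u) (\<gamma> u) < 1"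
          using eventually_happens'[OF sequentially_bot converges_on_compactaD[OF s(3) zero_less_one t]] by blast
        then have n: "mdist X (\<beta> (s n) t) (\<gamma> t) < 1" using t by simp
        have "\<beta> (s n) t \<in> metric_nbhd X (M 3 5) (f ` mspace Y)"
          using limit_set_ray[OF _ \<beta>(1), of "s n"] xL t by auto
        moreover have "\<gamma> t \<in> metric_nbhd X 1 {\<beta> (s n) t}"
          using n geodesic_rayD(2)[OF gc t] by (auto simp: metric_nbhd_def mdist_commute)
        ultimately show ?thesis
          using metric_nbhd_trans[of "{\<gamma> t}" X 1 "{\<beta> (s n) t}"] morse_with_gauge_subset[OF M(2)] by simp
      qed
      then show ?thesis using s(2) yb by (auto simp: limit_set_def)
    qed
    \<comment> \<open>A limit ray in \<open>y\<close> is Morse with some gauge, whereas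
      \<open>preimage\<close> asks for gauge \<open>N\<close>; membership of \<open>y\<close> in the
      stratum supplies such a representative.\<close>
    moreover obtain \<xi> where "\<xi> \<in> y" "morse_with_gauge X N (\<xi> ` {0..})"
      using ys by (auto simp: boundary_stratum_def)
    ultimately obtain y' where y': "y' \<in> boundary_stratum Y q N'" "y = boundary_map y'"
      using preimage by meson
    have y'b: "y' \<in> boundary_points Y q" using y' by (simp add: boundary_stratum_def)
    have "\<exists>s \<gamma>. strict_mono (s :: nat \<Rightarrow> nat) \<and> \<gamma> \<in> y' \<and>
                    converges_on_compacta Y (\<lambda>n. \<alpha> (r (s n))) \<gamma>" if r: "strict_mono (r :: nat \<Rightarrow> nat)" for r
    proof -
      obtain s \<gamma> where s: "strict_mono (s :: nat \<Rightarrow> nat)" "\<gamma> \<in> y" "converges_on_compacta X (\<lambda>n. \<beta> (r (s n))) \<gamma>"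
        using sub[OF r] by blast
      obtain u \<delta> where u: "strict_mono (u :: nat \<Rightarrow> nat)" "geodesic_ray Y q \<delta>"
          "converges_on_compacta Y (\<lambda>n. \<alpha> (r (s (u n)))) \<delta>"
        using Y.arzela_ascoli_rays[of "\<lambda>n. \<alpha> (r (s n))"] ga by blast
      have "near \<delta> \<gamma>"
        by (rule near_limit[OF ga u(2,3) gb boundary_points_geodesic_ray[OF yb s(2)]
              converges_on_compacta_subseq[OF s(3) u(1)] \<alpha>(3)])
      then have "\<delta> \<in> y'" using near_mem[OF y'b _ u(2)] s(2) y'(2) by simp
      moreover have "strict_mono (s \<circ> u)" using s(1) u(1) by (rule strict_mono_o)
      ultimately show ?thesis using u(3) by (intro exI[of _ "s \<circ> u"] exI[of _ \<delta>]) simp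
    qed
    then have "stratum_converges Y q N' x' y'"
      using x' y'(1) \<alpha>(1,2) unfolding stratum_converges_def by blast
    then show ?thesis using xx' y'(2) by blast
  qed
  then show ?thesis using N' by blast
qed

lemma boundary_map_image: "boundary_map ` boundary_points Y q = limit_set X p (f ` mspace Y)"
proof (intro equalityI subsetI)
  fix y assume y: "y \<in> limit_set X p (f ` mspace Y)"
  then have yb: "y \<in> boundary_points X p" by (simp add: limit_set_def)
  obtain \<beta> where \<beta>: "\<beta> \<in> y" using boundary_points_nonempty[OF yb] by blast
  then obtain N where N: "morse_gauge N" "morse_with_gauge X N (\<beta> ` {0..})"
    using boundary_points_morse_rays[OF yb] by (auto simp: morse_rays_def morse_subset_def)
  note gb = boundary_points_geodesic_ray[OF yb \<beta>]
  obtain N' \<alpha> D where N': "morse_gauge N'" and \<alpha>: "geodesic_ray Y q \<alpha>" "morse_with_gauge Y N' (\<alpha> ` {0..})"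
      "ray_near X (f \<circ> \<alpha>) \<beta> D"
    using pull_ray[OF N(1)] gb N(2) limit_set_ray[OF y \<beta>] by metis
  have "\<alpha> \<in> morse_rays Y q" using \<alpha> N' by (auto simp: morse_rays_def morse_subset_def)
  then obtain x where x: "x \<in> boundary_points Y q" "\<alpha> \<in> x" using boundary_points_ex by meson
  have "\<beta> \<in> boundary_map x" using mem_boundary_map[OF x gb] \<alpha>(3) near_def by blast
  then have "y = boundary_map x" by (rule boundary_points_eqI[OF yb boundary_map_in_boundary[OF x(1)] \<beta>])
  then show "y \<in> boundary_map ` boundary_points Y q" using x(1) by blast
qed (use boundary_map_in_limit_set in blast)

lemma embedding_boundary_map: "embedding_map (morse_boundary Y q) (morse_boundary X p) boundary_map"
proof (rule injective_closed_imp_embedding_map)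
  have push: "\<exists>N'. morse_gauge N' \<and> stratum_converges X p N' (\<lambda>n. boundary_map (x n)) (boundary_map y)"
    if "morse_gauge N" "stratum_converges Y q N x y" for N x y
    using stratum_converges_push[OF that(1)] that(2) by blast
  have pull: "\<exists>N' x' y'. morse_gauge N' \<and> stratum_converges Y q N' x' y' \<and>
      x = (\<lambda>n. boundary_map (x' n)) \<and> y = boundary_map y'"
    if c: "morse_gauge N" "stratum_converges X p N x y" "range x \<subseteq> limit_set X p (f ` mspace Y)" for N x y
  proof -
    obtain N' where "morse_gauge N'" "\<forall>x y. stratum_converges X p N x y \<and> range x \<subseteq> limit_set X p (f ` mspace Y) \<longrightarrow>
        (\<exists>x' y'. stratum_converges Y q N' x' y' \<and> x = (\<lambda>n. boundary_map (x' n)) \<and> y = boundary_map y')"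
      using stratum_converges_pull[OF c(1)] by (elim exE conjE) (rule that)
    then show ?thesis using c(2,3) by (meson exI conjI)
  qed
  show "continuous_map (morse_boundary Y q) (morse_boundary X p) boundary_map"
    unfolding continuous_map_closedin topspace_morse_boundary
  proof (intro conjI allI impI ballI)
    show "boundary_map \<in> boundary_points Y q \<rightarrow> boundary_points X p"
      using boundary_map_in_boundary by blast
    fix C assume "closedin (morse_boundary X p) C"
    then have C: "\<And>N x y. morse_gauge N \<Longrightarrow> range x \<subseteq> C \<Longrightarrow> stratum_converges X p N x y \<Longrightarrow> y \<in> C"
      unfolding closedin_morse_boundary by blast
    show "closedin (morse_boundary Y q) {x \<in> boundary_points Y q. boundary_map x \<in> C}"
      unfolding closedin_morse_boundary
    proof (intro conjI allI impI)
      fix N x y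
      assume a: "morse_gauge N \<and> range x \<subseteq> {x \<in> boundary_points Y q. boundary_map x \<in> C} \<and> stratum_converges Y q N x y"
      then obtain N' where "morse_gauge N'" "stratum_converges X p N' (\<lambda>n. boundary_map (x n)) (boundary_map y)"
        using push[of N x y] by blast
      moreover have "range (\<lambda>n. boundary_map (x n)) \<subseteq> C" using a by auto
      ultimately have "boundary_map y \<in> C" using C by blast
      moreover have "y \<in> boundary_points Y q"
        using a by (simp add: stratum_converges_def boundary_stratum_def)
      ultimately show "y \<in> {x \<in> boundary_points Y q. boundary_map x \<in> C}" by simp
    qed auto
  qed
  show "closed_map (morse_boundary Y q) (morse_boundary X p) boundary_map"
    unfolding closed_map_def
  proof (intro allI impI)
    fix C assume "closedin (morse_boundary Y q) C"
    then have Cs: "C \<subseteq> boundary_points Y q"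
      and C: "\<And>N x y. morse_gauge N \<Longrightarrow> range x \<subseteq> C \<Longrightarrow> stratum_converges Y q N x y \<Longrightarrow> y \<in> C"
      unfolding closedin_morse_boundary by blast+
    show "closedin (morse_boundary X p) (boundary_map ` C)"
      unfolding closedin_morse_boundary
    proof (intro conjI allI impI)
      show "boundary_map ` C \<subseteq> boundary_points X p" using Cs boundary_map_in_boundary by blast
      fix N x y
      assume a: "morse_gauge N \<and> range x \<subseteq> boundary_map ` C \<and> stratum_converges X p N x y"
      have "boundary_map ` C \<subseteq> limit_set X p (f ` mspace Y)" using Cs boundary_map_in_limit_set by auto
      then have "range x \<subseteq> limit_set X p (f ` mspace Y)" using a by (meson order_trans)
      then obtain N' x' y' where N': "morse_gauge N'" and x': "stratum_converges Y q N' x' y'"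
        "x = (\<lambda>n. boundary_map (x' n))" "y = boundary_map y'"
        using pull[of N x y] a by auto
      \<comment> \<open>The point \<open>x' n\<close> was built from a pulled back ray rather than
        picked in \<open>C\<close>; injectivity identifies it with the element of \<open>C\<close>
        that has the same image.\<close>
      have "x' n \<in> C" for n
      proof -
        obtain z where z: "z \<in> C" "boundary_map (x' n) = boundary_map z" using a x'(2) by blast
        have "x' n \<in> boundary_points Y q"
          using x'(1) by (auto simp: stratum_converges_def boundary_stratum_def)
        then show ?thesis using inj_onD[OF inj_on_boundary_map z(2)] z(1) Cs by blast
      qed
      then have "y' \<in> C" using C[OF N' _ x'(1)] by blast
      then show "y \<in> boundary_map ` C" using x'(3) by blast
    qed
  qed
  show "inj_on boundary_map (topspace (morse_boundary Y q))"
    using inj_on_boundary_map by (simp add: topspace_morse_boundary)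
qed

end

section \<open>Word length\<close>

text \<open>Inverse letters are expressed by \<open>u = v \<otimes> s\<close>, as in
  \<open>cayley_adj\<close>. The inverse operation depends on the carrier but the product does not,
  so balls of a subgroup record compare directly with balls of \<open>G\<close>.\<close>

primrec word_ball :: "('a, 'b) monoid_scheme \<Rightarrow> 'a set \<Rightarrow> nat \<Rightarrow> 'a set" where
  "word_ball G S 0 = {\<one>\<^bsub>G\<^esub>}"
| "word_ball G S (Suc n) = word_ball G S n \<union>
     {v \<in> carrier G. \<exists>u\<in>word_ball G S n. \<exists>s\<in>S. v = u \<otimes>\<^bsub>G\<^esub> s \<or> u = v \<otimes>\<^bsub>G\<^esub> s}"

definition word_length :: "('a, 'b) monoid_scheme \<Rightarrow> 'a set \<Rightarrow> 'a \<Rightarrow> nat" where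
  "word_length G S g = (LEAST n. g \<in> word_ball G S n)"

text \<open>The closed range of \<open>a\<close> lets \<open>t = n\<close> count as the end of the
  last edge, so \<open>i\<close> always indexes an existing edge.\<close>

lemma real_split:
  fixes t :: real
  assumes "0 \<le> t" "t \<le> real n" "n > 0"
  obtains i a where "t = real i + a" "0 \<le> a" "a \<le> 1" "i < n"
proof (cases "t = real n")
  case True
  then show ?thesis using that[of "n - 1" 1] assms by (simp add: of_nat_diff)
next
  case False
  have "nat \<lfloor>t\<rfloor> < n" using assms False by linarith
  moreover have "0 \<le> t - real (nat \<lfloor>t\<rfloor>)" "t - real (nat \<lfloor>t\<rfloor>) \<le> 1" using assms by linarith+
  ultimately show ?thesis using that[of "nat \<lfloor>t\<rfloor>" "t - real (nat \<lfloor>t\<rfloor>)"] by simp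
qed

text \<open>Pigeonhole makes one coordinate constant along a subsequence; diagonalising makes every
  coordinate eventually constant.\<close>

lemma diagonal_subsequence_finite:
  fixes v :: "nat \<Rightarrow> nat \<Rightarrow> 'a"
  assumes F: "\<And>i. finite (F i)" and v: "\<And>n i. v n i \<in> F i"
  shows "\<exists>r w. strict_mono (r :: nat \<Rightarrow> nat) \<and> (\<forall>i. \<forall>\<^sub>F n in sequentially. v (r n) i = w i)"
proof -
  have ex: "\<exists>q. strict_mono (q :: nat \<Rightarrow> nat) \<and> (\<exists>w. \<forall>n. v ((s \<circ> q) n) i = w)" for i and s :: "nat \<Rightarrow> nat"
  proof -
    have "finite ((\<lambda>n. v (s n) i) ` UNIV)" by (rule finite_subset[OF _ F[of i]]) (use v in auto)
    from pigeonhole_infinite[OF infinite_UNIV_nat this]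
    obtain m where "infinite {n. v (s n) i = v (s m) i}" by auto
    from infinite_enumerate[OF this] obtain q :: "nat \<Rightarrow> nat" where
      "strict_mono q" "\<forall>n. q n \<in> {n. v (s n) i = v (s m) i}" by blast
    then show ?thesis by auto
  qed
  interpret subseqs "\<lambda>i s. \<exists>w. \<forall>n. v (s n) i = w"
    by unfold_locales (rule ex)
  have "\<exists>w. \<forall>\<^sub>F n in sequentially. v (diagseq n) i = w" for i
  proof -
    \<comment> \<open>The diagonal sequence runs inside the subsequence chosen for coordinate
      \<open>i\<close> only from index \<open>Suc i\<close> on.\<close>
    obtain w where w: "\<And>n. v (diagseq (Suc i + n)) i = w"
      using diagseq_holds[of i] by auto
    have "v (diagseq n) i = w" if "n \<ge> Suc i" for n using w[of "n - Suc i"] that by simp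
    then show ?thesis by (intro exI[of _ w] eventually_sequentiallyI[of "Suc i"])
  qed
  then have "\<exists>w. \<forall>i. \<forall>\<^sub>F n in sequentially. v (diagseq n) i = w i" by (intro choice allI)
  then show ?thesis using subseq_diagseq by blast
qed

locale cayley = group G for G (structure) +
  fixes S assumes fgs: "finite_generating_set G S"
begin

lemma S: "finite S" "S \<subseteq> carrier G" "generate G S = carrier G"
  using fgs by (auto simp: finite_generating_set_def)

abbreviation "wball \<equiv> word_ball G S"
abbreviation "len \<equiv> word_length G S"

lemma ball_carrier: "wball n \<subseteq> carrier G"
  by (induction n) auto

lemma finite_ball: "finite (wball n)"
proof (induction n)
  case (Suc n)
  have "wball (Suc n) \<subseteq> wball n \<union> (\<Union>u\<in>wball n. \<Union>s\<in>S. {u \<otimes> s, u \<otimes> inv s})"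
  proof
    fix v assume "v \<in> wball (Suc n)"
    then consider "v \<in> wball n" | u s where "v \<in> carrier G" "u \<in> wball n" "s \<in> S" "v = u \<otimes> s \<or> u = v \<otimes> s" by auto
    then show "v \<in> wball n \<union> (\<Union>u\<in>wball n. \<Union>s\<in>S. {u \<otimes> s, u \<otimes> inv s})"
    proof cases
      case 2
      then have "v = u \<otimes> s \<or> v = u \<otimes> inv s"
        using S(2) ball_carrier[of n] by (metis inv_solve_right subsetD)
      then show ?thesis using 2 by blast
    qed simp
  qed
  then show ?case by (rule finite_subset) (use Suc S(1) in auto)
qed simp

lemma ball_mono: "m \<le> n \<Longrightarrow> wball m \<subseteq> wball n"
  by (rule lift_Suc_mono_le[of wball]) auto

lemma ball_mult: "g \<in> wball m \<Longrightarrow> h \<in> wball n \<Longrightarrow> g \<otimes> h \<in> wball (m + n)"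
proof (induction n arbitrary: h)
  case 0
  then show ?case using ball_carrier[of m] by auto
next
  case (Suc n)
  then have g: "g \<in> carrier G" using ball_carrier by auto
  from Suc.prems(2) consider "h \<in> wball n" | u s where "h \<in> carrier G" "u \<in> wball n" "s \<in> S" "h = u \<otimes> s \<or> u = h \<otimes> s" by auto
  then show ?case
  proof cases
    case 1
    then show ?thesis using Suc.IH[OF Suc.prems(1)] by simp
  next
    case 2
    have c: "u \<in> carrier G" "s \<in> carrier G" using 2 ball_carrier S(2) by auto
    have "g \<otimes> h = g \<otimes> u \<otimes> s \<or> g \<otimes> u = g \<otimes> h \<otimes> s" using 2 c g by (auto simp: m_assoc)
    moreover have "g \<otimes> u \<in> wball (m + n)" using Suc.IH[OF Suc.prems(1) 2(2)] .
    ultimately show ?thesis using 2 g by auto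
  qed
qed

lemma generator_ball: "s \<in> S \<Longrightarrow> s \<in> wball 1" "s \<in> S \<Longrightarrow> inv s \<in> wball 1"
proof -
  assume s: "s \<in> S"
  then have c: "s \<in> carrier G" using S(2) by auto
  have "s = \<one> \<otimes> s" "\<one> = inv s \<otimes> s" using c by auto
  then show "s \<in> wball 1" "inv s \<in> wball 1"
    unfolding One_nat_def word_ball.simps using s c inv_closed[OF c] by blast+
qed

lemma ball_inv: "g \<in> wball n \<Longrightarrow> inv g \<in> wball n"
proof (induction n arbitrary: g)
  case (Suc n)
  from Suc.prems consider "g \<in> wball n" | u s where "g \<in> carrier G" "u \<in> wball n" "s \<in> S" "g = u \<otimes> s \<or> u = g \<otimes> s" by auto
  then show ?case
  proof cases
    case 1
    then show ?thesis using Suc.IH by auto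
  next
    case 2
    have c: "u \<in> carrier G" "s \<in> carrier G" using 2 ball_carrier S(2) by auto
    have "inv g = inv s \<otimes> inv u \<or> inv g = s \<otimes> inv u"
      using 2 c by (metis inv_closed inv_inv inv_mult_group inv_solve_right)
    then have "inv g \<in> wball (1 + n)" using ball_mult generator_ball[OF 2(3)] Suc.IH[OF 2(2)] by metis
    then show ?thesis by simp
  qed
qed simp

lemma ex_ball: "g \<in> carrier G \<Longrightarrow> \<exists>n. g \<in> wball n"
proof -
  assume "g \<in> carrier G"
  then have "g \<in> generate G S" using S by simp
  then show ?thesis
  proof (induction rule: generate.induct)
    case one
    have "\<one> \<in> wball 0" by simp
    then show ?case ..
  qed (use generator_ball ball_mult in blast)+
qed

section \<open>Word length and the word metric\<close>

lemma len_le_iff: "g \<in> carrier G \<Longrightarrow> len g \<le> n \<longleftrightarrow> g \<in> wball n"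
  unfolding word_length_def
  by (metis (mono_tags, lifting) LeastI_ex Least_le ball_mono ex_ball subsetD)

lemma len_ball: "g \<in> carrier G \<Longrightarrow> g \<in> wball (len g)"
  using len_le_iff[of g "len g"] by simp

lemma len_one [simp]: "len \<one> = 0"
  using len_le_iff[of \<one> 0] by simp

lemma len_0: "g \<in> carrier G \<Longrightarrow> len g = 0 \<longleftrightarrow> g = \<one>"
  using len_le_iff[of g 0] by auto

lemma len_mult: "g \<in> carrier G \<Longrightarrow> h \<in> carrier G \<Longrightarrow> len (g \<otimes> h) \<le> len g + len h"
  using ball_mult len_ball len_le_iff by simp

lemma len_inv [simp]: "g \<in> carrier G \<Longrightarrow> len (inv g) = len g"
  by (metis antisym ball_inv inv_closed inv_inv len_ball len_le_iff)

lemma cayley_adj_sym: "cayley_adj G S u v \<Longrightarrow> cayley_adj G S v u"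
  unfolding cayley_adj_def by blast

lemma cayley_adj_carrier: "cayley_adj G S u v \<Longrightarrow> u \<in> carrier G \<and> v \<in> carrier G \<and> u \<noteq> v"
  unfolding cayley_adj_def by blast

lemma cayley_adj_translate:
  assumes g: "g \<in> carrier G" and uv: "cayley_adj G S u v"
  shows "cayley_adj G S (g \<otimes> u) (g \<otimes> v)"
proof -
  obtain s where c: "u \<in> carrier G" "v \<in> carrier G" "u \<noteq> v" and s: "s \<in> S" "v = u \<otimes> s \<or> u = v \<otimes> s"
    using uv by (auto simp: cayley_adj_def)
  have "s \<in> carrier G" using s S by auto
  then have "g \<otimes> v = g \<otimes> u \<otimes> s \<or> g \<otimes> u = g \<otimes> v \<otimes> s" using s c g by (auto simp: m_assoc)
  moreover have "g \<otimes> u \<noteq> g \<otimes> v" using c g by simp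
  ultimately show ?thesis using c g s(1) unfolding cayley_adj_def by auto
qed

lemma len_step:
  assumes "cayley_adj G S u v"
  shows "len (inv u \<otimes> v) \<le> 1"
proof -
  obtain s where c: "u \<in> carrier G" "v \<in> carrier G" "u \<noteq> v" and s: "s \<in> S" "v = u \<otimes> s \<or> u = v \<otimes> s"
    using assms by (auto simp: cayley_adj_def)
  have sc: "s \<in> carrier G" using s S by auto
  have "inv u \<otimes> v = s \<or> inv u \<otimes> v = inv s"
    using s(2)
  proof
    assume "u = v \<otimes> s"
    then have "inv u \<otimes> v = inv s \<otimes> (inv v \<otimes> v)" using c sc by (simp add: inv_mult_group m_assoc)
    then show ?thesis using c sc by simp
  qed (use c sc in \<open>simp add: m_assoc[symmetric]\<close>)
  then have "inv u \<otimes> v \<in> wball 1" using generator_ball[OF s(1)] by metis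
  then show ?thesis using len_le_iff[of "inv u \<otimes> v" 1] c by (simp del: word_ball.simps)
qed

lemma len_diff_triangle:
  assumes "u \<in> carrier G" "v \<in> carrier G" "w \<in> carrier G"
  shows "len (inv u \<otimes> w) \<le> len (inv u \<otimes> v) + len (inv v \<otimes> w)"
proof -
  have "v \<otimes> (inv v \<otimes> w) = w" using assms by (simp add: m_assoc[symmetric])
  then have "inv u \<otimes> w = (inv u \<otimes> v) \<otimes> (inv v \<otimes> w)" using assms by (simp add: m_assoc)
  then show ?thesis using len_mult[of "inv u \<otimes> v" "inv v \<otimes> w"] assms by simp
qed

lemma len_diff_sym:
  assumes "u \<in> carrier G" "v \<in> carrier G"
  shows "len (inv u \<otimes> v) = len (inv v \<otimes> u)"
proof -
  have "inv v \<otimes> u = inv (inv u \<otimes> v)" using assms by (simp add: inv_mult_group)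
  then show ?thesis using assms by simp
qed

lemma len_diff_0:
  assumes "u \<in> carrier G" "v \<in> carrier G"
  shows "len (inv u \<otimes> v) = 0 \<longleftrightarrow> u = v"
proof -
  have "inv u \<otimes> v = \<one> \<longleftrightarrow> v = u"
    using assms inv_solve_left'[of \<one> u v] by simp
  then show ?thesis using len_0[of "inv u \<otimes> v"] assms by auto
qed

text \<open>Undoing the last step of a shortest word leaves length at most \<open>n\<close>, and one
  edge changes the length by at most \<open>1\<close>, so it is exactly \<open>n\<close>.\<close>

lemma len_Suc_adj:
  assumes g: "g \<in> carrier G" "len g = Suc n"
  shows "\<exists>h\<in>carrier G. len h = n \<and> cayley_adj G S h g"
proof -
  have "g \<in> wball (Suc n)" "g \<notin> wball n" using len_le_iff[OF g(1)] g(2)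
    by (simp_all del: word_ball.simps flip: len_le_iff[OF g(1)])
  then obtain u s where u: "u \<in> wball n" "s \<in> S" "g = u \<otimes> s \<or> u = g \<otimes> s" by auto
  have uc: "u \<in> carrier G" using u ball_carrier by auto
  have "u \<noteq> g" using u(1) \<open>g \<notin> wball n\<close> by auto
  then have adj: "cayley_adj G S u g" using u uc g(1) by (auto simp: cayley_adj_def)
  have "len u \<le> n" using u(1) len_le_iff[OF uc] by simp
  moreover have "len g \<le> len u + 1"
    using len_diff_triangle[of \<one> u g] len_step[OF adj] uc g(1) by simp
  ultimately show ?thesis using g(2) uc adj by auto
qed

lemma geodesic_word:
  assumes "g \<in> carrier G"
  shows "\<exists>v. v 0 = \<one> \<and> v (len g) = g \<and> (\<forall>i<len g. cayley_adj G S (v i) (v (Suc i)))"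
proof -
  have "\<exists>v. v 0 = \<one> \<and> v n = g \<and> (\<forall>i<n. cayley_adj G S (v i) (v (Suc i)))"
    if "g \<in> carrier G" "len g = n" for g n
    using that
  proof (induction n arbitrary: g)
    case 0
    then show ?case using len_0 by auto
  next
    case (Suc n)
    obtain h where h: "h \<in> carrier G" "len h = n" "cayley_adj G S h g" using len_Suc_adj[OF Suc.prems] by blast
    obtain v where v: "v 0 = \<one>" "v n = h" "\<forall>i<n. cayley_adj G S (v i) (v (Suc i))" using Suc.IH[OF h(1,2)] by blast
    then show ?case
      using h(3) by (intro exI[of _ "v(Suc n := g)"]) (auto simp: less_Suc_eq)
  qed
  then show ?thesis using assms by blast
qed

section \<open>The geometry of Cayley graphs\<close>

abbreviation "X \<equiv> cayley_graph G S"

lemma mspace_X: "mspace X = cayley_points G S" and mdist_X: "mdist X = cayley_dist G S"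
  using cayley_graph_simps[OF is_group fgs] by auto

lemma mdist_le: "cayley_path G S x l y \<Longrightarrow> mdist X x y \<le> l"
proof -
  assume p: "cayley_path G S x l y"
  have "bdd_below {l. cayley_path G S x l y}"
  proof (rule bdd_belowI[of _ 0])
    fix l assume "l \<in> {l. cayley_path G S x l y}"
    then show "0 \<le> l" using cayley_path_coordinate[of G S x l y undefined] by auto
  qed
  then have "Inf {l. cayley_path G S x l y} \<le> l" using p by (intro cInf_lower) auto
  then show ?thesis using cayley_path_points[OF p] by (simp add: mdist_X cayley_dist_def)
qed

lemma le_mdist:
  assumes "x \<in> mspace X" "y \<in> mspace X" "\<And>l. cayley_path G S x l y \<Longrightarrow> b \<le> l"
  shows "b \<le> mdist X x y"
proof -
  have "b \<le> Inf {l. cayley_path G S x l y}"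
    using cayley_path_exists[OF is_group fgs] assms by (intro cInf_greatest) (auto simp: mspace_X)
  then show ?thesis using assms by (simp add: mspace_X mdist_X cayley_dist_def)
qed

lemma vertex_mspace [simp]: "u \<in> carrier G \<Longrightarrow> vertex u \<in> mspace X"
  by (auto simp: mspace_X cayley_points_def)

lemma edge_point_mspace [simp]: "cayley_adj G S u v \<Longrightarrow> 0 \<le> a \<Longrightarrow> a \<le> 1 \<Longrightarrow> edge_point u v a \<in> mspace X"
  by (auto simp: mspace_X cayley_points_def)

lemma edge_point_swap: "edge_point u v a = edge_point v u (1 - a)"
  by (auto simp: edge_point_def)

lemma mspace_cases:
  assumes "x \<in> mspace X"
  obtains (vertex) u where "u \<in> carrier G" "x = vertex u"
  | (edge) u v a where "cayley_adj G S u v" "0 \<le> a" "a \<le> 1" "x = edge_point u v a"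
  using assms by (auto simp: mspace_X cayley_points_def)

text \<open>The distance from a vertex \<open>w\<close> to \<open>y\<close> is the minimum of \<open>len (inv w \<otimes> g) + 1 - y g\<close> over the support
  of the barycentric coordinates \<open>y\<close>; this minimum is \<open>1\<close>-Lipschitz along every edge.\<close>

lemma cayley_path_length:
  assumes "cayley_path G S x l y" "x = vertex w" "w \<in> carrier G"
  shows "\<exists>g\<in>carrier G. y g > 0 \<and> real (len (inv w \<otimes> g)) + 1 - y g \<le> l"
  using assms
proof (induction rule: cayley_path.induct)
  case (refl x)
  then show ?case by (intro bexI[of _ w]) (auto simp: vertex_def)
next
  case (step x l u v a b)
  have c: "u \<in> carrier G" "v \<in> carrier G" "u \<noteq> v" using cayley_adj_carrier[OF step.hyps(2)] by auto
  have e: "edge_point u v t u = 1 - t" "edge_point u v t v = t" "h \<noteq> u \<Longrightarrow> h \<noteq> v \<Longrightarrow> edge_point u v t h = 0" for t h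
    using c by (auto simp: edge_point_def vertex_def)
  have l1: "len (inv u \<otimes> v) \<le> 1" "len (inv v \<otimes> u) \<le> 1"
    using len_step[OF step.hyps(2)] len_diff_sym[OF c(1,2)] by auto
  have l2: "len (inv w \<otimes> v) \<le> len (inv w \<otimes> u) + 1" "len (inv w \<otimes> u) \<le> len (inv w \<otimes> v) + 1"
    using len_diff_triangle[OF step.prems(2) c(1,2)] len_diff_triangle[OF step.prems(2) c(2,1)] l1 by linarith+
  obtain g where g: "g \<in> carrier G" "edge_point u v a g > 0" "real (len (inv w \<otimes> g)) + 1 - edge_point u v a g \<le> l"
    using step.IH step.prems by blast
  then have "g = u \<or> g = v" using e(3)[of g a] by force
  \<comment> \<open>A witness at one end of the edge loses its positive coordinate exactly when
    \<open>b\<close> reaches the opposite end; that end then takes over, its word distance being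
    larger by at most \<open>1\<close>.\<close>
  then consider "real (len (inv w \<otimes> u)) + a \<le> l" "b < 1" | "real (len (inv w \<otimes> u)) + a \<le> l" "b = 1"
    | "real (len (inv w \<otimes> v)) + 1 - a \<le> l" "b > 0" | "real (len (inv w \<otimes> v)) + 1 - a \<le> l" "b = 0"
    using g(3) e step.hyps(3-) by fastforce
  then show ?case
  proof cases
    case 1
    then show ?thesis using c e(1,2) by (intro bexI[of _ u]) auto
  next
    case 2
    then show ?thesis using c e(1,2) l2 step.hyps(3-) by (intro bexI[of _ v]) auto
  next
    case 3
    then show ?thesis using c e(1,2) by (intro bexI[of _ v]) auto
  next
    case 4
    then show ?thesis using c e(1,2) l2 step.hyps(3-) by (intro bexI[of _ u]) auto
  qed
qed

lemma mdist_vertex_mult_le: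
  assumes "w \<in> carrier G" "g \<in> wball n"
  shows "mdist X (vertex w) (vertex (w \<otimes> g)) \<le> n"
  using assms(2)
proof (induction n arbitrary: g)
  case 0
  then show ?case using assms(1) by simp
next
  case (Suc n)
  from Suc.prems consider "g \<in> wball n" | u s where "g \<in> carrier G" "u \<in> wball n" "s \<in> S" "g = u \<otimes> s \<or> u = g \<otimes> s" by auto
  then show ?case
  proof cases
    case 1
    then show ?thesis using Suc.IH[of g] by simp
  next
    case 2
    have c: "u \<in> carrier G" using 2 ball_carrier by auto
    have "mdist X (vertex (w \<otimes> u)) (vertex (w \<otimes> g)) \<le> 1"
    proof (cases "u = g")
      case False
      then have "cayley_adj G S u g" using 2 c by (auto simp: cayley_adj_def)
      then have "cayley_adj G S (w \<otimes> u) (w \<otimes> g)" using cayley_adj_translate assms(1) by blast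
      then show ?thesis using mdist_le[OF cayley_path_edge[of G S _ _ 0 1]] by (simp add: edge_point_ends)
    qed (use assms(1) c in simp)
    moreover have "mdist X (vertex w) (vertex (w \<otimes> g)) \<le> mdist X (vertex w) (vertex (w \<otimes> u)) + mdist X (vertex (w \<otimes> u)) (vertex (w \<otimes> g))"
      using assms(1) c 2 by (intro mdist_triangle) auto
    ultimately show ?thesis using Suc.IH[OF 2(2)] by simp
  qed
qed

lemma mdist_vertex:
  assumes "w \<in> carrier G" "v \<in> carrier G"
  shows "mdist X (vertex w) (vertex v) = len (inv w \<otimes> v)"
proof (rule antisym)
  have "w \<otimes> (inv w \<otimes> v) = v" using assms by (simp add: m_assoc[symmetric])
  then show "mdist X (vertex w) (vertex v) \<le> len (inv w \<otimes> v)"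
    using mdist_vertex_mult_le[OF assms(1) len_ball[of "inv w \<otimes> v"]] assms by simp
  show "len (inv w \<otimes> v) \<le> mdist X (vertex w) (vertex v)"
  proof (rule le_mdist)
    fix l assume "cayley_path G S (vertex w) l (vertex v)"
    then obtain g where "vertex v g > 0" "real (len (inv w \<otimes> g)) + 1 - vertex v g \<le> l"
      using cayley_path_length assms(1) by blast
    then show "real (len (inv w \<otimes> v)) \<le> l" by (simp add: vertex_def split: if_splits)
  qed (use assms in auto)
qed

lemma mdist_edge_le:
  assumes "cayley_adj G S u v" "0 \<le> a" "a \<le> 1" "0 \<le> b" "b \<le> 1"
  shows "mdist X (edge_point u v a) (edge_point u v b) \<le> \<bar>a - b\<bar>"
  using mdist_le[OF cayley_path_edge[OF assms]] .

text \<open>The two terms are the routes through the two ends. No path is shorter, because the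
  witness of \<open>cayley_path_length\<close> lies in the support \<open>{u, v}\<close>.\<close>

lemma mdist_vertex_edge_point:
  assumes w: "w \<in> carrier G" and uv: "cayley_adj G S u v" "0 \<le> a" "a \<le> 1"
  shows "mdist X (vertex w) (edge_point u v a)
    = min (real (len (inv w \<otimes> u)) + a) (real (len (inv w \<otimes> v)) + (1 - a))"
proof (rule antisym)
  have c: "u \<in> carrier G" "v \<in> carrier G" "u \<noteq> v" using cayley_adj_carrier[OF uv(1)] by auto
  have "mdist X (vertex w) (edge_point u v a) \<le> mdist X (vertex w) (vertex u) + mdist X (vertex u) (edge_point u v a)"
    "mdist X (vertex w) (edge_point u v a) \<le> mdist X (vertex w) (vertex v) + mdist X (vertex v) (edge_point u v a)"
    using w uv c by (intro mdist_triangle; simp)+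
  moreover have "mdist X (vertex u) (edge_point u v a) \<le> a" "mdist X (vertex v) (edge_point u v a) \<le> 1 - a"
    using mdist_edge_le[OF uv(1), of 0 a] mdist_edge_le[OF uv(1), of 1 a] uv by (auto simp: edge_point_ends)
  ultimately show "mdist X (vertex w) (edge_point u v a) \<le> min (real (len (inv w \<otimes> u)) + a) (real (len (inv w \<otimes> v)) + (1 - a))"
    using mdist_vertex[OF w c(1)] mdist_vertex[OF w c(2)] by simp
  show "min (real (len (inv w \<otimes> u)) + a) (real (len (inv w \<otimes> v)) + (1 - a)) \<le> mdist X (vertex w) (edge_point u v a)"
  proof (rule le_mdist)
    fix l assume "cayley_path G S (vertex w) l (edge_point u v a)"
    then obtain g where g: "edge_point u v a g > 0" "real (len (inv w \<otimes> g)) + 1 - edge_point u v a g \<le> l"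
      using cayley_path_length w by blast
    then have "g = u \<or> g = v" by (auto simp: edge_point_def vertex_def split: if_splits)
    then show "min (real (len (inv w \<otimes> u)) + a) (real (len (inv w \<otimes> v)) + (1 - a)) \<le> l"
      using g c by (auto simp: edge_point_def vertex_def)
  qed (use w uv in auto)
qed

section \<open>Geodesics and the vertices they pass\<close>

lemma vertex_net:
  assumes "x \<in> mspace X"
  shows "\<exists>u\<in>carrier G. mdist X x (vertex u) \<le> 1"
  using assms
proof (cases rule: mspace_cases)
  case (vertex u)
  then show ?thesis by (intro bexI[of _ u]) auto
next
  case (edge u v a)
  then show ?thesis
    using mdist_edge_le[OF edge(1), of a 0] cayley_adj_carrier[OF edge(1)]
    by (intro bexI[of _ u]) (auto simp: edge_point_ends)
qed

text \<open>A term of the distance formula is at least \<open>1\<close> unless its end is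
  \<open>g\<close>; so a point at distance below \<open>1\<close> lies on an edge at
  \<open>g\<close>, and the distance is its coordinate there.\<close>

lemma edge_point_near_vertex:
  assumes g: "g \<in> carrier G" and uv: "cayley_adj G S u v" "0 \<le> b" "b \<le> 1"
    and d: "mdist X (vertex g) (edge_point u v b) < 1"
  shows "\<exists>v'. cayley_adj G S g v' \<and> edge_point u v b = edge_point g v' (mdist X (vertex g) (edge_point u v b))"
proof -
  have c: "u \<in> carrier G" "v \<in> carrier G" "u \<noteq> v" using cayley_adj_carrier[OF uv(1)] by auto
  note m = mdist_vertex_edge_point[OF g uv]
  consider "len (inv g \<otimes> u) = 0" "mdist X (vertex g) (edge_point u v b) = b"
    | "len (inv g \<otimes> v) = 0" "mdist X (vertex g) (edge_point u v b) = 1 - b"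
    using m d uv by (cases "len (inv g \<otimes> u) = 0"; cases "len (inv g \<otimes> v) = 0") (auto simp: min_def split: if_splits)
  then show ?thesis
  proof cases
    case 1
    then show ?thesis using len_diff_0[OF g c(1)] uv by auto
  next
    case 2
    then show ?thesis using len_diff_0[OF g c(2)] uv edge_point_swap[of u v b] cayley_adj_sym by (intro exI[of _ u]) auto
  qed
qed

text \<open>Takes an infinite sequence of vertices, so that it describes finite segments and the
  limit ray alike.\<close>

definition word_path :: "(nat \<Rightarrow> 'a) \<Rightarrow> real \<Rightarrow> 'a \<Rightarrow> real" where
  "word_path v t = edge_point (v (nat \<lfloor>t\<rfloor>)) (v (Suc (nat \<lfloor>t\<rfloor>))) (frac t)"

lemma word_path_nat [simp]: "word_path v (real i) = vertex (v i)"
  by (simp add: word_path_def frac_def edge_point_ends)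

text \<open>At \<open>a = 1\<close> the floor already selects the next edge; both descriptions agree
  at the common vertex.\<close>

lemma word_path_between:
  assumes "0 \<le> a" "a \<le> 1"
  shows "word_path v (real i + a) = edge_point (v i) (v (Suc i)) a"
proof (cases "a = 1")
  case True
  then have "real i + a = real (Suc i)" by simp
  then show ?thesis using True by (metis edge_point_ends(2) word_path_nat)
next
  case False
  then have "\<lfloor>real i + a\<rfloor> = int i" using assms by (simp add: floor_unique)
  then show ?thesis by (simp add: word_path_def frac_def)
qed

text \<open>The path is \<open>1\<close>-Lipschitz and its ends are at distance \<open>n\<close>,
  the full length of the parameter interval, so no inequality in between can be strict.\<close>

lemma word_path_geodesic_segment:
  assumes adj: "\<And>i. i < n \<Longrightarrow> cayley_adj G S (v i) (v (Suc i))" and v0: "v 0 \<in> carrier G"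
    and len: "len (inv (v 0) \<otimes> v n) = n"
  shows "geodesic_segment X (word_path v) n"
proof -
  have vc: "v i \<in> carrier G" if "i \<le> n" for i
    using that v0 cayley_adj_carrier[OF adj] by (cases i) auto
  have m: "word_path v t \<in> mspace X" if t: "0 \<le> t" "t \<le> real n" for t
  proof (cases "n = 0")
    case True
    then show ?thesis using t v0 word_path_nat[of v 0] by simp
  next
    case False
    then obtain i a where "t = real i + a" "0 \<le> a" "a \<le> 1" "i < n" using real_split t by blast
    then show ?thesis using adj by (simp add: word_path_between)
  qed
  have vertices: "mdist X (vertex (v i)) (vertex (v (i + k))) \<le> k" if "i + k \<le> n" for i k
    using that
  proof (induction k)
    case 0
    then show ?case using vc[of i] by simp
  next
    case (Suc k)
    have "mdist X (vertex (v i)) (vertex (v (i + Suc k))) \<le> mdist X (vertex (v i)) (vertex (v (i + k)))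
        + mdist X (vertex (v (i + k))) (vertex (v (i + Suc k)))"
      using Suc vc by (intro mdist_triangle) auto
    moreover have "mdist X (vertex (v (i + k))) (vertex (v (i + Suc k))) \<le> 1"
      using mdist_edge_le[OF adj[of "i + k"], of 0 1] Suc by (simp add: edge_point_ends)
    ultimately show ?case using Suc by simp
  qed
  have le: "mdist X (word_path v s) (word_path v t) \<le> t - s" if st: "0 \<le> s" "s \<le> t" "t \<le> real n" for s t
  proof (cases "n = 0")
    case True
    then have "s = 0" "t = 0" using st by auto
    then show ?thesis using m[of 0] by simp
  next
    case False
    obtain i a where i: "s = real i + a" "0 \<le> a" "a \<le> 1" "i < n" using real_split[of s n] st False by auto
    obtain j b where j: "t = real j + b" "0 \<le> b" "b \<le> 1" "j < n" using real_split[of t n] st False by auto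
    show ?thesis
    proof (cases "j \<le> i")
      case True
      show ?thesis
      proof (cases "i = j")
        case True
        then show ?thesis using mdist_edge_le[OF adj[OF i(4)] i(2,3) j(2,3)] i j st
          by (simp add: word_path_between)
      next
        case False
        \<comment> \<open>With \<open>s \<le> t\<close> this happens only when \<open>s\<close> and
          \<open>t\<close> are the same integer, written once as the start of an edge and once as
          the end of the preceding one.\<close>
        then have "real j + 1 \<le> real i" using \<open>j \<le> i\<close> by simp
        then have "s = t" using i j st by linarith
        then show ?thesis using m st by simp
      qed
    next
      case False
      then have ij: "Suc i \<le> j" by simp
      have "mdist X (word_path v s) (word_path v t) \<le> mdist X (word_path v s) (vertex (v (Suc i)))
          + mdist X (vertex (v (Suc i))) (vertex (v j)) + mdist X (vertex (v j)) (word_path v t)"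
        using m st vc i j by (intro mdist_triangle4) auto
      moreover have "mdist X (word_path v s) (vertex (v (Suc i))) \<le> 1 - a"
        using mdist_edge_le[OF adj[OF i(4)] i(2,3), of 1] i by (simp add: word_path_between edge_point_ends)
      moreover have "mdist X (vertex (v j)) (word_path v t) \<le> b"
        using mdist_edge_le[OF adj[OF j(4)] _ _ j(2,3), of 0] j by (simp add: word_path_between edge_point_ends)
      moreover have "mdist X (vertex (v (Suc i))) (vertex (v j)) \<le> real (j - Suc i)"
        using vertices[of "Suc i" "j - Suc i"] ij j by simp
      ultimately show ?thesis using i j ij by (simp add: of_nat_diff)
    qed
  qed
  have eq: "mdist X (word_path v s) (word_path v t) = t - s" if st: "0 \<le> s" "s \<le> t" "t \<le> real n" for s t
  proof (rule antisym[OF le[OF st]])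
    have "real n = mdist X (word_path v 0) (word_path v (real n))"
      using word_path_nat[of v 0] mdist_vertex[of "v 0" "v n"] vc len by simp
    also have "\<dots> \<le> mdist X (word_path v 0) (word_path v s) + mdist X (word_path v s) (word_path v t)
        + mdist X (word_path v t) (word_path v (real n))"
      by (rule mdist_triangle4) (use m[of 0] m[of s] m[of t] m[of "real n"] st in \<open>simp_all del: word_path_nat\<close>)
    finally show "t - s \<le> mdist X (word_path v s) (word_path v t)"
      using le[of 0 s] le[of t "real n"] st by linarith
  qed
  show ?thesis
    unfolding geodesic_segment_def
  proof (intro conjI ballI)
    fix s t assume "s \<in> {0..real n}" "t \<in> {0..real n}"
    then show "mdist X (word_path v s) (word_path v t) = \<bar>s - t\<bar>"
      using eq[of s t] eq[of t s] by (cases "s \<le> t") (auto simp: mdist_commute)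
  qed (use m in auto)
qed

lemma vertex_geodesic:
  assumes "u \<in> carrier G" "w \<in> carrier G"
  shows "\<exists>\<gamma>. geodesic_segment X \<gamma> (mdist X (vertex u) (vertex w)) \<and> \<gamma> 0 = vertex u \<and>
    \<gamma> (mdist X (vertex u) (vertex w)) = vertex w \<and>
    (\<forall>i\<le>len (inv u \<otimes> w). \<exists>g\<in>carrier G. \<gamma> (real i) = vertex g)"
proof -
  let ?n = "len (inv u \<otimes> w)"
  obtain v where v: "v 0 = \<one>" "v ?n = inv u \<otimes> w" "\<forall>i<?n. cayley_adj G S (v i) (v (Suc i))"
    using geodesic_word[of "inv u \<otimes> w"] assms by auto
  define v' where "v' i = u \<otimes> v i" for i
  have adj: "cayley_adj G S (v' i) (v' (Suc i))" if "i < ?n" for i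
    using v(3) that cayley_adj_translate[OF assms(1)] by (simp add: v'_def)
  have e: "v' 0 = u" "v' ?n = w" using v assms by (simp_all add: v'_def m_assoc[symmetric])
  have "geodesic_segment X (word_path v') ?n"
    by (rule word_path_geodesic_segment) (use adj e assms in auto)
  moreover have "word_path v' 0 = vertex u" "word_path v' (real ?n) = vertex w"
    using word_path_nat[of v' 0] e by simp_all
  moreover have "v' i \<in> carrier G" if "i \<le> ?n" for i
    using that e assms cayley_adj_carrier[OF adj] by (cases i) auto
  ultimately show ?thesis
    unfolding mdist_vertex[OF assms] by (intro exI[of _ "word_path v'"]) auto
qed

text \<open>The distance from the identity is the integer \<open>i\<close>; the distance formula
  then makes the edge coordinate an integer, so the point is an end of its edge.\<close>

lemma geodesic_vertex:
  assumes \<gamma>: "geodesic_segment X \<gamma> l" "\<gamma> 0 = vertex \<one>" and i: "real i \<le> l"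
  shows "\<exists>g\<in>carrier G. len g = i \<and> \<gamma> (real i) = vertex g"
proof -
  note g = geodesic_segmentD[OF \<gamma>(1)]
  have m: "\<gamma> (real i) \<in> mspace X" using g(2) i by simp
  have d: "mdist X (vertex \<one>) (\<gamma> (real i)) = real i" using g(3)[of 0 "real i"] g(1) \<gamma>(2) i by simp
  have "\<exists>g\<in>carrier G. \<gamma> (real i) = vertex g"
    using m
  proof (cases rule: mspace_cases)
    case (edge u v a)
    have "min (real (len (inv \<one> \<otimes> u)) + a) (real (len (inv \<one> \<otimes> v)) + (1 - a)) = real i"
      using mdist_vertex_edge_point[OF one_closed edge(1-3)] d edge(4) by simp
    then have "a = real_of_int (int i - int (len (inv \<one> \<otimes> u))) \<or> a = real_of_int (int (len (inv \<one> \<otimes> v)) + 1 - int i)"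
      by (auto simp: min_def split: if_splits)
    then obtain z :: int where z: "a = real_of_int z" by blast
    then have "z = 0 \<or> z = 1" using edge(2,3) by auto
    then show ?thesis using z edge(4) cayley_adj_carrier[OF edge(1)] by (auto simp: edge_point_ends)
  qed auto
  then obtain g where "g \<in> carrier G" "\<gamma> (real i) = vertex g" by blast
  then show ?thesis using d mdist_vertex[of \<one> g] by auto
qed

text \<open>Shows that a geodesic from the identity is determined by its vertices: distance
  \<open>a\<close> from \<open>g\<close> puts the point on an edge at \<open>g\<close>, and distance
  \<open>1 - a\<close> from \<open>h\<close> makes \<open>h\<close> the other end.\<close>

lemma geodesic_between:
  assumes \<gamma>: "geodesic_segment X \<gamma> l" "\<gamma> 0 = vertex \<one>" and i: "real i + 1 \<le> l"
    and g: "g \<in> carrier G" "\<gamma> (real i) = vertex g" and h: "h \<in> carrier G" "\<gamma> (real (Suc i)) = vertex h"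
    and a: "0 \<le> a" "a \<le> 1"
  shows "\<gamma> (real i + a) = edge_point g h a"
proof -
  note s = geodesic_segmentD[OF \<gamma>(1)]
  consider "a = 0" | "a = 1" | "0 < a" "a < 1" using a by linarith
  then show ?thesis
  proof cases
    case 1
    then show ?thesis using g by (simp add: edge_point_ends)
  next
    case 2
    then show ?thesis using h by (simp add: edge_point_ends add.commute)
  next
    case 3
    define y where "y = \<gamma> (real i + a)"
    have m: "y \<in> mspace X" using s(2) i a by (simp add: y_def)
    have d: "mdist X (vertex \<one>) y = real i + a" "mdist X (vertex g) y = a" "mdist X (vertex h) y = 1 - a"
      "mdist X (vertex h) (vertex g) = 1"
      using s(3)[of 0 "real i + a"] s(3)[of "real i" "real i + a"] s(3)[of "real (Suc i)" "real i + a"]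
        s(3)[of "real (Suc i)" "real i"] s(1) \<gamma>(2) g h i a 3 by (auto simp: y_def)
    obtain u v b where uv: "cayley_adj G S u v" "0 \<le> b" "b \<le> 1" "y = edge_point u v b"
      using m
    proof (cases rule: mspace_cases)
      case (vertex k)
      then have "real (len (inv \<one> \<otimes> k)) = real i + a" using d(1) mdist_vertex[of \<one> k] by simp
      then have "real_of_int (int (len (inv \<one> \<otimes> k)) - int i) = a" by simp
      then have "0 < int (len (inv \<one> \<otimes> k)) - int i" "int (len (inv \<one> \<otimes> k)) - int i < 1"
        using 3 by linarith+
      then show ?thesis by linarith
    qed (use that in blast)
    obtain v' where v': "cayley_adj G S g v'" "y = edge_point g v' a"
      using edge_point_near_vertex[OF g(1) uv(1-3)] d(2) uv(4) 3 by auto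
    have v'c: "v' \<in> carrier G" using cayley_adj_carrier[OF v'(1)] by simp
    \<comment> \<open>The first term is \<open>1 + a\<close>, too large as \<open>a > 0\<close>, so
      the minimum is the second term and \<open>v'\<close> is at distance \<open>0\<close> from
      \<open>h\<close>.\<close>
    have "1 - a = min (real (len (inv h \<otimes> g)) + a) (real (len (inv h \<otimes> v')) + (1 - a))"
      using mdist_vertex_edge_point[OF h(1) v'(1) a] d(3) v'(2) by simp
    moreover have "real (len (inv h \<otimes> g)) = 1" using d(4) mdist_vertex[OF h(1) g(1)] by simp
    ultimately have "len (inv h \<otimes> v') = 0" using 3 by (auto simp: min_def split: if_splits)
    then have "v' = h" using len_diff_0[OF h(1) v'c] by simp
    then show ?thesis using v'(2) by (simp add: y_def)
  qed
qed

text \<open>The \<open>i\<close>-th vertex ranges over the finite ball of radius \<open>i\<close>.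
  Once the vertices up to \<open>k + 1\<close> are constant along a subsequence, the segments
  coincide with the limit on \<open>{0..k + 1}\<close>, which is stronger than uniform
  convergence.\<close>

lemma cayley_arzela_ascoli:
  assumes \<gamma>: "\<And>n. geodesic_segment X (\<gamma> n) (l n) \<and> \<gamma> n 0 = vertex \<one>"
    and l: "filterlim l at_top sequentially"
  shows "\<exists>r \<beta>. strict_mono (r :: nat \<Rightarrow> nat) \<and> geodesic_ray X (vertex \<one>) \<beta> \<and>
      converges_on_compacta X (\<lambda>n. \<gamma> (r n)) \<beta>"
proof -
  define P where "P n i g \<longleftrightarrow> g \<in> wball i \<and> (real i \<le> l n \<longrightarrow> len g = i \<and> \<gamma> n (real i) = vertex g)" for n i g
  have ex: "\<exists>g. P n i g" for n i
  proof (cases "real i \<le> l n")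
    case True
    then show ?thesis
      unfolding P_def using geodesic_vertex[of "\<gamma> n" "l n" i] \<gamma>[of n] len_ball by blast
  next
    case False
    then show ?thesis unfolding P_def using ball_mono[of 0 i] by auto
  qed
  define v where "v n i = (SOME g. P n i g)" for n i
  have "P n i (v n i)" for n i unfolding v_def by (rule someI_ex[OF ex])
  then have v: "v n i \<in> wball i" "real i \<le> l n \<Longrightarrow> len (v n i) = i \<and> \<gamma> n (real i) = vertex (v n i)" for n i
    unfolding P_def by blast+
  have vc: "v n i \<in> carrier G" for n i using v(1) ball_carrier by blast
  obtain r w where r: "strict_mono (r :: nat \<Rightarrow> nat)" and w: "\<And>i. \<forall>\<^sub>F n in sequentially. v (r n) i = w i"
    using diagonal_subsequence_finite[of wball v, OF finite_ball v(1)] by blast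
  have "filterlim (\<lambda>n. l (r n)) at_top sequentially"
    by (rule filterlim_compose[OF l filterlim_subseq[OF r]])
  then have lr: "\<forall>\<^sub>F n in sequentially. Z \<le> l (r n)" for Z by (simp add: filterlim_at_top)
  have agree: "\<forall>\<^sub>F n in sequentially. real k + 1 \<le> l (r n) \<and> (\<forall>i\<in>{..Suc k}. v (r n) i = w i)" for k
    using lr[of "real k + 1"] eventually_ball_finite[of "{..Suc k}" "\<lambda>n i. v (r n) i = w i"] w
    by (auto intro: eventually_conj)
  have path: "\<gamma> (r n) t = word_path w t"
    if n: "real k + 1 \<le> l (r n)" "\<forall>i\<in>{..Suc k}. v (r n) i = w i" and t: "0 \<le> t" "t \<le> real k + 1" for n k t
  proof -
    obtain i a where i: "t = real i + a" "0 \<le> a" "a \<le> 1" "i < Suc k" using real_split[of t "Suc k"] t by auto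
    have e: "\<gamma> (r n) (real i) = vertex (w i)" "\<gamma> (r n) (real (Suc i)) = vertex (w (Suc i))"
      using v(2)[of i "r n"] v(2)[of "Suc i" "r n"] n i(4) by auto
    have "w i \<in> carrier G" "w (Suc i) \<in> carrier G"
      using n(2) i(4) vc by (metis Suc_le_eq Suc_le_mono atMost_iff less_Suc_eq_le less_imp_le)+
    then show ?thesis
      using geodesic_between[of "\<gamma> (r n)" "l (r n)" i "w i" "w (Suc i)" a] \<gamma> n i e
      by (simp add: word_path_between)
  qed
  have "geodesic_ray X (vertex \<one>) (word_path w)"
    unfolding geodesic_ray_def
  proof (intro conjI allI impI image_subsetI)
    have ex: "\<exists>n. real k + 1 \<le> l (r n) \<and> (\<forall>i\<in>{..Suc k}. v (r n) i = w i)" for k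
      using eventually_happens'[OF sequentially_bot agree[of k]] by blast
    have *: "word_path w s \<in> mspace X \<and> mdist X (word_path w s) (word_path w t) = \<bar>s - t\<bar>"
      if "s \<ge> 0" "t \<ge> 0" for s t
    proof -
      define k where "k = nat \<lceil>max s t\<rceil>"
      have k: "s \<le> real k" "t \<le> real k" unfolding k_def by linarith+
      obtain n where n: "real k + 1 \<le> l (r n)" "\<forall>i\<in>{..Suc k}. v (r n) i = w i" using ex by blast
      note g = geodesic_segmentD[OF conjunct1[OF \<gamma>[of "r n"]]]
      show ?thesis using g(2)[of s] g(3)[of s t] path[OF n, of s] path[OF n, of t] k n(1) that by auto
    qed
    show "word_path w s \<in> mspace X" if "s \<in> {0..}" for s using *[of s s] that by simp
    show "mdist X (word_path w s) (word_path w t) = \<bar>s - t\<bar>" if "0 \<le> s" "0 \<le> t" for s t using * that by blast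
    obtain n where "v (r n) 0 = w 0" using eventually_happens'[OF sequentially_bot w] by blast
    then have "w 0 = \<one>" using v(1)[of "r n" 0] by simp
    then show "word_path w 0 = vertex \<one>" using word_path_nat[of w 0] by simp
  qed
  moreover have "converges_on_compacta X (\<lambda>n. \<gamma> (r n)) (word_path w)"
    unfolding converges_on_compacta_def
  proof (intro allI impI)
    fix C :: "real set" and e :: real assume C: "compact C \<and> C \<subseteq> {0..}" and e: "e > 0"
    obtain b where b: "\<And>t. t \<in> C \<Longrightarrow> \<bar>t\<bar> \<le> b"
      using compact_imp_bounded[of C] C by (auto simp: bounded_iff)
    obtain k :: nat where k: "b \<le> real k" using real_arch_simple by blast
    show "\<forall>\<^sub>F n in sequentially. \<forall>t\<in>C. mdist X (\<gamma> (r n) t) (word_path w t) < e"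
      using agree[of k]
    proof (rule eventually_mono)
      fix n assume n: "real k + 1 \<le> l (r n) \<and> (\<forall>i\<in>{..Suc k}. v (r n) i = w i)"
      show "\<forall>t\<in>C. mdist X (\<gamma> (r n) t) (word_path w t) < e"
      proof
        fix t assume "t \<in> C"
        then have t: "0 \<le> t" "t \<le> real k" using b[of t] k C by auto
        have "\<gamma> (r n) t \<in> mspace X"
          using geodesic_segmentD(2)[OF conjunct1[OF \<gamma>[of "r n"]], of t] t n by simp
        then show "mdist X (\<gamma> (r n) t) (word_path w t) < e" using path[of k n t] n t e by simp
      qed
    qed
  qed
  ultimately show ?thesis using r by blast
qed

lemma cayley_ray_space: "ray_space X (vertex ` carrier G) (vertex \<one>)"
proof
  show "\<exists>v\<in>vertex ` carrier G. mdist X x v \<le> 1" if "x \<in> mspace X" for x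
    using vertex_net[OF that] by blast
  show "\<exists>\<gamma>. geodesic_segment X \<gamma> (mdist X u v) \<and> \<gamma> 0 = u \<and> \<gamma> (mdist X u v) = v"
    if "u \<in> vertex ` carrier G" "v \<in> vertex ` carrier G" for u v
    using that vertex_geodesic by blast
  show "\<exists>r \<beta>. strict_mono (r :: nat \<Rightarrow> nat) \<and> geodesic_ray X (vertex \<one>) \<beta> \<and>
      converges_on_compacta X (\<lambda>n. \<gamma> (r n)) \<beta>"
    if "\<And>n. geodesic_segment X (\<gamma> n) (l n) \<and> \<gamma> n 0 = vertex \<one>" "filterlim l at_top sequentially" for \<gamma> l
    using that by (rule cayley_arzela_ascoli)
qed auto

end

section \<open>Strongly quasiconvex subgroups\<close>

lemma (in group) word_ball_generate:
  assumes "S \<subseteq> carrier G"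
  shows "word_ball G S n \<subseteq> generate G S"
proof (induction n)
  case 0
  then show ?case by (simp add: generate.one)
next
  case (Suc n)
  show ?case
  proof
    fix v assume "v \<in> word_ball G S (Suc n)"
    then consider "v \<in> word_ball G S n" | u s where "v \<in> carrier G" "u \<in> word_ball G S n" "s \<in> S"
      "v = u \<otimes> s \<or> u = v \<otimes> s" by auto
    then show "v \<in> generate G S"
    proof cases
      case 2
      have u: "u \<in> generate G S" using 2 Suc by blast
      then have "u \<in> carrier G" using generate_incl[OF assms] by blast
      then have "v = u \<otimes> s \<or> v = u \<otimes> inv s" using 2 assms inv_solve_right[of v u s] by auto
      then show ?thesis using u generate.incl[OF 2(3)] generate.inv[OF 2(3)] by (auto intro: generate.eng)
    qed (use Suc in blast)
  qed
qed

section \<open>Finite generation and distortion of Morse subgroups\<close>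

context cayley
begin

lemma finite_subset_ball:
  assumes "finite F" "F \<subseteq> carrier G"
  shows "\<exists>m. F \<subseteq> wball m"
proof
  show "F \<subseteq> wball (Max (len ` F))"
    using assms by (auto simp flip: len_le_iff intro: Max_ge)
qed

text \<open>Each letter of \<open>T\<close> is a word of length at most \<open>m\<close> over
  \<open>S\<close>. With \<open>H\<close> the whole carrier this also compares two generating sets
  of \<open>G\<close>.\<close>

lemma word_ball_subset:
  assumes T: "T \<subseteq> wball m" and H: "H \<subseteq> carrier G"
  shows "word_ball (G\<lparr>carrier := H\<rparr>) T n \<subseteq> wball (m * n)"
proof (induction n)
  case (Suc n)
  show ?case
  proof
    fix v assume "v \<in> word_ball (G\<lparr>carrier := H\<rparr>) T (Suc n)"
    then consider "v \<in> word_ball (G\<lparr>carrier := H\<rparr>) T n"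
      | u s where "v \<in> H" "u \<in> word_ball (G\<lparr>carrier := H\<rparr>) T n" "s \<in> T" "v = u \<otimes> s \<or> u = v \<otimes> s" by auto
    then show "v \<in> wball (m * Suc n)"
    proof cases
      case 1
      then show ?thesis using Suc ball_mono[of "m * n" "m * Suc n"] by auto
    next
      case 2
      have u: "u \<in> wball (m * n)" and s: "s \<in> wball m" using 2 Suc T by auto
      have "v \<in> carrier G" "s \<in> carrier G" "u \<in> carrier G" using 2 H u s ball_carrier by blast+
      then have "v = u \<otimes> s \<or> v = u \<otimes> inv s" using 2 inv_solve_right[of v u s] by auto
      then have "v \<in> wball (m * n + m)" using ball_mult[OF u s] ball_mult[OF u ball_inv[OF s]] by auto
      then show ?thesis by (simp add: add.commute)
    qed
  qed
qed simp

text \<open>Every geodesic word between points of \<open>H\<close> is followed by elements of \<open>H\<close> with bounded jumps.\<close>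

lemma morse_subgroup_generators:
  assumes H: "subgroup H G" and N: "morse_with_gauge X N (vertex ` H)"
  shows "\<exists>T. finite_generating_set (G\<lparr>carrier := H\<rparr>) T \<and> (\<forall>n. H \<inter> wball n \<subseteq> word_ball (G\<lparr>carrier := H\<rparr>) T n)"
proof -
  let ?K = "G\<lparr>carrier := H\<rparr>"
  interpret H: subgroup H G by fact
  interpret K: group ?K by (rule H.subgroup_is_group[OF is_group])
  obtain R :: nat where R: "N 1 0 \<le> real R" using real_arch_simple by blast
  \<comment> \<open>Consecutive elements of \<open>H\<close> along a geodesic differ by at most
    \<open>R + 1 + R\<close>: from \<open>H\<close> to the geodesic, one step along it, and back to
    \<open>H\<close>.\<close>
  define T where "T = H \<inter> wball (2 * R + 1)"
  have len: "h \<in> word_ball ?K T (len h)" if h: "h \<in> H" for h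
  proof -
    define n where "n = len h"
    have hc: "h \<in> carrier G" using h by simp
    have dn: "mdist X (vertex \<one>) (vertex h) = real n" using mdist_vertex[of \<one> h] hc by (simp add: n_def)
    obtain \<gamma> where \<gamma>: "geodesic_segment X \<gamma> n" "\<gamma> 0 = vertex \<one>" "\<gamma> n = vertex h"
      using vertex_geodesic[of \<one> h] hc unfolding dn by auto
    note g = geodesic_segmentD[OF \<gamma>(1)]
    have q: "quasi_geodesic X 1 0 {0..real n} \<gamma>" by (rule geodesic_segment_quasi_geodesic[OF \<gamma>(1)])
    have "\<forall>i\<in>{..n}. \<exists>k. k \<in> H \<and> mdist X (\<gamma> (real i)) (vertex k) \<le> R"
    proof
      fix i assume "i \<in> {..n}"
      then obtain x where "x \<in> vertex ` H" "mdist X (\<gamma> (real i)) x \<le> N 1 0"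
        using morse_with_gaugeD[OF N _ _ q, of "real i"] \<gamma>(2,3) h H.one_closed by auto
      then show "\<exists>k. k \<in> H \<and> mdist X (\<gamma> (real i)) (vertex k) \<le> R" using R by force
    qed
    from bchoice[OF this] obtain k where
      k: "\<And>i. i \<le> n \<Longrightarrow> k i \<in> H \<and> mdist X (\<gamma> (real i)) (vertex (k i)) \<le> R" by auto
    \<comment> \<open>The ends must be exactly \<open>\<one>\<close> and \<open>h\<close>, not
      merely close to them; if \<open>n = 0\<close> the two values coincide.\<close>
    define w where "w = k(n := h, 0 := \<one>)"
    have w: "w i \<in> H" "mdist X (\<gamma> (real i)) (vertex (w i)) \<le> R" if "i \<le> n" for i
      using k[OF that] h H.one_closed \<gamma> hc that by (auto simp: w_def)
    have "w 0 = \<one>" by (simp add: w_def)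
    have "w n = h"
      using len_0[OF hc] by (auto simp: w_def n_def)
    have "w i \<in> word_ball ?K T i" if "i \<le> n" for i
      using that
    proof (induction i)
      case 0
      then show ?case using \<open>w 0 = \<one>\<close> by simp
    next
      case (Suc i)
      have i: "i \<le> n" "Suc i \<le> n" using Suc.prems by auto
      have wc: "w i \<in> carrier G" "w (Suc i) \<in> carrier G" using w(1)[OF i(1)] w(1)[OF i(2)] by auto
      have m: "\<gamma> (real i) \<in> mspace X" "\<gamma> (real (Suc i)) \<in> mspace X" using g(2) i by auto
      have "mdist X (vertex (w i)) (vertex (w (Suc i))) \<le> mdist X (vertex (w i)) (\<gamma> (real i))
          + mdist X (\<gamma> (real i)) (\<gamma> (real (Suc i))) + mdist X (\<gamma> (real (Suc i))) (vertex (w (Suc i)))"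
        using wc m by (intro mdist_triangle4) auto
      also have "mdist X (\<gamma> (real i)) (\<gamma> (real (Suc i))) = 1" using g(3) i by simp
      finally have "real (len (inv (w i) \<otimes> w (Suc i))) \<le> real (2 * R + 1)"
        using w(2)[OF i(1)] w(2)[OF i(2)] mdist_vertex[OF wc] by (simp add: mdist_commute)
      then have "len (inv (w i) \<otimes> w (Suc i)) \<le> 2 * R + 1" by (simp only: of_nat_le_iff)
      then have "inv (w i) \<otimes> w (Suc i) \<in> wball (2 * R + 1)"
        using len_le_iff[of "inv (w i) \<otimes> w (Suc i)" "2 * R + 1"] wc by simp
      then have "inv (w i) \<otimes> w (Suc i) \<in> T"
        unfolding T_def using w(1)[OF i(1)] w(1)[OF i(2)] by blast
      moreover have "w i \<otimes> (inv (w i) \<otimes> w (Suc i)) = w (Suc i)" using wc by (simp add: m_assoc[symmetric])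
      ultimately obtain s where "s \<in> T" "w (Suc i) = w i \<otimes> s" by metis
      then show ?case using Suc.IH[OF i(1)] w(1)[OF i(2)] by auto
    qed
    from this[of n] show ?thesis by (simp add: \<open>w n = h\<close> flip: n_def)
  qed
  have "word_ball ?K T m \<subseteq> word_ball ?K T n" if "m \<le> n" for m n
    by (rule lift_Suc_mono_le[of "word_ball ?K T", OF _ that]) auto
  then have balls: "H \<inter> wball n \<subseteq> word_ball ?K T n" for n
    using len len_le_iff by (meson H.mem_carrier IntD1 IntD2 subsetD subsetI)
  have T: "T \<subseteq> carrier ?K" by (auto simp: T_def)
  have "H \<subseteq> generate ?K T" using len K.word_ball_generate[OF T] by blast
  moreover have "generate ?K T \<subseteq> H" using K.generate_incl[OF T] by simp
  moreover have "finite T" unfolding T_def by (intro finite_Int disjI2 finite_ball)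
  ultimately have "finite_generating_set ?K T" using T by (auto simp: finite_generating_set_def)
  then show ?thesis using balls by blast
qed

text \<open>\<open>morse_subgroup_generators\<close> controls only one special generating set of
  \<open>H\<close>; an arbitrary \<open>T\<close> is compared with it by word lengths inside
  \<open>H\<close>.\<close>

lemma morse_subgroup_undistorted:
  assumes H: "subgroup H G" and N: "morse_with_gauge X N (vertex ` H)"
    and T: "finite_generating_set (G\<lparr>carrier := H\<rparr>) T"
  shows "\<exists>m\<ge>1. T \<subseteq> wball m \<and> (\<forall>n. H \<inter> wball n \<subseteq> word_ball (G\<lparr>carrier := H\<rparr>) T (m * n))"
proof -
  let ?K = "G\<lparr>carrier := H\<rparr>"
  interpret H: subgroup H G by fact
  interpret K: group ?K by (rule H.subgroup_is_group[OF is_group])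
  interpret K: cayley ?K T by unfold_locales (rule T)
  obtain T' where T': "finite_generating_set ?K T'" "\<And>n. H \<inter> wball n \<subseteq> word_ball ?K T' n"
    using morse_subgroup_generators[OF H N] by blast
  obtain m where m: "T \<subseteq> wball m" using finite_subset_ball[of T] K.S H.subset by auto
  obtain m' where m': "T' \<subseteq> K.wball m'"
    using K.finite_subset_ball[of T'] T'(1) by (auto simp: finite_generating_set_def)
  \<comment> \<open>One number for both comparisons; the successor makes it at least
    \<open>1\<close>, as a multiplicative constant must be.\<close>
  define M where "M = Suc (m + m')"
  have "word_ball ?K T' n \<subseteq> K.wball (M * n)" for n
    using K.word_ball_subset[OF m', of "carrier ?K" n] K.ball_mono[of "m' * n" "M * n"]
    by (auto simp: M_def algebra_simps)
  moreover have "T \<subseteq> wball M" using m ball_mono[of m M] by (auto simp: M_def simp del: word_ball.simps)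
  moreover have "M \<ge> 1" by (simp add: M_def)
  ultimately show ?thesis using T'(2) by blast
qed

text \<open>On vertices both word metrics agree up to the factor \<open>m\<close>. Rounding two
  points changes their distance by at most \<open>2\<close>, which the factor turns into
  \<open>2 * m\<close>.\<close>

lemma undistorted_qi_embedding:
  assumes H: "subgroup H G" and T: "finite_generating_set (G\<lparr>carrier := H\<rparr>) T"
    and m: "m \<ge> 1" "T \<subseteq> wball m" "\<And>n. H \<inter> wball n \<subseteq> word_ball (G\<lparr>carrier := H\<rparr>) T (m * n)"
  shows "\<exists>f. qi_embedding (cayley_graph (G\<lparr>carrier := H\<rparr>) T) X m (2 * m) f \<and>
    (\<forall>h\<in>H. f (vertex h) = vertex h) \<and> f ` mspace (cayley_graph (G\<lparr>carrier := H\<rparr>) T) = vertex ` H"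
proof -
  let ?K = "G\<lparr>carrier := H\<rparr>"
  interpret H: subgroup H G by fact
  interpret K: group ?K by (rule H.subgroup_is_group[OF is_group])
  interpret K: cayley ?K T by unfold_locales (rule T)
  define r where "r y = (SOME u. u \<in> H \<and> mdist K.X y (vertex u) \<le> 1)" for y
  have r: "r y \<in> H \<and> mdist K.X y (vertex (r y)) \<le> 1" if "y \<in> mspace K.X" for y
    unfolding r_def by (rule someI_ex) (use K.vertex_net[OF that] in auto)
  define f where "f y = (if y \<in> vertex ` H then y else vertex (r y))" for y
  have f: "\<exists>u\<in>H. f y = vertex u \<and> mdist K.X y (vertex u) \<le> 1" if "y \<in> mspace K.X" for y
    using r[OF that] that by (auto simp: f_def)
  have fh: "f (vertex h) = vertex h" if "h \<in> H" for h using that by (simp add: f_def)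
  have d: "mdist X (vertex u) (vertex v) \<le> m * mdist K.X (vertex u) (vertex v)"
    "mdist K.X (vertex u) (vertex v) \<le> m * mdist X (vertex u) (vertex v)" if uv: "u \<in> H" "v \<in> H" for u v
  proof -
    \<comment> \<open>After this identification both word metrics evaluate the same element
      \<open>inv u \<otimes> v\<close>.\<close>
    have i: "inv\<^bsub>?K\<^esub> u = inv u" using uv(1) H m_inv_consistent by simp
    have g: "inv u \<otimes> v \<in> H" "inv u \<otimes> v \<in> carrier G" using uv by auto
    have e: "mdist X (vertex u) (vertex v) = len (inv u \<otimes> v)" "mdist K.X (vertex u) (vertex v) = K.len (inv u \<otimes> v)"
      using mdist_vertex[of u v] K.mdist_vertex[of u v] uv i by auto
    have "inv u \<otimes> v \<in> wball (m * K.len (inv u \<otimes> v))"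
      using word_ball_subset[OF m(2) H.subset] K.len_ball[of "inv u \<otimes> v"] g by auto
    then have "len (inv u \<otimes> v) \<le> m * K.len (inv u \<otimes> v)" using len_le_iff g by blast
    moreover have "inv u \<otimes> v \<in> K.wball (m * len (inv u \<otimes> v))"
      using m(3)[of "len (inv u \<otimes> v)"] len_ball g by blast
    then have "K.len (inv u \<otimes> v) \<le> m * len (inv u \<otimes> v)" using K.len_le_iff g by simp
    ultimately show "mdist X (vertex u) (vertex v) \<le> m * mdist K.X (vertex u) (vertex v)"
      "mdist K.X (vertex u) (vertex v) \<le> m * mdist X (vertex u) (vertex v)"
      unfolding e by (metis of_nat_le_iff of_nat_mult)+
  qed
  have "mdist X (f x) (f y) \<le> m * mdist K.X x y + 2 * m \<and> mdist K.X x y \<le> m * mdist X (f x) (f y) + 2 * m"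
    if xy: "x \<in> mspace K.X" "y \<in> mspace K.X" for x y
  proof -
    obtain u where u: "u \<in> H" "f x = vertex u" "mdist K.X x (vertex u) \<le> 1" using f[OF xy(1)] by blast
    obtain v where v: "v \<in> H" "f y = vertex v" "mdist K.X y (vertex v) \<le> 1" using f[OF xy(2)] by blast
    have uv: "vertex u \<in> mspace K.X" "vertex v \<in> mspace K.X" using u v by auto
    have 1: "mdist K.X (vertex u) (vertex v) \<le> mdist K.X x y + 2"
      using mdist_triangle4[OF uv(1) xy uv(2)] u v by (simp add: mdist_commute)
    have 2: "mdist K.X x y \<le> mdist K.X (vertex u) (vertex v) + 2"
      using mdist_triangle4[OF xy(1) uv xy(2)] u v by (simp add: mdist_commute)
    have "real m * mdist K.X (vertex u) (vertex v) \<le> m * (mdist K.X x y + 2)"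
      using 1 by (intro mult_left_mono) auto
    then show ?thesis using d[OF u(1) v(1)] 2 m(1) u(2) v(2) by (simp add: algebra_simps)
  qed
  moreover have "f ` mspace K.X = vertex ` H"
  proof
    show "f ` mspace K.X \<subseteq> vertex ` H" using f by auto
    show "vertex ` H \<subseteq> f ` mspace K.X"
    proof
      fix y assume "y \<in> vertex ` H"
      then obtain h where "h \<in> H" "y = vertex h" by blast
      then have "y = f (vertex h)" "vertex h \<in> mspace K.X" using fh by auto
      then show "y \<in> f ` mspace K.X" by blast
    qed
  qed
  moreover have "vertex ` H \<subseteq> mspace X" using H.subset by auto
  ultimately have "qi_embedding K.X X m (2 * m) f" using m(1) by (auto simp: qi_embedding_def)
  then show ?thesis using fh \<open>f ` mspace K.X = vertex ` H\<close> by blast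
qed

lemma morse_subset_change_generators:
  assumes S': "finite_generating_set G S'" and H: "H \<subseteq> carrier G"
    and morse: "morse_subset (cayley_graph G S') (vertex ` H)"
  shows "morse_subset X (vertex ` H)"
proof -
  interpret S': cayley G S' by unfold_locales (rule S')
  have G: "G\<lparr>carrier := carrier G\<rparr> = G" by simp
  obtain m where m: "S \<subseteq> S'.wball m" using S'.finite_subset_ball S by blast
  obtain m' where m': "S' \<subseteq> wball m'" using finite_subset_ball S'.S by blast
  define M where "M = Suc (m + m')"
  have M: "S \<subseteq> S'.wball M" using m S'.ball_mono[of m M] by (auto simp: M_def simp del: word_ball.simps)
  have "S'.wball n \<subseteq> wball (m' * n)" for n
    using word_ball_subset[OF m' order_refl, of n] by (simp add: G)
  moreover have "wball (m' * n) \<subseteq> wball (M * n)" for n by (rule ball_mono) (simp add: M_def algebra_simps)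
  ultimately have "carrier G \<inter> S'.wball n \<subseteq> wball (M * n)" for n by blast
  then obtain f where f: "qi_embedding X S'.X M (2 * M) f" "\<And>h. h \<in> carrier G \<Longrightarrow> f (vertex h) = vertex h"
    using S'.undistorted_qi_embedding[of "carrier G" S M] fgs M subgroup_self by (auto simp: G M_def)
  obtain N where N: "morse_gauge N" "morse_with_gauge S'.X N (vertex ` H)"
    using morse by (auto simp: morse_subset_def)
  have "f ` vertex ` H = vertex ` H" unfolding image_image by (rule image_cong) (use f(2) H in auto)
  moreover have "vertex ` H \<subseteq> mspace X" using H by auto
  ultimately show ?thesis
    using morse_with_gauge_pullback[OF f(1), of "vertex ` H" N] N unfolding morse_subset_def by metis
qed

lemma strongly_quasiconvex_iff:
  "strongly_quasiconvex G H \<longleftrightarrow> subgroup H G \<and> morse_subset X (vertex ` H)"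
  using morse_subset_change_generators fgs subgroup.subset unfolding strongly_quasiconvex_def by metis

text \<open>What remains is a translation: finite Hausdorff distance of the vertices on
  \<open>\<alpha>\<close> from \<open>\<beta>\<close> amounts to \<open>near\<close>, after which
  the induced map agrees with \<open>boundary_map\<close> on boundary points.\<close>

lemma induced_boundary_map_embedding:
  assumes H: "subgroup H G" and morse: "morse_subset X (vertex ` H)"
    and T: "finite_generating_set (G\<lparr>carrier := H\<rparr>) T"
  shows "embedding_map (group_boundary (G\<lparr>carrier := H\<rparr>) T) (group_boundary G S) (induced_boundary_map G S H)"
    and "induced_boundary_map G S H ` topspace (group_boundary (G\<lparr>carrier := H\<rparr>) T) = group_limit_set G S H"
proof -
  let ?K = "G\<lparr>carrier := H\<rparr>"
  interpret H: subgroup H G by fact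
  interpret K: group ?K by (rule H.subgroup_is_group[OF is_group])
  interpret K: cayley ?K T by unfold_locales (rule T)
  obtain N where N: "morse_gauge N" "morse_with_gauge X N (vertex ` H)"
    using morse by (auto simp: morse_subset_def)
  obtain m where m: "m \<ge> 1" "T \<subseteq> wball m" "\<And>n. H \<inter> wball n \<subseteq> word_ball ?K T (m * n)"
    using morse_subgroup_undistorted[OF H N(2) T] by blast
  obtain f where f: "qi_embedding K.X X m (2 * m) f" "\<And>h. h \<in> H \<Longrightarrow> f (vertex h) = vertex h"
      "f ` mspace K.X = vertex ` H"
    using undistorted_qi_embedding[OF H T m] by blast
  interpret K: ray_space K.X "vertex ` H" "vertex \<one>" using K.cayley_ray_space by simp
  interpret X: ray_space X "vertex ` carrier G" "vertex \<one>" by (rule cayley_ray_space)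
  interpret e: morse_embedding K.X "vertex ` H" "vertex \<one>" X "vertex ` carrier G" "vertex \<one>" f m "2 * m" N
    using f N H.subset by unfold_locales auto
  have near_iff: "finite_hausdorff_distance X (inclusion_image H \<alpha>) (\<beta> ` {0..}) \<longleftrightarrow> e.near \<alpha> \<beta>"
    if \<alpha>: "geodesic_ray K.X (vertex \<one>) \<alpha>" and \<beta>: "geodesic_ray X (vertex \<one>) \<beta>" for \<alpha> \<beta>
  proof -
    note a = geodesic_rayD[OF \<alpha>] and b = geodesic_rayD[OF \<beta>]
    \<comment> \<open>A geodesic ray is at a vertex at every integer time, so some vertex is within
      \<open>1\<close> in the graph of \<open>H\<close>; the embedding turns this into
      \<open>m + 2 * m\<close>.\<close>
    have vx: "\<exists>h\<in>H. vertex h \<in> inclusion_image H \<alpha> \<and> mdist X (f (\<alpha> t)) (vertex h) \<le> 3 * m" if t: "t \<ge> 0" for t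
    proof -
      define n where "n = nat \<lfloor>t\<rfloor>"
      have n: "\<bar>t - real n\<bar> \<le> 1" using t unfolding n_def by linarith
      have "geodesic_segment K.X \<alpha> (real n)" using a by (auto simp: geodesic_segment_def)
      then obtain h where h: "h \<in> H" "\<alpha> (real n) = vertex h"
        using K.geodesic_vertex[of \<alpha> "real n" n] a(1) by auto
      have "mdist X (f (\<alpha> t)) (f (\<alpha> (real n))) \<le> m * mdist K.X (\<alpha> t) (\<alpha> (real n)) + 2 * m"
        using a(2)[OF t] a(2)[of "real n"] by (intro qi_embeddingD(4)[OF f(1)]) auto
      also have "real m * mdist K.X (\<alpha> t) (\<alpha> (real n)) \<le> real m * 1"
        using n a(3)[OF t, of "real n"] by (intro mult_left_mono) auto
      finally have "mdist X (f (\<alpha> t)) (vertex h) \<le> 3 * m" using h f(2) by simp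
      moreover have "vertex h \<in> inclusion_image H \<alpha>"
        unfolding inclusion_image_def using h by (metis (mono_tags, lifting) atLeast_iff imageI mem_Collect_eq of_nat_0_le_iff)
      ultimately show ?thesis using h(1) by blast
    qed
    have fm: "f (\<alpha> t) \<in> mspace X" if "t \<ge> 0" for t using e.f_mspace a(2) that by blast
    have hm: "vertex h \<in> mspace X" if "h \<in> H" for h using that H.subset by auto
    show ?thesis
    proof
      assume "finite_hausdorff_distance X (inclusion_image H \<alpha>) (\<beta> ` {0..})"
      then obtain r where r: "inclusion_image H \<alpha> \<subseteq> metric_nbhd X r (\<beta> ` {0..})"
        unfolding finite_hausdorff_distance_def by blast
      have "\<exists>s\<ge>0. mdist X (f (\<alpha> t)) (\<beta> s) \<le> 3 * m + r" if t: "t \<ge> 0" for t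
      proof -
        obtain h where h: "h \<in> H" "vertex h \<in> inclusion_image H \<alpha>" "mdist X (f (\<alpha> t)) (vertex h) \<le> 3 * m"
          using vx[OF t] by blast
        obtain s where s: "s \<ge> 0" "mdist X (vertex h) (\<beta> s) \<le> r" using r h(2) by (auto simp: metric_nbhd_def)
        have "mdist X (f (\<alpha> t)) (\<beta> s) \<le> 3 * m + r"
          using mdist_triangle[OF fm[OF t] hm[OF h(1)] b(2)[OF s(1)]] h s by simp
        then show ?thesis using s by blast
      qed
      then show "e.near \<alpha> \<beta>" by (auto simp: e.near_def ray_near_def)
    next
      assume n: "e.near \<alpha> \<beta>"
      then obtain D where D: "ray_near X (f \<circ> \<alpha>) \<beta> D" by (auto simp: e.near_def)
      obtain D' where D': "ray_near X \<beta> (f \<circ> \<alpha>) D'" using e.near_sym[OF n \<alpha> \<beta>] by blast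
      have "inclusion_image H \<alpha> \<subseteq> metric_nbhd X (max D (D' + 3 * m)) (\<beta> ` {0..})"
      proof
        fix x assume "x \<in> inclusion_image H \<alpha>"
        then obtain h t where h: "h \<in> H" "x = vertex h" "t \<ge> 0" "vertex h = \<alpha> t"
          by (auto simp: inclusion_image_def)
        obtain s where "s \<ge> 0" "mdist X (f (\<alpha> t)) (\<beta> s) \<le> D" using D h(3) by (auto simp: ray_near_def)
        then have "s \<in> {0..}" "mdist X x (\<beta> s) \<le> max D (D' + 3 * m)"
          using f(2)[OF h(1)] unfolding h(2) h(4)[symmetric] by auto
        then show "x \<in> metric_nbhd X (max D (D' + 3 * m)) (\<beta> ` {0..})"
          using hm[OF h(1)] h(2) by (auto simp: metric_nbhd_def)
      qed
      moreover have "\<beta> ` {0..} \<subseteq> metric_nbhd X (max D (D' + 3 * m)) (inclusion_image H \<alpha>)"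
      proof
        fix x assume "x \<in> \<beta> ` {0..}"
        then obtain s where s: "s \<ge> 0" "x = \<beta> s" by auto
        obtain t where t: "t \<ge> 0" "mdist X (\<beta> s) (f (\<alpha> t)) \<le> D'" using D' s by (auto simp: ray_near_def)
        obtain h where h: "h \<in> H" "vertex h \<in> inclusion_image H \<alpha>" "mdist X (f (\<alpha> t)) (vertex h) \<le> 3 * m"
          using vx[OF t(1)] by blast
        have "mdist X x (vertex h) \<le> max D (D' + 3 * m)"
          using mdist_triangle[OF b(2)[OF s(1)] fm[OF t(1)] hm[OF h(1)]] h t s by simp
        then show "x \<in> metric_nbhd X (max D (D' + 3 * m)) (inclusion_image H \<alpha>)"
          using h(2) b(2)[OF s(1)] s(2) by (auto simp: metric_nbhd_def)
      qed
      ultimately show "finite_hausdorff_distance X (inclusion_image H \<alpha>) (\<beta> ` {0..})"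
        unfolding finite_hausdorff_distance_def by blast
    qed
  qed
  have eq: "induced_boundary_map G S H x = e.boundary_map x" if x: "x \<in> boundary_points K.X (vertex \<one>)" for x
    unfolding induced_boundary_map_def e.boundary_map_def
    using near_iff boundary_points_geodesic_ray[OF x] by (auto simp: morse_rays_def)
  have b: "group_boundary ?K T = morse_boundary K.X (vertex \<one>)" "group_boundary G S = morse_boundary X (vertex \<one>)"
    by (simp_all add: group_boundary_def)
  show "embedding_map (group_boundary ?K T) (group_boundary G S) (induced_boundary_map G S H)"
    unfolding b by (rule embedding_map_eq[OF e.embedding_boundary_map]) (simp add: eq topspace_morse_boundary)
  show "induced_boundary_map G S H ` topspace (group_boundary ?K T) = group_limit_set G S H"
    using e.boundary_map_image eq f(3) unfolding b topspace_morse_boundary group_limit_set_def by (simp cong: image_cong)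
qed

section \<open>Intersections\<close>

text \<open>If \<open>g \<otimes> u \<in> H\<^sub>1\<close> and \<open>g \<otimes> v \<in> H\<^sub>2\<close> with \<open>u\<close>, \<open>v\<close> in a finite ball, then \<open>g \<otimes> inv c \<in> H\<^sub>1 \<inter> H\<^sub>2\<close> for
  any other \<open>c\<close> with the same \<open>u\<close> and \<open>v\<close>, so one such \<open>c\<close> per pair suffices.\<close>

lemma nbhd_Int_subgroups:
  assumes H: "subgroup H\<^sub>1 G" "subgroup H\<^sub>2 G"
  shows "\<exists>r'\<ge>0. metric_nbhd X r (vertex ` H\<^sub>1) \<inter> metric_nbhd X r (vertex ` H\<^sub>2) \<subseteq> metric_nbhd X r' (vertex ` (H\<^sub>1 \<inter> H\<^sub>2))"
proof -
  interpret H1: subgroup H\<^sub>1 G by fact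
  interpret H2: subgroup H\<^sub>2 G by fact
  \<comment> \<open>A vertex \<open>g\<close> within \<open>1\<close> of \<open>x\<close> is within
    \<open>r + 1\<close> of both subgroups, so its offsets \<open>u\<close> and \<open>v\<close> lie
    in the ball of radius \<open>n\<close>.\<close>
  obtain n :: nat where n: "r + 1 \<le> real n" using real_arch_simple by blast
  define P where "P u v g \<longleftrightarrow> g \<in> carrier G \<and> g \<otimes> u \<in> H\<^sub>1 \<and> g \<otimes> v \<in> H\<^sub>2" for u v g
  \<comment> \<open>The value is arbitrary for pairs that no element realises; such values can only
    enlarge \<open>Max F\<close>.\<close>
  define c where "c u v = (SOME g. P u v g)" for u v
  have c: "P u v (c u v)" if "P u v g" for u v g unfolding c_def by (rule someI[of "P u v", OF that])
  define F where "F = (\<lambda>(u, v). len (c u v)) ` (wball n \<times> wball n)"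
  have F: "finite F" using finite_ball by (simp add: F_def)
  have "x \<in> metric_nbhd X (1 + real (Max F)) (vertex ` (H\<^sub>1 \<inter> H\<^sub>2))"
    if x: "x \<in> metric_nbhd X r (vertex ` H\<^sub>1)" "x \<in> metric_nbhd X r (vertex ` H\<^sub>2)" for x
  proof -
    have xm: "x \<in> mspace X" using x by (simp add: metric_nbhd_def)
    obtain g where g: "g \<in> carrier G" "mdist X x (vertex g) \<le> 1" using vertex_net[OF xm] by blast
    have offset: "\<exists>u\<in>wball n. g \<otimes> u \<in> H" if H: "subgroup H G" "x \<in> metric_nbhd X r (vertex ` H)" for H
    proof -
      obtain h where h: "h \<in> H" "mdist X x (vertex h) \<le> r" using H(2) by (auto simp: metric_nbhd_def)
      have hc: "h \<in> carrier G" using h(1) subgroup.subset[OF H(1)] by blast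
      have "mdist X (vertex g) (vertex h) \<le> mdist X (vertex g) x + mdist X x (vertex h)"
        using g hc xm by (intro mdist_triangle) auto
      then have "real (len (inv g \<otimes> h)) \<le> real n"
        using mdist_vertex[OF g(1) hc] g(2) h(2) n by (simp add: mdist_commute)
      then have "inv g \<otimes> h \<in> wball n" using len_le_iff g(1) hc by auto
      moreover have "g \<otimes> (inv g \<otimes> h) = h" using g(1) hc by (simp add: m_assoc[symmetric])
      ultimately show ?thesis using h(1) by metis
    qed
    obtain u where u: "u \<in> wball n" "g \<otimes> u \<in> H\<^sub>1" using offset[OF H(1) x(1)] by blast
    obtain v where v: "v \<in> wball n" "g \<otimes> v \<in> H\<^sub>2" using offset[OF H(2) x(2)] by blast
    have uv: "u \<in> carrier G" "v \<in> carrier G" using u v ball_carrier by blast+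
    define k where "k = c u v"
    have k: "k \<in> carrier G" "k \<otimes> u \<in> H\<^sub>1" "k \<otimes> v \<in> H\<^sub>2"
      using c[of u v g] g u v by (auto simp: P_def k_def)
    \<comment> \<open>The offset cancels, so the same element \<open>g \<otimes> inv k\<close> is a
      quotient of two elements of each subgroup.\<close>
    have quot: "(g \<otimes> w) \<otimes> inv (k \<otimes> w) = g \<otimes> inv k" if "w \<in> carrier G" for w
    proof -
      have "w \<otimes> (inv w \<otimes> inv k) = inv k" using that k(1) by (simp flip: m_assoc)
      then show ?thesis using that g k(1) by (simp add: inv_mult_group m_assoc)
    qed
    have "g \<otimes> inv k \<in> H\<^sub>1 \<inter> H\<^sub>2"
      using quot[OF uv(1)] quot[OF uv(2)] u(2) v(2) k(2,3)
      by (metis H1.m_closed H1.m_inv_closed H2.m_closed H2.m_inv_closed IntI)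
    moreover have "mdist X (vertex g) (vertex (g \<otimes> inv k)) = len k"
      using mdist_vertex[of g "g \<otimes> inv k"] g k by (simp add: m_assoc[symmetric])
    moreover have "len k \<le> Max F" using F u v by (intro Max_ge) (auto simp: F_def k_def)
    moreover have "mdist X x (vertex (g \<otimes> inv k)) \<le> mdist X x (vertex g) + mdist X (vertex g) (vertex (g \<otimes> inv k))"
      using g k xm by (intro mdist_triangle) auto
    ultimately show ?thesis using xm g(2) by (intro metric_nbhdI[of _ _ "vertex (g \<otimes> inv k)"]) auto
  qed
  then show ?thesis by (intro exI[of _ "1 + real (Max F)"]) auto
qed

text \<open>A quasi-geodesic with endpoints in the intersection is close to both subgroups; with the
  larger of the two radii it is close to the intersection.\<close>

lemma morse_subset_Int_subgroups:
  assumes H: "subgroup H\<^sub>1 G" "subgroup H\<^sub>2 G"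
    and morse: "morse_subset X (vertex ` H\<^sub>1)" "morse_subset X (vertex ` H\<^sub>2)"
  shows "morse_subset X (vertex ` (H\<^sub>1 \<inter> H\<^sub>2))"
proof -
  obtain N1 where N1: "morse_with_gauge X N1 (vertex ` H\<^sub>1)" using morse(1) by (auto simp: morse_subset_def)
  obtain N2 where N2: "morse_with_gauge X N2 (vertex ` H\<^sub>2)" using morse(2) by (auto simp: morse_subset_def)
  obtain R where R: "\<And>r. R r \<ge> 0"
    "\<And>r. metric_nbhd X r (vertex ` H\<^sub>1) \<inter> metric_nbhd X r (vertex ` H\<^sub>2) \<subseteq> metric_nbhd X (R r) (vertex ` (H\<^sub>1 \<inter> H\<^sub>2))"
    using nbhd_Int_subgroups[OF H] by metis
  define N where "N K C = R (max (N1 K C) (N2 K C))" for K C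
  have "c ` {a..b} \<subseteq> metric_nbhd X (N K C) (vertex ` (H\<^sub>1 \<inter> H\<^sub>2))"
    if "K \<ge> 1" "C \<ge> 0" "a \<le> b" "quasi_geodesic X K C {a..b} c"
      "c a \<in> vertex ` (H\<^sub>1 \<inter> H\<^sub>2)" "c b \<in> vertex ` (H\<^sub>1 \<inter> H\<^sub>2)" for K C a b c
  proof -
    have e: "c a \<in> vertex ` H\<^sub>1" "c b \<in> vertex ` H\<^sub>1" "c a \<in> vertex ` H\<^sub>2" "c b \<in> vertex ` H\<^sub>2"
      using that by auto
    have "c ` {a..b} \<subseteq> metric_nbhd X (N1 K C) (vertex ` H\<^sub>1)" "c ` {a..b} \<subseteq> metric_nbhd X (N2 K C) (vertex ` H\<^sub>2)"
      using N1 N2 that(1-4) e unfolding morse_with_gauge_def by simp_all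
    then have "c ` {a..b} \<subseteq> metric_nbhd X (max (N1 K C) (N2 K C)) (vertex ` H\<^sub>1)"
      "c ` {a..b} \<subseteq> metric_nbhd X (max (N1 K C) (N2 K C)) (vertex ` H\<^sub>2)"
      using metric_nbhd_le[OF max.cobounded1] metric_nbhd_le[OF max.cobounded2] by (meson order_trans)+
    then show ?thesis using R(2)[of "max (N1 K C) (N2 K C)"] unfolding N_def by blast
  qed
  moreover have "vertex ` (H\<^sub>1 \<inter> H\<^sub>2) \<subseteq> mspace X" using subgroup.subset[OF H(1)] by auto
  ultimately have "morse_with_gauge X N (vertex ` (H\<^sub>1 \<inter> H\<^sub>2))" by (simp add: morse_with_gauge_def)
  moreover have "morse_gauge N" using R(1) by (simp add: morse_gauge_def N_def)
  ultimately show ?thesis by (auto simp: morse_subset_def)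
qed

text \<open>Membership in the two limit sets may be witnessed by different rays; as these are
  asymptotic, one of them stays close to both subgroups.\<close>

lemma limit_set_Int_subgroups:
  assumes H: "subgroup H\<^sub>1 G" "subgroup H\<^sub>2 G"
  shows "limit_set X p (vertex ` (H\<^sub>1 \<inter> H\<^sub>2)) = limit_set X p (vertex ` H\<^sub>1) \<inter> limit_set X p (vertex ` H\<^sub>2)"
proof (intro equalityI subsetI)
  fix x assume "x \<in> limit_set X p (vertex ` (H\<^sub>1 \<inter> H\<^sub>2))"
  then obtain \<alpha> r where x: "x \<in> boundary_points X p" "\<alpha> \<in> x" "\<alpha> ` {0..} \<subseteq> metric_nbhd X r (vertex ` (H\<^sub>1 \<inter> H\<^sub>2))"
    by (auto simp: limit_set_def)
  have "\<alpha> ` {0..} \<subseteq> metric_nbhd X r (vertex ` H\<^sub>1)" "\<alpha> ` {0..} \<subseteq> metric_nbhd X r (vertex ` H\<^sub>2)"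
    using x(3) metric_nbhd_mono[of "vertex ` (H\<^sub>1 \<inter> H\<^sub>2)"] by (meson image_mono inf_le1 inf_le2 order_trans)+
  then show "x \<in> limit_set X p (vertex ` H\<^sub>1) \<inter> limit_set X p (vertex ` H\<^sub>2)"
    using x(1,2) unfolding limit_set_def by blast
next
  fix x assume x: "x \<in> limit_set X p (vertex ` H\<^sub>1) \<inter> limit_set X p (vertex ` H\<^sub>2)"
  then obtain \<alpha> r where xb: "x \<in> boundary_points X p" and \<alpha>: "\<alpha> \<in> x" "\<alpha> ` {0..} \<subseteq> metric_nbhd X r (vertex ` H\<^sub>1)"
    by (auto simp: limit_set_def)
  obtain \<beta> s where \<beta>: "\<beta> \<in> x" "\<beta> ` {0..} \<subseteq> metric_nbhd X s (vertex ` H\<^sub>2)"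
    using x by (auto simp: limit_set_def)
  obtain D where "ray_near X \<alpha> \<beta> D" using boundary_points_near[OF xb \<alpha>(1) \<beta>(1)] by blast
  then have "\<alpha> ` {0..} \<subseteq> metric_nbhd X D (\<beta> ` {0..})"
    using ray_near_nbhd[OF geodesic_ray_mspace[OF boundary_points_geodesic_ray[OF xb \<alpha>(1)]]] by simp
  moreover have "vertex ` H\<^sub>2 \<subseteq> mspace X" using subgroup.subset[OF H(2)] by auto
  ultimately have "\<alpha> ` {0..} \<subseteq> metric_nbhd X (D + s) (vertex ` H\<^sub>2)"
    using metric_nbhd_trans[OF _ \<beta>(2)] by blast
  then have "\<alpha> ` {0..} \<subseteq> metric_nbhd X (max r (D + s)) (vertex ` H\<^sub>2)"
    by (rule order_trans) (rule metric_nbhd_le, simp)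
  moreover from \<alpha>(2) have "\<alpha> ` {0..} \<subseteq> metric_nbhd X (max r (D + s)) (vertex ` H\<^sub>1)"
    by (rule order_trans) (rule metric_nbhd_le, simp)
  ultimately have "\<alpha> ` {0..} \<subseteq> metric_nbhd X (max r (D + s)) (vertex ` H\<^sub>1) \<inter> metric_nbhd X (max r (D + s)) (vertex ` H\<^sub>2)"
    by (simp only: le_inf_iff)
  then have "\<exists>r'. \<alpha> ` {0..} \<subseteq> metric_nbhd X r' (vertex ` (H\<^sub>1 \<inter> H\<^sub>2))"
    using nbhd_Int_subgroups[OF H, of "max r (D + s)"] by (meson order_trans)
  then show "x \<in> limit_set X p (vertex ` (H\<^sub>1 \<inter> H\<^sub>2))"
    using xb \<alpha>(1) unfolding limit_set_def by blast
qed

end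

theorem theorem1p4:
  fixes G :: "('a, 'b) monoid_scheme" and S :: "'a set"
  assumes "group G" and "finite_generating_set G S"
  shows "(\<forall>H. strongly_quasiconvex G H \<longrightarrow>
            (\<exists>T. finite_generating_set (G\<lparr>carrier := H\<rparr>) T) \<and>
            (\<forall>T. finite_generating_set (G\<lparr>carrier := H\<rparr>) T \<longrightarrow>
               embedding_map (group_boundary (G\<lparr>carrier := H\<rparr>) T) (group_boundary G S)
                 (induced_boundary_map G S H) \<and>
               induced_boundary_map G S H ` topspace (group_boundary (G\<lparr>carrier := H\<rparr>) T)
                 = group_limit_set G S H)) \<and>
         (\<forall>H\<^sub>1 H\<^sub>2. strongly_quasiconvex G H\<^sub>1 \<and> strongly_quasiconvex G H\<^sub>2 \<longrightarrow>
            strongly_quasiconvex G (H\<^sub>1 \<inter> H\<^sub>2) \<and>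
            group_limit_set G S (H\<^sub>1 \<inter> H\<^sub>2) = group_limit_set G S H\<^sub>1 \<inter> group_limit_set G S H\<^sub>2)"
proof -
  interpret cayley G S by (intro cayley.intro cayley_axioms.intro assms)
  show ?thesis
  proof (intro conjI allI impI)
    fix H assume "strongly_quasiconvex G H"
    then have H: "subgroup H G" "morse_subset X (vertex ` H)" by (auto simp: strongly_quasiconvex_iff)
    then obtain N where "morse_with_gauge X N (vertex ` H)" by (auto simp: morse_subset_def)
    from morse_subgroup_generators[OF H(1) this]
    show "\<exists>T. finite_generating_set (G\<lparr>carrier := H\<rparr>) T" by blast
    fix T assume "finite_generating_set (G\<lparr>carrier := H\<rparr>) T"
    note e = induced_boundary_map_embedding[OF H this]
    show "embedding_map (group_boundary (G\<lparr>carrier := H\<rparr>) T) (group_boundary G S) (induced_boundary_map G S H)"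
      by (rule e(1))
    show "induced_boundary_map G S H ` topspace (group_boundary (G\<lparr>carrier := H\<rparr>) T) = group_limit_set G S H"
      by (rule e(2))
  next
    fix H\<^sub>1 H\<^sub>2 assume a: "strongly_quasiconvex G H\<^sub>1 \<and> strongly_quasiconvex G H\<^sub>2"
    then show "strongly_quasiconvex G (H\<^sub>1 \<inter> H\<^sub>2)"
      using morse_subset_Int_subgroups subgroups_Inter_pair by (simp add: strongly_quasiconvex_iff)
    show "group_limit_set G S (H\<^sub>1 \<inter> H\<^sub>2) = group_limit_set G S H\<^sub>1 \<inter> group_limit_set G S H\<^sub>2"
      using a limit_set_Int_subgroups by (simp add: strongly_quasiconvex_iff group_limit_set_def)
  qed
qed

end
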